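(* Let $\{X_t\}_{0\le t\le T}\sim\mathrm{EML}(\alpha,\lambda,b,T)$, let $Y(t)$, $t\ge0$, be a real-valued Lévy process independent of $X$ such that $Y=Y(1)$ has a finite non-zero mean $\mathrm E(Y)\ne0$, and put $Z_t=Y(X_t)$, $\nabla Z_t=Z_t-Z_{t-d}$, $c=1/\Gamma(\alpha)$, $a_T=b\,e^{-\lambda T}T^{\alpha-1}/\Gamma(\alpha)$. (i) There is a constant $c'>0$, not depending on $s,t$ below, such that for any $s,t>0$ with $s+t\le T$, as $d=\Delta\to0$, $$\mathrm E(\nabla Z_s\nabla Z_{s+t})\sim c'\Delta^2e^{-\lambda t}t^{\alpha-1},\qquad\mathrm{cov}(\nabla Z_s,\nabla Z_{s+t})\sim c'\Delta^2\big(e^{-\lambda t}t^{\alpha-1}-be^{-\lambda T}T^{\alpha-1}\big).$$ (ii) For any $m\in\mathbb N$ and $0<t_1<\cdots<t_m\le T$, $$\lim_{d\to0}\frac{\mathrm E\big(\prod_{i=1}^m\nabla Z_{t_i}\big)}{\prod_{i=1}^m\mathrm E(\nabla Z_{t_i})}=e^{-\lambda(t_m-t_1)}(c/a_T)^{m-1}\prod_{i=2}^m(t_i-t_{i-1})^{\alpha-1}.$$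
   Context: $u\sim v$ means $u/v\to1$. Parameters: $\alpha\in(0,1]$, $T>0$, $b\in(0,1]$, $\lambda>(\alpha-1)/T$. EML$(\alpha,\lambda,b,T)$ is the nonnegative, nondecreasing process $X$ on $[0,T]$ with $X_0=0$ and stationary increments whose finite-dimensional laws are determined, for $0=t_0<t_1<\cdots<t_m\le T$, $s_j\in\mathbb R$, $S_i=\sum_{j=i}^ms_j$, by $$\mathrm E\big(e^{s_1X_{t_1}+\cdots+s_mX_{t_m}}\big)=1+a_T\sum_{\emptyset\ne C\subset\{1,\dots,m\}}\sum_{k_1,\dots,k_{|C|}\in\mathbb N}t_{C(|C|)}^{\alpha(\sum_ik_i-1)+1}\Big(\prod_{i=1}^{|C|}S_{C(i)}^{k_i}\Big)A(C,\{k_i\}),$$ where $C(i)$ is the $i$-th smallest element of $C$ and, with $q=|C|$, $\tau=t_{C(q)}$, $C_1=\{i\le q:k_i=1\}$, $C_2=\{i\le q:k_i\ge2\}$, $$A(C,\{k_i\})=\int_{Q_C}\Big\{\tfrac{(x_1-x_1')^{\alpha(k_1-1)-1}}{\Gamma((k_1-1)\alpha)}e^{-\lambda\tau(x_1-x_1')}\Big\}^{I(k_1>1)}\prod_{i\in C_2,i\ge2}\Big\{c(x_i'-x_{i-1})^{\alpha-1}\tfrac{(x_i-x_i')^{\alpha(k_i-1)-1}}{\Gamma((k_i-1)\alpha)}\Big\}\prod_{j\in C_1,j\ge2}\{c(x_j-x_{j-1})^{\alpha-1}\}\,e^{-\lambda\tau(x_q-x_1)}\,dx'\,dx,$$ integrating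 over $Q_C$: $t_{C(i)-1}/\tau<x_i'<x_i<t_{C(i)}/\tau$ for $i\in C_2$, $t_{C(j)-1}/\tau<x_j<t_{C(j)}/\tau$ for $j\in C_1$ ($t_{C(i)-1}$ is $t_r$ with $r=C(i)-1$). *)

theory Defs
  imports "HOL-Probability.Probability"
begin

definition covariance :: "'a measure \<Rightarrow> ('a \<Rightarrow> real) \<Rightarrow> ('a \<Rightarrow> real) \<Rightarrow> real" where
  "covariance M U V =
     (\<integral>\<omega>. (U \<omega> - (\<integral>w. U w \<partial>M)) * (V \<omega> - (\<integral>w. V w \<partial>M)) \<partial>M)"

definition nabla :: "real \<Rightarrow> (real \<Rightarrow> 'a \<Rightarrow> real) \<Rightarrow> real \<Rightarrow> 'a \<Rightarrow> real" where
  "nabla d Z t \<omega> = Z t \<omega> - Z (t - d) \<omega>"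

definition cadlag :: "(real \<Rightarrow> real) \<Rightarrow> bool" where
  "cadlag f \<longleftrightarrow>
     (\<forall>t\<ge>0. (f \<longlongrightarrow> f t) (at_right t)) \<and> (\<forall>t>0. \<exists>l. (f \<longlongrightarrow> l) (at_left t))"

text \<open>Every path is required to be cadlag, not just almost every one: this makes the composition
  \<open>\<lambda>\<omega>. Y (X \<omega>) \<omega>\<close> measurable for every nonnegative random variable \<open>X\<close> without
  assuming \<open>M\<close> complete. Stochastic continuity follows from the path regularity and
  stationarity of the increments.\<close>

definition levy_process :: "'a measure \<Rightarrow> (real \<Rightarrow> 'a \<Rightarrow> real) \<Rightarrow> bool" where
  "levy_process M Y \<longleftrightarrow>
     (\<forall>t\<ge>0. Y t \<in> borel_measurable M) \<and>
     (AE \<omega> in M. Y 0 \<omega> = 0) \<and>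
     (\<forall>n (u::nat \<Rightarrow> real). 0 \<le> u 0 \<and> strict_mono_on {0..n} u \<longrightarrow>
        prob_space.indep_vars M (\<lambda>_. borel) (\<lambda>i \<omega>. Y (u (Suc i)) \<omega> - Y (u i) \<omega>) {..<n}) \<and>
     (\<forall>s t. 0 \<le> s \<and> s \<le> t \<longrightarrow>
        distr M borel (\<lambda>\<omega>. Y t \<omega> - Y s \<omega>) = distr M borel (Y (t - s))) \<and>
     (\<forall>\<omega>\<in>space M. cadlag (\<lambda>t. Y t \<omega>))"

text \<open>Stationarity is that of the joint laws of finitely many increments.\<close>

definition stationary_increments ::
    "'a measure \<Rightarrow> real set \<Rightarrow> (real \<Rightarrow> 'a \<Rightarrow> real) \<Rightarrow> bool" where
  "stationary_increments M I X \<longleftrightarrow>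
     (\<forall>n (u::nat \<Rightarrow> real) h. (\<forall>i\<le>n. u i \<in> I \<and> u i + h \<in> I) \<longrightarrow>
        distr M (PiM {..<n} (\<lambda>_. borel))
          (\<lambda>\<omega>. \<lambda>i\<in>{..<n}. X (u (Suc i) + h) \<omega> - X (u i + h) \<omega>) =
        distr M (PiM {..<n} (\<lambda>_. borel))
          (\<lambda>\<omega>. \<lambda>i\<in>{..<n}. X (u (Suc i)) \<omega> - X (u i) \<omega>))"

definition indep_processes ::
    "'a measure \<Rightarrow> real set \<Rightarrow> (real \<Rightarrow> 'a \<Rightarrow> real) \<Rightarrow> real set \<Rightarrow> (real \<Rightarrow> 'a \<Rightarrow> real) \<Rightarrow> bool" where
  "indep_processes M I X J Y \<longleftrightarrow>
     prob_space.indep_var M (PiM I (\<lambda>_. borel)) (\<lambda>\<omega>. \<lambda>t\<in>I. X t \<omega>)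
                            (PiM J (\<lambda>_. borel)) (\<lambda>\<omega>. \<lambda>t\<in>J. Y t \<omega>)"

definition eml_c :: "real \<Rightarrow> real" where
  "eml_c \<alpha> = 1 / Gamma \<alpha>"

definition eml_a :: "real \<Rightarrow> real \<Rightarrow> real \<Rightarrow> real \<Rightarrow> real" where
  "eml_a \<alpha> l b T = b * exp (- l * T) * T powr (\<alpha> - 1) / Gamma \<alpha>"

text \<open>\<open>elt C i\<close> is the \<open>i\<close>-th smallest element of the finite set \<open>C\<close>, counting from 1.\<close>

definition elt :: "nat set \<Rightarrow> nat \<Rightarrow> nat" where
  "elt C i = sorted_list_of_set C ! (i - 1)"

text \<open>The integration variables are a pair \<open>(x, x')\<close>: \<open>x\<close> has coordinates \<open>{1..card C}\<close>, whereas
  \<open>x'\<close> only has the coordinates \<open>i\<close> with \<open>k i \<ge> 2\<close>.\<close>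

definition eml_Q ::
    "(nat \<Rightarrow> real) \<Rightarrow> nat set \<Rightarrow> (nat \<Rightarrow> nat) \<Rightarrow> ((nat \<Rightarrow> real) \<times> (nat \<Rightarrow> real)) set" where
  "eml_Q t C k =
     (let q = card C; \<tau> = t (elt C q) in
      {(x, x').
         (\<forall>i\<in>{1..q}. k i \<ge> 2 \<longrightarrow>
            t (elt C i - 1) / \<tau> < x' i \<and> x' i < x i \<and> x i < t (elt C i) / \<tau>) \<and>
         (\<forall>j\<in>{1..q}. k j = 1 \<longrightarrow>
            t (elt C j - 1) / \<tau> < x j \<and> x j < t (elt C j) / \<tau>)})"

definition eml_A ::
    "real \<Rightarrow> real \<Rightarrow> (nat \<Rightarrow> real) \<Rightarrow> nat set \<Rightarrow> (nat \<Rightarrow> nat) \<Rightarrow> real" where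
  "eml_A \<alpha> l t C k =
     (let q = card C; \<tau> = t (elt C q);
          C1 = {i\<in>{1..q}. k i = 1}; C2 = {i\<in>{1..q}. k i \<ge> 2} in
      LINT (x, x') : eml_Q t C k | (PiM {1..q} (\<lambda>_. lborel) \<Otimes>\<^sub>M PiM C2 (\<lambda>_. lborel)).
        (if k 1 > 1
         then (x 1 - x' 1) powr (\<alpha> * (real (k 1) - 1) - 1) / Gamma ((real (k 1) - 1) * \<alpha>)
                * exp (- l * \<tau> * (x 1 - x' 1))
         else 1) *
        (\<Prod>i\<in>{i\<in>C2. i \<ge> 2}.
           eml_c \<alpha> * (x' i - x (i - 1)) powr (\<alpha> - 1)
             * ((x i - x' i) powr (\<alpha> * (real (k i) - 1) - 1) / Gamma ((real (k i) - 1) * \<alpha>))) *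
        (\<Prod>j\<in>{j\<in>C1. j \<ge> 2}. eml_c \<alpha> * (x j - x (j - 1)) powr (\<alpha> - 1)) *
        exp (- l * \<tau> * (x q - x 1)))"

text \<open>The right-hand side of the formula for the joint moment generating function; here \<open>k\<close>
  ranges over the families of positive integers indexed by \<open>{1..card C}\<close>.\<close>

definition eml_mgf ::
    "real \<Rightarrow> real \<Rightarrow> real \<Rightarrow> real \<Rightarrow> nat \<Rightarrow> (nat \<Rightarrow> real) \<Rightarrow> (nat \<Rightarrow> real) \<Rightarrow> real" where
  "eml_mgf \<alpha> l b T m t s =
     1 + eml_a \<alpha> l b T *
       (\<Sum>C\<in>Pow {1..m} - {{}}.
          \<Sum>\<^sub>\<infinity>k\<in>{1..card C} \<rightarrow>\<^sub>E {1..}.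
            t (elt C (card C)) powr (\<alpha> * (real (\<Sum>i=1..card C. k i) - 1) + 1) *
            (\<Prod>i=1..card C. (\<Sum>j=elt C i..m. s j) ^ k i) *
            eml_A \<alpha> l t C k)"

text \<open>Nonnegativity holds on all of \<open>space M\<close> so that \<open>X t\<close> can be substituted for the time
  parameter of a process indexed by \<open>{0..}\<close>. The integrability conjunct expresses that the
  expectation is finite, as the Bochner integral of a non-integrable function is 0.\<close>

definition eml_process ::
    "'a measure \<Rightarrow> real \<Rightarrow> real \<Rightarrow> real \<Rightarrow> real \<Rightarrow> (real \<Rightarrow> 'a \<Rightarrow> real) \<Rightarrow> bool" where
  "eml_process M \<alpha> l b T X \<longleftrightarrow>
     (\<forall>t\<in>{0..T}. X t \<in> borel_measurable M) \<and>
     (\<forall>t\<in>{0..T}. \<forall>\<omega>\<in>space M. 0 \<le> X t \<omega>) \<and>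
     (AE \<omega> in M. mono_on {0..T} (\<lambda>t. X t \<omega>)) \<and>
     (AE \<omega> in M. X 0 \<omega> = 0) \<and>
     stationary_increments M {0..T} X \<and>
     (\<forall>m\<ge>1. \<forall>t s. t 0 = 0 \<and> strict_mono_on {0..m} t \<and> t m \<le> T \<longrightarrow>
        integrable M (\<lambda>\<omega>. exp (\<Sum>j=1..m. s j * X (t j) \<omega>)) \<and>
        (\<integral>\<omega>. exp (\<Sum>j=1..m. s j * X (t j) \<omega>) \<partial>M) = eml_mgf \<alpha> l b T m t s)"

end

theory Submission
  imports Defs
begin

text \<open>Write \<open>D\<^sub>i = X(t\<^sub>i) - X(t\<^sub>i - d)\<close>. Evaluating the generating function at the \<open>2 m\<close> points
  \<open>t\<^sub>i - d, t\<^sub>i\<close> with exponents \<open>-r, r\<close> makes every partial sum \<open>S\<close> equal to \<open>0\<close> or \<open>r\<close>, and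
  inclusion-exclusion leaves \<open>E(\<Prod>(exp(r D\<^sub>i) - 1))\<close> as a single power series in \<open>r\<close>. For fixed \<open>d\<close>
  its coefficients grow at most geometrically, so letting \<open>r\<close> tend to \<open>0\<close> identifies
  \<open>E(\<Prod>D\<^sub>i)\<close> with the term of the family \<open>k = (1, ..., 1)\<close>, an integral of a continuous function
  over a box of side \<open>d\<close>. Conditioning on \<open>X\<close> and using \<open>E Y(t) = t E Y(1)\<close> together with the
  independence of the increments of \<open>Y\<close> gives \<open>E(\<Prod>\<nabla>Z) = (E Y(1))\<^sup>m E(\<Prod>D\<^sub>i)\<close>.\<close>

section \<open>Levy processes with integrable increments\<close>

text \<open>The generating function is the only handle on \<open>X\<close>. Reading moments off it
  is exact for each fixed \<open>d\<close>, so the bound on the coefficients may depend on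
  \<open>d\<close> in any way; letting \<open>d\<close> tend to 0 is a separate, elementary squeeze
  of the one term that remains. Three obstacles arise on the side of \<open>Y\<close>. Only
  \<open>Y 1\<close> is assumed integrable, so integrability of \<open>Y t\<close>, linearity of its
  mean and at most linear growth of its absolute mean must be derived; the last supplies the
  majorant that justifies conditioning on \<open>X\<close>. Times read off a path of
  \<open>X\<close> may coincide, whereas independence of increments is stated for strictly
  increasing times. And \<open>Y\<close> at a random time must be a measurable functional of the
  pair of paths. Both limits in (i) come from the cases m = 2 and m = 1 of one limit. The covariance
  limit is strictly positive because the assumption on \<open>l\<close> makes
  \<open>exp (- l * t) * t powr (\<alpha> - 1)\<close> strictly decreasing up to \<open>T\<close>,
  and \<open>b \<le> 1\<close>.\<close>

lemma (in prob_space) indep_var_pair_integrals: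
  fixes H :: "'b \<times> 'b \<Rightarrow> real"
  assumes ind: "indep_var S A N B" and H[measurable]: "H \<in> borel_measurable (S \<Otimes>\<^sub>M N)"
  shows "(\<integral>\<^sup>+\<omega>. norm (H (A \<omega>, B \<omega>)) \<partial>M) = (\<integral>\<^sup>+\<omega>. (\<integral>\<^sup>+\<omega>'. norm (H (A \<omega>, B \<omega>')) \<partial>M) \<partial>M)"
    and "integrable M (\<lambda>\<omega>. H (A \<omega>, B \<omega>)) \<Longrightarrow>
      (\<integral>\<omega>. H (A \<omega>, B \<omega>) \<partial>M) = (\<integral>\<omega>. (\<integral>\<omega>'. H (A \<omega>, B \<omega>') \<partial>M) \<partial>M)"
    and "integrable M (\<lambda>\<omega>. H (A \<omega>, B \<omega>)) \<Longrightarrow> integrable M (\<lambda>\<omega>. \<integral>\<omega>'. H (A \<omega>, B \<omega>') \<partial>M)"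
    and "integrable M (\<lambda>\<omega>. H (A \<omega>, B \<omega>)) \<Longrightarrow> AE \<omega>' in M. integrable M (\<lambda>\<omega>. H (A \<omega>, B \<omega>'))"
proof -
  note eq = ind[unfolded indep_var_distribution_eq]
  have A[measurable]: "A \<in> M \<rightarrow>\<^sub>M S" and B[measurable]: "B \<in> M \<rightarrow>\<^sub>M N"
    using eq by auto
  let ?P = "distr M S A" and ?Q = "distr M N B"
  interpret P: prob_space ?P by (rule prob_space_distr) simp
  interpret Q: prob_space ?Q by (rule prob_space_distr) simp
  interpret PQ: pair_prob_space ?P ?Q ..
  have d: "?P \<Otimes>\<^sub>M ?Q = distr M (S \<Otimes>\<^sub>M N) (\<lambda>x. (A x, B x))"
    using eq by simp
  have "(\<integral>\<^sup>+\<omega>. norm (H (A \<omega>, B \<omega>)) \<partial>M) = (\<integral>\<^sup>+z. norm (H z) \<partial>(?P \<Otimes>\<^sub>M ?Q))"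
    unfolding d by (subst nn_integral_distr) auto
  also have "\<dots> = (\<integral>\<^sup>+x. (\<integral>\<^sup>+y. norm (H (x, y)) \<partial>?Q) \<partial>?P)"
    by (subst Q.nn_integral_fst[symmetric]) auto
  also have "\<dots> = (\<integral>\<^sup>+x. (\<integral>\<^sup>+\<omega>'. norm (H (x, B \<omega>')) \<partial>M) \<partial>?P)"
    by (intro nn_integral_cong) (subst nn_integral_distr; simp)
  also have "\<dots> = (\<integral>\<^sup>+\<omega>. (\<integral>\<^sup>+\<omega>'. norm (H (A \<omega>, B \<omega>')) \<partial>M) \<partial>M)"
    by (subst nn_integral_distr) auto
  finally show "(\<integral>\<^sup>+\<omega>. norm (H (A \<omega>, B \<omega>)) \<partial>M) = (\<integral>\<^sup>+\<omega>. (\<integral>\<^sup>+\<omega>'. norm (H (A \<omega>, B \<omega>')) \<partial>M) \<partial>M)" .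
  assume "integrable M (\<lambda>\<omega>. H (A \<omega>, B \<omega>))"
  then have i: "integrable (?P \<Otimes>\<^sub>M ?Q) H"
    unfolding d by (subst integrable_distr_eq) auto
  have in1: "(\<integral>y. H (A \<omega>, y) \<partial>?Q) = (\<integral>\<omega>'. H (A \<omega>, B \<omega>') \<partial>M)" if "\<omega> \<in> space M" for \<omega>
  proof -
    have "A \<omega> \<in> space S" using that by (rule measurable_space[OF A])
    then show ?thesis by (subst integral_distr) simp_all
  qed
  have "(\<integral>\<omega>. H (A \<omega>, B \<omega>) \<partial>M) = (\<integral>z. H z \<partial>(?P \<Otimes>\<^sub>M ?Q))"
    unfolding d by (subst integral_distr) auto
  also have "\<dots> = (\<integral>x. (\<integral>y. H (x, y) \<partial>?Q) \<partial>?P)"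
    using PQ.integral_fst'[OF i] by simp
  also have "\<dots> = (\<integral>\<omega>. (\<integral>y. H (A \<omega>, y) \<partial>?Q) \<partial>M)"
    by (subst integral_distr) auto
  also have "\<dots> = (\<integral>\<omega>. (\<integral>\<omega>'. H (A \<omega>, B \<omega>') \<partial>M) \<partial>M)"
    by (intro Bochner_Integration.integral_cong refl in1)
  finally show "(\<integral>\<omega>. H (A \<omega>, B \<omega>) \<partial>M) = (\<integral>\<omega>. (\<integral>\<omega>'. H (A \<omega>, B \<omega>') \<partial>M) \<partial>M)" .
  have "integrable ?P (\<lambda>x. \<integral>y. H (x, y) \<partial>?Q)"
    using PQ.integrable_fst'[OF i] by simp
  then have "integrable M (\<lambda>\<omega>. \<integral>y. H (A \<omega>, y) \<partial>?Q)"
    by (subst (asm) integrable_distr_eq) auto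
  then show "integrable M (\<lambda>\<omega>. \<integral>\<omega>'. H (A \<omega>, B \<omega>') \<partial>M)"
    by (subst (asm) Bochner_Integration.integrable_cong[OF refl in1]) auto
  have "AE y in ?Q. integrable ?P (\<lambda>x. H (x, y))"
    using PQ.AE_integrable_snd[of "\<lambda>x y. H (x, y)"] i by simp
  then have "AE \<omega>' in M. integrable ?P (\<lambda>x. H (x, B \<omega>'))"
    by (rule AE_distrD[OF B])
  then show "AE \<omega>' in M. integrable M (\<lambda>\<omega>. H (A \<omega>, B \<omega>'))"
  proof (rule AE_mp, intro AE_I2 impI)
    fix \<omega>' assume w: "\<omega>' \<in> space M" and "integrable ?P (\<lambda>x. H (x, B \<omega>'))"
    moreover have "B \<omega>' \<in> space N" using w by (rule measurable_space[OF B])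
    ultimately show "integrable M (\<lambda>\<omega>. H (A \<omega>, B \<omega>'))"
      by (subst (asm) integrable_distr_eq) auto
  qed
qed

text \<open>By Fubini almost every section of \<open>U + V\<close> with the argument of
  \<open>V\<close> frozen is integrable, and one such section differs from \<open>U\<close> only by
  a constant.\<close>

lemma (in prob_space) integrable_indep_summand:
  fixes U V :: "'a \<Rightarrow> real"
  assumes ind: "indep_var borel U borel V" and int: "integrable M (\<lambda>\<omega>. U \<omega> + V \<omega>)"
  shows "integrable M U"
proof -
  have "AE \<omega>' in M. integrable M (\<lambda>\<omega>. U \<omega> + V \<omega>')"
    using indep_var_pair_integrals(4)[OF ind, of "\<lambda>(u, v). u + v"] int by simp
  then obtain \<omega>' where "integrable M (\<lambda>\<omega>. U \<omega> + V \<omega>')"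
    using eventually_happens'[OF ae_filter_bot] by blast
  then have "integrable M (\<lambda>\<omega>. (U \<omega> + V \<omega>') - V \<omega>')"
    by (rule Bochner_Integration.integrable_diff) simp
  then show ?thesis by simp
qed

text \<open>Jensen's inequality conditionally on \<open>U\<close>.\<close>
lemma (in prob_space) expectation_abs_indep_le:
  fixes U V :: "'a \<Rightarrow> real"
  assumes ind: "indep_var borel U borel V" and U: "integrable M U" and V: "integrable M V"
  shows "expectation (\<lambda>\<omega>. \<bar>U \<omega> + expectation V\<bar>) \<le> expectation (\<lambda>\<omega>. \<bar>U \<omega> + V \<omega>\<bar>)"
proof -
  have i: "integrable M (\<lambda>\<omega>. \<bar>U \<omega> + V \<omega>\<bar>)" using U V by simp
  have "expectation (\<lambda>\<omega>. \<bar>U \<omega> + expectation V\<bar>) \<le> (\<integral>\<omega>. (\<integral>\<omega>'. \<bar>U \<omega> + V \<omega>'\<bar> \<partial>M) \<partial>M)"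
  proof (rule integral_mono)
    show "integrable M (\<lambda>\<omega>. \<bar>U \<omega> + expectation V\<bar>)" using U by simp
    show "integrable M (\<lambda>\<omega>. \<integral>\<omega>'. \<bar>U \<omega> + V \<omega>'\<bar> \<partial>M)"
      using indep_var_pair_integrals(3)[OF ind, of "\<lambda>(u, v). \<bar>u + v\<bar>"] i by simp
    fix \<omega>
    have "\<bar>U \<omega> + expectation V\<bar> = \<bar>\<integral>\<omega>'. U \<omega> + V \<omega>' \<partial>M\<bar>"
      using V by (simp add: prob_space)
    also have "\<dots> \<le> (\<integral>\<omega>'. \<bar>U \<omega> + V \<omega>'\<bar> \<partial>M)"
      using integral_abs_bound by blast
    finally show "\<bar>U \<omega> + expectation V\<bar> \<le> (\<integral>\<omega>'. \<bar>U \<omega> + V \<omega>'\<bar> \<partial>M)" .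
  qed
  also have "\<dots> = expectation (\<lambda>\<omega>. \<bar>U \<omega> + V \<omega>\<bar>)"
    using indep_var_pair_integrals(2)[OF ind, of "\<lambda>(u, v). \<bar>u + v\<bar>"] i by simp
  finally show ?thesis .
qed

text \<open>Cauchy's functional equation. Subtracting the linear candidate leaves an additive
  \<open>h\<close> with \<open>h 1 = 0\<close>, hence of period 1. A bound near 0 therefore spreads
  to a global one, which \<open>h (k * t) = k * h t\<close> allows only if
  \<open>h t = 0\<close>.\<close>

lemma additive_bounded_near_zero_imp_linear:
  fixes f :: "real \<Rightarrow> real"
  assumes add: "\<And>s t. 0 \<le> s \<Longrightarrow> 0 \<le> t \<Longrightarrow> f (s + t) = f s + f t"
    and \<delta>: "0 < \<delta>" and bd: "\<And>t. 0 < t \<Longrightarrow> t < \<delta> \<Longrightarrow> \<bar>f t\<bar> \<le> B" and t: "0 \<le> t"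
  shows "f t = t * f 1"
proof -
  define h where "h t = f t - t * f 1" for t
  have hadd: "h (s + t) = h s + h t" if "0 \<le> s" "0 \<le> t" for s t
    using add[OF that] by (simp add: h_def algebra_simps)
  have h0: "h 0 = 0" using hadd[of 0 0] by simp
  have hn: "h (real n * t) = real n * h t" if "0 \<le> t" for n t
  proof (induction n)
    case (Suc n)
    have "h (real (Suc n) * t) = h (real n * t + t)" by (simp add: algebra_simps)
    then show ?case using Suc hadd[of "real n * t" t] that by (simp add: algebra_simps)
  qed (simp add: h0)
  have h1: "h 1 = 0" by (simp add: h_def)
  \<comment> \<open>This \<open>n\<close> makes \<open>t / n < \<delta>\<close> for every
    \<open>t \<le> 1\<close>, so \<open>h t = n * h (t / n)\<close> carries the bound from near 0 to
    [0, 1].\<close>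
  obtain n :: nat where n: "1 / \<delta> < real n" using reals_Archimedean2 by blast
  have npos: "0 < real n" using n \<delta> by (smt (verit) divide_pos_pos)
  have b1: "\<bar>h t\<bar> \<le> real n * (\<bar>B\<bar> + \<bar>\<delta>\<bar> * \<bar>f 1\<bar>)" if "0 \<le> t" "t \<le> 1" for t
  proof (cases "t = 0")
    case False
    have "t / n < \<delta>" "t / n > 0"
      using n npos that False \<delta> by (auto simp: field_simps intro: le_less_trans)
    have "\<bar>h (t / n)\<bar> \<le> \<bar>f (t / n)\<bar> + \<bar>t / n\<bar> * \<bar>f 1\<bar>"
      unfolding h_def abs_mult[symmetric] by (rule abs_triangle_ineq4)
    also have "\<dots> \<le> \<bar>B\<bar> + \<bar>\<delta>\<bar> * \<bar>f 1\<bar>"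
      using bd[OF \<open>t / n > 0\<close> \<open>t / n < \<delta>\<close>] \<open>t / n > 0\<close> \<open>t / n < \<delta>\<close>
      by (intro add_mono mult_right_mono) auto
    finally have "\<bar>h (t / n)\<bar> \<le> \<bar>B\<bar> + \<bar>\<delta>\<bar> * \<bar>f 1\<bar>" .
    moreover have "h t = real n * h (t / n)" using hn[of "t / n" n] npos that by simp
    ultimately show ?thesis using npos by (simp add: abs_mult)
  qed (simp add: h0)
  have bg: "\<bar>h t\<bar> \<le> real n * (\<bar>B\<bar> + \<bar>\<delta>\<bar> * \<bar>f 1\<bar>)" if "0 \<le> t" for t
  proof -
    have "t = real (nat \<lfloor>t\<rfloor>) * 1 + frac t" using that by (simp add: frac_def)
    then have "h t = h (real (nat \<lfloor>t\<rfloor>) * 1) + h (frac t)"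
      using hadd[of "real (nat \<lfloor>t\<rfloor>) * 1" "frac t"] by simp
    then have "h t = h (frac t)" using hn[of 1] h1 by simp
    then show ?thesis using b1[of "frac t"] by (simp add: frac_lt_1 less_imp_le)
  qed
  have "h t = 0"
  proof (rule ccontr)
    assume nz: "h t \<noteq> 0"
    obtain k :: nat where k: "real n * (\<bar>B\<bar> + \<bar>\<delta>\<bar> * \<bar>f 1\<bar>) / \<bar>h t\<bar> < real k"
      using reals_Archimedean2 by blast
    have "\<bar>h (real k * t)\<bar> \<le> real n * (\<bar>B\<bar> + \<bar>\<delta>\<bar> * \<bar>f 1\<bar>)" using bg t by simp
    then have "real k * \<bar>h t\<bar> \<le> real n * (\<bar>B\<bar> + \<bar>\<delta>\<bar> * \<bar>f 1\<bar>)"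
      using hn[OF t, of k] by (simp add: abs_mult)
    then show False using k nz by (simp add: field_simps)
  qed
  then show ?thesis by (simp add: h_def)
qed

text \<open>Values of \<open>X\<close> repeat wherever a path is flat, but the independence clause
  of \<open>levy_process\<close> speaks of strictly increasing times. Repeated times are merged;
  \<open>\<phi>\<close> gives each proper step its position in the merged grid, and its injectivity
  lets products over steps be reindexed. The clause \<open>v N = u n\<close> carries the
  induction.\<close>

lemma compress_weakly_increasing:
  fixes u :: "nat \<Rightarrow> real"
  assumes "\<And>i. i < n \<Longrightarrow> u i \<le> u (Suc i)"
  shows "\<exists>N v \<phi>. strict_mono_on {0..N} v \<and> v 0 = u 0 \<and> v N = u n \<and>
    inj_on \<phi> {i. i < n \<and> u i < u (Suc i)} \<and>
    (\<forall>i. i < n \<and> u i < u (Suc i) \<longrightarrow> \<phi> i < N \<and> v (\<phi> i) = u i \<and> v (Suc (\<phi> i)) = u (Suc i))"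
  using assms
proof (induction n)
  case 0
  then show ?case by (intro exI[of _ "0::nat"] exI[of _ u] exI) (auto simp: strict_mono_on_def)
next
  case (Suc n)
  have "\<exists>N v \<phi>. strict_mono_on {0..N} v \<and> v 0 = u 0 \<and> v N = u n \<and>
    inj_on \<phi> {i. i < n \<and> u i < u (Suc i)} \<and>
    (\<forall>i. i < n \<and> u i < u (Suc i) \<longrightarrow> \<phi> i < N \<and> v (\<phi> i) = u i \<and> v (Suc (\<phi> i)) = u (Suc i))"
    by (rule Suc.IH) (simp add: Suc.prems)
  then obtain N v \<phi> where v: "strict_mono_on {0..N} v" "v 0 = u 0" "v N = u n"
    and \<phi>: "inj_on \<phi> {i. i < n \<and> u i < u (Suc i)}"
      "\<And>i. i < n \<Longrightarrow> u i < u (Suc i) \<Longrightarrow> \<phi> i < N \<and> v (\<phi> i) = u i \<and> v (Suc (\<phi> i)) = u (Suc i)"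
    by blast
  show ?case
  proof (cases "u (Suc n) = u n")
    case True
    then have eq: "i < Suc n \<and> u i < u (Suc i) \<longleftrightarrow> i < n \<and> u i < u (Suc i)" for i
      by (auto simp: less_Suc_eq)
    show ?thesis unfolding eq
      using v \<phi> True by (intro exI[of _ N] exI[of _ v] exI[of _ \<phi>]) auto
  next
    case False
    then have lt: "u n < u (Suc n)" using Suc.prems[of n] by simp
    let ?v = "v(Suc N := u (Suc n))" and ?\<phi> = "\<phi>(n := N)"
    have vle: "v i \<le> v N" if "i \<le> N" for i
      using v(1) that by (cases "i = N") (auto simp: strict_mono_on_def intro: less_imp_le)
    have "strict_mono_on {0..Suc N} ?v"
    proof (rule strict_mono_onI)
      fix r s assume "r \<in> {0..Suc N}" "s \<in> {0..Suc N}" "r < s"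
      then show "?v r < ?v s"
        using vle[of r] v lt by (auto simp: strict_mono_on_def le_Suc_eq)
    qed
    moreover have "inj_on ?\<phi> {i. i < Suc n \<and> u i < u (Suc i)}"
    proof -
      have "{i. i < Suc n \<and> u i < u (Suc i)} = insert n {i. i < n \<and> u i < u (Suc i)}"
        using lt by (auto simp: less_Suc_eq)
      moreover have "inj_on ?\<phi> {i. i < n \<and> u i < u (Suc i)}"
        using \<phi>(1) by (rule inj_on_cong[THEN iffD1, rotated]) auto
      ultimately show ?thesis using \<phi>(2) by (auto simp: image_iff)
    qed
    moreover have "?\<phi> i < Suc N \<and> ?v (?\<phi> i) = u i \<and> ?v (Suc (?\<phi> i)) = u (Suc i)"
      if "i < Suc n \<and> u i < u (Suc i)" for i
      using that \<phi>(2)[of i] v by (cases "i = n") auto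
    moreover have "?v 0 = u 0" "?v (Suc N) = u (Suc n)" using v(2) by auto
    ultimately show ?thesis by blast
  qed
qed

section \<open>Integrability and means of a Levy process with integrable value at time 1\<close>

locale integrable_levy = prob_space M for M :: "'a measure" +
  fixes Y :: "real \<Rightarrow> 'a \<Rightarrow> real"
  assumes levy: "levy_process M Y" and integrable_1: "integrable M (Y 1)"
begin

lemma measurable_Y[measurable]: "0 \<le> t \<Longrightarrow> Y t \<in> borel_measurable M"
  and Y_0: "AE \<omega> in M. Y 0 \<omega> = 0"
  and cadlag_Y: "\<omega> \<in> space M \<Longrightarrow> cadlag (\<lambda>t. Y t \<omega>)"
  and distr_incr: "0 \<le> s \<Longrightarrow> s \<le> t \<Longrightarrow>
        distr M borel (\<lambda>\<omega>. Y t \<omega> - Y s \<omega>) = distr M borel (Y (t - s))"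
  and indep_incr: "0 \<le> u 0 \<Longrightarrow> strict_mono_on {0..n} u \<Longrightarrow>
        indep_vars (\<lambda>_. borel) (\<lambda>i \<omega>. Y (u (Suc i)) \<omega> - Y (u i) \<omega>) {..<n}"
  using levy unfolding levy_process_def by auto

lemma incr_transfer:
  assumes "0 \<le> s" "s \<le> t"
  shows "integrable M (\<lambda>\<omega>. Y t \<omega> - Y s \<omega>) \<longleftrightarrow> integrable M (Y (t - s))"
    and "expectation (\<lambda>\<omega>. Y t \<omega> - Y s \<omega>) = expectation (Y (t - s))"
    and "expectation (\<lambda>\<omega>. \<bar>Y t \<omega> - Y s \<omega>\<bar>) = expectation (\<lambda>\<omega>. \<bar>Y (t - s) \<omega>\<bar>)"
proof -
  have m: "(\<lambda>\<omega>. Y t \<omega> - Y s \<omega>) \<in> borel_measurable M" "Y (t - s) \<in> borel_measurable M"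
    using assms by auto
  have gen: "integrable M (\<lambda>\<omega>. g (Y t \<omega> - Y s \<omega>)) \<longleftrightarrow> integrable M (\<lambda>\<omega>. g (Y (t - s) \<omega>))"
    "expectation (\<lambda>\<omega>. g (Y t \<omega> - Y s \<omega>)) = expectation (\<lambda>\<omega>. g (Y (t - s) \<omega>))"
    if [measurable]: "g \<in> borel_measurable borel" for g :: "real \<Rightarrow> real"
    using integrable_distr_eq[OF m(1), of g] integrable_distr_eq[OF m(2), of g]
      integral_distr[OF m(1), of g] integral_distr[OF m(2), of g] distr_incr[OF assms] by auto
  show "integrable M (\<lambda>\<omega>. Y t \<omega> - Y s \<omega>) \<longleftrightarrow> integrable M (Y (t - s))"
    "expectation (\<lambda>\<omega>. Y t \<omega> - Y s \<omega>) = expectation (Y (t - s))"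
    "expectation (\<lambda>\<omega>. \<bar>Y t \<omega> - Y s \<omega>\<bar>) = expectation (\<lambda>\<omega>. \<bar>Y (t - s) \<omega>\<bar>)"
    using gen[of "\<lambda>x. x"] gen[of abs] by auto
qed

lemma indep_two_incr:
  assumes "0 < t" "t < 1"
  shows "indep_var borel (\<lambda>\<omega>. Y t \<omega> - Y 0 \<omega>) borel (\<lambda>\<omega>. Y 1 \<omega> - Y t \<omega>)"
proof -
  let ?u = "\<lambda>i::nat. if i = 0 then 0 else if i = 1 then t else 1"
  have "indep_vars (\<lambda>_. borel) (\<lambda>i \<omega>. Y (?u (Suc i)) \<omega> - Y (?u i) \<omega>) {..<2}"
    by (rule indep_incr) (use assms in \<open>auto simp: strict_mono_on_def\<close>)
  then have "indep_var (PiM {0} (\<lambda>_. borel)) (\<lambda>\<omega>. restrict (\<lambda>i. Y (?u (Suc i)) \<omega> - Y (?u i) \<omega>) {0})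
      (PiM {1} (\<lambda>_. borel)) (\<lambda>\<omega>. restrict (\<lambda>i. Y (?u (Suc i)) \<omega> - Y (?u i) \<omega>) {1})"
    by (rule indep_var_restrict) auto
  then have "indep_var borel ((\<lambda>f. f 0) \<circ> (\<lambda>\<omega>. restrict (\<lambda>i. Y (?u (Suc i)) \<omega> - Y (?u i) \<omega>) {0}))
      borel ((\<lambda>f. f 1) \<circ> (\<lambda>\<omega>. restrict (\<lambda>i. Y (?u (Suc i)) \<omega> - Y (?u i) \<omega>) {1}))"
    by (rule indep_var_compose) auto
  then show ?thesis by (simp add: comp_def)
qed

text \<open>Below time 1, \<open>Y 1 - Y 0\<close> splits at \<open>t\<close> into independent
  summands, so integrability of the sum passes to the first one; beyond time 1, unit steps are
  peeled off by induction. The ends 0 and 1 stand apart since the grid 0, t, 1 must be strictly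
  increasing.\<close>

lemma integrable_Y:
  assumes "0 \<le> t" shows "integrable M (Y t)"
proof -
  have le1: "integrable M (Y t)" if "0 \<le> t" "t \<le> 1" for t
  proof -
    have "t = 0 \<or> t = 1 \<or> 0 < t \<and> t < 1" using that by linarith
    then consider "t = 0" | "t = 1" | "0 < t" "t < 1" by blast
    then show ?thesis
    proof cases
      case 1
      have "integrable M (\<lambda>_::'a. 0::real)" by simp
      then show ?thesis unfolding 1
        by (subst integrable_cong_AE[where g="\<lambda>_. 0"]) (use Y_0 in auto)
    next
      case 3
      have "integrable M (\<lambda>\<omega>. (Y t \<omega> - Y 0 \<omega>) + (Y 1 \<omega> - Y t \<omega>))"
        using incr_transfer(1)[of 0 1] integrable_1 by simp
      from integrable_indep_summand[OF indep_two_incr[OF 3] this] show ?thesis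
        using incr_transfer(1)[of 0 t] that by simp
    qed (use integrable_1 in simp)
  qed
  have "integrable M (Y t)" if "0 \<le> t" "t \<le> real n" for t n
    using that
  proof (induction n arbitrary: t)
    case (Suc n)
    show ?case
    proof (cases "t \<le> 1")
      case False
      have "integrable M (\<lambda>\<omega>. (Y t \<omega> - Y 1 \<omega>) + Y 1 \<omega>)"
        using Suc.IH[of "t - 1"] Suc.prems False incr_transfer(1)[of 1 t] integrable_1
        by (intro Bochner_Integration.integrable_add) auto
      then show ?thesis by simp
    qed (use le1 Suc.prems in auto)
  qed (use le1 in auto)
  then show ?thesis using assms real_arch_simple by blast
qed

lemma integrable_incr: "0 \<le> s \<Longrightarrow> s \<le> t \<Longrightarrow> integrable M (\<lambda>\<omega>. Y t \<omega> - Y s \<omega>)"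
  using incr_transfer(1) integrable_Y by simp

lemma expectation_Y_add:
  assumes "0 \<le> s" "0 \<le> t"
  shows "expectation (Y (s + t)) = expectation (Y s) + expectation (Y t)"
proof -
  have "expectation (Y (s + t)) = expectation (\<lambda>\<omega>. Y s \<omega> + (Y (s + t) \<omega> - Y s \<omega>))" by simp
  also have "\<dots> = expectation (Y s) + expectation (\<lambda>\<omega>. Y (s + t) \<omega> - Y s \<omega>)"
    using assms by (intro Bochner_Integration.integral_add integrable_Y integrable_incr) auto
  finally show ?thesis using incr_transfer(2)[of s "s + t"] assms by simp
qed

text \<open>Jensen replaces the independent remainder \<open>Y 1 - Y t\<close> by its mean. The
  point is a bound that does not depend on \<open>t\<close>.\<close>

lemma expectation_abs_incr_le:
  assumes "0 < t" "t < 1"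
  shows "expectation (\<lambda>\<omega>. \<bar>(Y t \<omega> - Y 0 \<omega>) + (expectation (Y 1) - expectation (Y t))\<bar>)
    \<le> expectation (\<lambda>\<omega>. \<bar>Y 1 \<omega>\<bar>)"
proof -
  have "expectation (\<lambda>\<omega>. Y 1 \<omega> - Y t \<omega>) = expectation (Y 1) - expectation (Y t)"
    using assms by (intro Bochner_Integration.integral_diff integrable_Y) auto
  then show ?thesis
    using expectation_abs_indep_le[OF indep_two_incr[OF assms]] integrable_incr assms
      incr_transfer(3)[of 0 1] by simp
qed

text \<open>If \<open>E Y\<^sub>t\<close> were unbounded near 0, then along a sequence \<open>t\<^sub>n \<down> 0\<close> right-continuity
  would force \<open>\<bar>Y\<^sub>t - Y\<^sub>0 + E Y\<^sub>1 - E Y\<^sub>t\<bar>\<close> to diverge on every path, although its expectation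
  is bounded.\<close>
lemma expectation_Y_bounded_near_0:
  "\<exists>\<delta>>0. \<exists>B. \<forall>t. 0 < t \<and> t < \<delta> \<longrightarrow> \<bar>expectation (Y t)\<bar> \<le> B"
proof (rule ccontr)
  assume neg: "\<not> ?thesis"
  have "\<exists>t. 0 < t \<and> t < 1 / (real n + 1) \<and> \<bar>expectation (Y t)\<bar> > real n" for n
    using neg[simplified, rule_format, of "1 / (real n + 1)" "real n"] by (auto simp: not_le)
  then obtain t where t: "\<And>n. 0 < t n" "\<And>n. t n < 1 / (real n + 1)"
    "\<And>n. \<bar>expectation (Y (t n))\<bar> > real n" by metis
  have t1: "t n < 1" for n
  proof -
    have "1 / (real n + 1) \<le> 1" by (simp add: field_simps)
    then show ?thesis using t(2)[of n] by linarith
  qed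
  have tlim: "t \<longlonglongrightarrow> 0"
    by (rule tendsto_sandwich[where f="\<lambda>_. 0" and h="\<lambda>n. 1 / (real n + 1)"])
      (use t LIMSEQ_inverse_real_of_nat in
        \<open>auto intro!: always_eventually less_imp_le simp: inverse_eq_divide add.commute\<close>)
  then have tlim': "filterlim t (at_right 0) sequentially"
    by (simp add: filterlim_at t(1) less_imp_neq[OF t(1), symmetric])
  define W where "W n \<omega> = (Y (t n) \<omega> - Y 0 \<omega>) + (expectation (Y 1) - expectation (Y (t n)))" for n \<omega>
  have W[measurable]: "W n \<in> borel_measurable M" for n
    unfolding W_def using t(1)[of n] by (auto intro!: borel_measurable_add borel_measurable_diff measurable_Y)
  have Wi: "integrable M (W n)" for n
    unfolding W_def using t(1)[of n] integrable_incr[of 0 "t n"] by (auto simp: less_imp_le)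
  \<comment> \<open>The summand 1 keeps \<open>K\<close> positive, so that dividing by
    \<open>2 * K\<close> is safe.\<close>
  define K where "K = expectation (\<lambda>\<omega>. \<bar>Y 1 \<omega>\<bar>) + 1"
  have K: "0 < K" unfolding K_def by (simp add: add_nonneg_pos)
  \<comment> \<open>Truncation at 1 lets dominated convergence apply although \<open>W n\<close>
    diverges: the means of \<open>?g n\<close> tend to 1, while the bound on the mean of
    \<open>\<bar>W n \<omega>\<bar>\<close> keeps them at most 1/2.\<close>
  let ?g = "\<lambda>n \<omega>. min 1 (\<bar>W n \<omega>\<bar> / (2 * K))"
  have glim: "(\<lambda>n. ?g n \<omega>) \<longlonglongrightarrow> 1" if "\<omega> \<in> space M" for \<omega>
  proof -
    have "((\<lambda>s. Y s \<omega>) \<longlongrightarrow> Y 0 \<omega>) (at_right 0)"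
      using cadlag_Y[OF that] by (auto simp: cadlag_def)
    then have "(\<lambda>n. Y (t n) \<omega>) \<longlonglongrightarrow> Y 0 \<omega>"
      by (rule filterlim_compose[OF _ tlim'])
    then have "(\<lambda>n. Y (t n) \<omega> - Y 0 \<omega>) \<longlonglongrightarrow> Y 0 \<omega> - Y 0 \<omega>" by (intro tendsto_intros)
    then have "\<forall>\<^sub>F n in sequentially. dist (Y (t n) \<omega> - Y 0 \<omega>) 0 < 1"
      by (intro tendstoD) simp_all
    moreover have "\<forall>\<^sub>F n in sequentially. real n \<ge> 2 * K + 1 + \<bar>expectation (Y 1)\<bar>"
      by (meson eventually_sequentiallyI order.trans real_nat_ceiling_ge of_nat_mono)
    ultimately have "\<forall>\<^sub>F n in sequentially. ?g n \<omega> = 1"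
    proof eventually_elim
      case (elim n)
      have "2 * K \<le> \<bar>W n \<omega>\<bar>" unfolding W_def using elim t(3)[of n] by (simp add: dist_real_def)
      then show ?case using K by (simp add: min_def field_simps)
    qed
    then show ?thesis by (rule tendsto_eventually)
  qed
  have "(\<lambda>n. expectation (?g n)) \<longlonglongrightarrow> expectation (\<lambda>_. 1)"
    by (rule integral_dominated_convergence[where w="\<lambda>_. 1"]) (use glim K in auto)
  then have l: "(\<lambda>n. expectation (?g n)) \<longlonglongrightarrow> 1" by (simp add: prob_space)
  have "expectation (?g n) \<le> 1 / 2" for n
  proof -
    have "expectation (?g n) \<le> expectation (\<lambda>\<omega>. \<bar>W n \<omega>\<bar> / (2 * K))"
    proof (rule integral_mono)
      show "integrable M (?g n)"
        by (rule Bochner_Integration.integrable_bound[where f="\<lambda>_. 1::real"]) (use K in auto)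
    qed (use Wi[of n] in auto)
    also have "\<dots> = expectation (\<lambda>\<omega>. \<bar>W n \<omega>\<bar>) / (2 * K)" by simp
    also have "\<dots> \<le> K / (2 * K)"
      using expectation_abs_incr_le[OF t(1) t1, of n] K unfolding W_def K_def
      by (intro divide_right_mono) auto
    finally show ?thesis using K by simp
  qed
  then have "1 \<le> (1 / 2 :: real)" by (intro LIMSEQ_le_const2[OF l]) auto
  then show False by simp
qed

lemma expectation_Y: "0 \<le> t \<Longrightarrow> expectation (Y t) = t * expectation (Y 1)"
proof -
  assume t: "0 \<le> t"
  obtain \<delta> B where "\<delta> > 0" "\<And>t. 0 < t \<Longrightarrow> t < \<delta> \<Longrightarrow> \<bar>expectation (Y t)\<bar> \<le> B"
    using expectation_Y_bounded_near_0 by auto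
  then show ?thesis
    by (intro additive_bounded_near_zero_imp_linear[where f="\<lambda>t. expectation (Y t)"])
      (use t expectation_Y_add in auto)
qed

text \<open>This becomes the integrable majorant once \<open>t\<close> is replaced by an increment
  of \<open>X\<close>. On [0, 1] the shift in the Jensen bound is undone by the triangle inequality,
  and each further unit of time adds at most \<open>K\<close>.\<close>

lemma expectation_abs_Y_linear_bound:
  "\<exists>K\<ge>0. \<forall>t\<ge>0. expectation (\<lambda>\<omega>. \<bar>Y t \<omega>\<bar>) \<le> K * (1 + t)"
proof -
  let ?e = "\<lambda>t. expectation (\<lambda>\<omega>. \<bar>Y t \<omega>\<bar>)"
  \<comment> \<open>The second term pays for the shift
    \<open>expectation (Y 1) - expectation (Y t)\<close>, which equals
    \<open>(1 - t) * expectation (Y 1)\<close>.\<close>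
  define K where "K = ?e 1 + \<bar>expectation (Y 1)\<bar>"
  have K: "0 \<le> K" unfolding K_def by simp
  have le1: "?e t \<le> K" if "0 \<le> t" "t \<le> 1" for t
  proof -
    have "t = 0 \<or> t = 1 \<or> 0 < t \<and> t < 1" using that by linarith
    then consider "t = 0" | "t = 1" | "0 < t" "t < 1" by blast
    then show ?thesis
    proof cases
      case 1
      have "?e 0 = expectation (\<lambda>_. 0)"
        by (rule integral_cong_AE) (use Y_0 in auto)
      then show ?thesis using 1 K by simp
    next
      case 3
      let ?m = "expectation (Y 1) - expectation (Y t)"
      have i: "integrable M (\<lambda>\<omega>. Y t \<omega> - Y 0 \<omega>)" using integrable_incr that by simp
      have "?e t = expectation (\<lambda>\<omega>. \<bar>Y t \<omega> - Y 0 \<omega>\<bar>)"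
        using incr_transfer(3)[of 0 t] that by simp
      also have "\<dots> \<le> expectation (\<lambda>\<omega>. \<bar>(Y t \<omega> - Y 0 \<omega>) + ?m\<bar> + \<bar>?m\<bar>)"
        by (rule integral_mono) (use i in auto)
      also have "\<dots> = expectation (\<lambda>\<omega>. \<bar>(Y t \<omega> - Y 0 \<omega>) + ?m\<bar>) + \<bar>?m\<bar>"
        using i by (subst Bochner_Integration.integral_add) (auto simp: prob_space)
      also have "\<dots> \<le> ?e 1 + \<bar>expectation (Y 1)\<bar>"
      proof (rule add_mono)
        have "?m = (1 - t) * expectation (Y 1)"
          using expectation_Y[of t] that by (simp add: algebra_simps)
        then have "\<bar>?m\<bar> = (1 - t) * \<bar>expectation (Y 1)\<bar>"
          using that by (simp add: abs_mult)
        also have "\<dots> \<le> 1 * \<bar>expectation (Y 1)\<bar>" using that by (intro mult_right_mono) auto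
        finally show "\<bar>?m\<bar> \<le> \<bar>expectation (Y 1)\<bar>" by simp
      qed (use expectation_abs_incr_le[OF 3] in auto)
      finally show ?thesis by (simp add: K_def)
    qed (simp add: K_def)
  qed
  have "?e t \<le> K * (1 + t)" if "0 \<le> t" "t \<le> real n" for t n
    using that
  proof (induction n arbitrary: t)
    case (Suc n)
    show ?case
    proof (cases "t \<le> 1")
      case True
      then show ?thesis using le1[of t] K Suc.prems mult_left_mono[of 1 "1 + t" K] by simp
    next
      case False
      have i: "integrable M (\<lambda>\<omega>. Y t \<omega> - Y 1 \<omega>)" using integrable_incr False by simp
      have "?e t \<le> expectation (\<lambda>\<omega>. \<bar>Y t \<omega> - Y 1 \<omega>\<bar> + \<bar>Y 1 \<omega>\<bar>)"
        by (rule integral_mono) (use i integrable_1 integrable_Y Suc.prems in auto)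
      also have "\<dots> = ?e (t - 1) + ?e 1"
        using i integrable_1 incr_transfer(3)[of 1 t] False by simp
      also have "\<dots> \<le> K * (1 + (t - 1)) + K"
        using Suc.IH[of "t - 1"] False Suc.prems le1[of 1] by (intro add_mono) auto
      finally show ?thesis by (simp add: algebra_simps)
    qed
  qed (use le1[of 0] in auto)
  then show ?thesis using K real_arch_simple by blast
qed

text \<open>Here \<open>u\<close> stands for a frozen path of \<open>X\<close> at finitely many
  times. A step of length 0 in \<open>J\<close> makes the product of increments and the product of
  means vanish; otherwise all steps of \<open>J\<close> survive the merging of repeated times, and
  independence factorises the expectations.\<close>

lemma expectation_prod_incr:
  fixes u :: "nat \<Rightarrow> real"
  assumes u0: "0 \<le> u 0" and mono: "\<And>i. i < n \<Longrightarrow> u i \<le> u (Suc i)" and J: "J \<subseteq> {..<n}"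
  shows "integrable M (\<lambda>\<omega>. \<Prod>i\<in>J. Y (u (Suc i)) \<omega> - Y (u i) \<omega>)"
    and "expectation (\<lambda>\<omega>. \<Prod>i\<in>J. Y (u (Suc i)) \<omega> - Y (u i) \<omega>)
      = (\<Prod>i\<in>J. (u (Suc i) - u i) * expectation (Y 1))"
    and "expectation (\<lambda>\<omega>. \<bar>\<Prod>i\<in>J. Y (u (Suc i)) \<omega> - Y (u i) \<omega>\<bar>)
      \<le> (\<Prod>i\<in>J. expectation (\<lambda>\<omega>. \<bar>Y (u (Suc i) - u i) \<omega>\<bar>))"
proof -
  let ?D = "\<lambda>i \<omega>. Y (u (Suc i)) \<omega> - Y (u i) \<omega>"
  have fin: "finite J" using J finite_subset by blast
  have u_nn: "0 \<le> u i" if "i \<le> n" for i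
    using that by (induction i) (use u0 mono in \<open>auto intro: order_trans\<close>)
  have "integrable M (\<lambda>\<omega>. \<Prod>i\<in>J. ?D i \<omega>) \<and>
    expectation (\<lambda>\<omega>. \<Prod>i\<in>J. ?D i \<omega>) = (\<Prod>i\<in>J. (u (Suc i) - u i) * expectation (Y 1)) \<and>
    expectation (\<lambda>\<omega>. \<bar>\<Prod>i\<in>J. ?D i \<omega>\<bar>) \<le> (\<Prod>i\<in>J. expectation (\<lambda>\<omega>. \<bar>Y (u (Suc i) - u i) \<omega>\<bar>))"
  proof (cases "\<exists>i\<in>J. u (Suc i) = u i")
    case True
    then obtain i where i: "i \<in> J" "u (Suc i) = u i" by blast
    then have z: "(\<Prod>i\<in>J. ?D i \<omega>) = 0" for \<omega> using fin i by (intro prod_zero bexI[of _ i]) auto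
    moreover have "(\<Prod>i\<in>J. (u (Suc i) - u i) * expectation (Y 1)) = 0"
      using fin i by (auto intro!: prod_zero)
    ultimately show ?thesis by (auto intro!: prod_nonneg)
  next
    case False
    obtain N v \<phi> where v: "strict_mono_on {0..N} v" "v 0 = u 0"
      and inj: "inj_on \<phi> {i. i < n \<and> u i < u (Suc i)}"
      and \<phi>: "\<And>i. i < n \<Longrightarrow> u i < u (Suc i) \<Longrightarrow>
        \<phi> i < N \<and> v (\<phi> i) = u i \<and> v (Suc (\<phi> i)) = u (Suc i)"
      using compress_weakly_increasing[of n u] mono by blast
    have Jn: "i < n" "u i < u (Suc i)" if "i \<in> J" for i
      using J False that mono[of i] by force+
    have injJ: "inj_on \<phi> J" using inj by (rule inj_on_subset) (use Jn in auto)
    have im: "\<phi> ` J \<subseteq> {..<N}" using \<phi> Jn by blast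
    let ?E = "\<lambda>i \<omega>. Y (v (Suc i)) \<omega> - Y (v i) \<omega>"
    have ind: "indep_vars (\<lambda>_. borel) ?E (\<phi> ` J)"
      using indep_vars_subset[OF indep_incr[OF _ v(1)] im] v(2) u0 by simp
    have ED: "?E (\<phi> i) = ?D i" if "i \<in> J" for i using \<phi>[OF Jn[OF that]] by auto
    have Di: "integrable M (?D i)" if "i \<in> J" for i
      using integrable_incr u_nn[of i] Jn[OF that] by (simp add: less_imp_le)
    have int: "integrable M (?E j)" if "j \<in> \<phi> ` J" for j using that ED Di by auto
    have rw: "(\<Prod>j\<in>\<phi> ` J. f (?E j)) = (\<Prod>i\<in>J. f (?D i))" for f :: "('a \<Rightarrow> real) \<Rightarrow> real"
      using ED by (simp add: prod.reindex[OF injJ])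
    have rw': "(\<Prod>j\<in>\<phi> ` J. ?E j \<omega>) = (\<Prod>i\<in>J. ?D i \<omega>)"
      "(\<Prod>j\<in>\<phi> ` J. \<bar>?E j \<omega>\<bar>) = (\<Prod>i\<in>J. \<bar>?D i \<omega>\<bar>)" for \<omega>
      using rw[of "\<lambda>f. f \<omega>"] rw[of "\<lambda>f. \<bar>f \<omega>\<bar>"] by simp_all
    have m: "expectation (?D i) = (u (Suc i) - u i) * expectation (Y 1)"
      "expectation (\<lambda>\<omega>. \<bar>?D i \<omega>\<bar>) = expectation (\<lambda>\<omega>. \<bar>Y (u (Suc i) - u i) \<omega>\<bar>)" if "i \<in> J" for i
      using incr_transfer(2,3)[of "u i" "u (Suc i)"] expectation_Y[of "u (Suc i) - u i"]
        u_nn[of i] Jn[OF that] by auto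
    have "integrable M (\<lambda>\<omega>. \<Prod>j\<in>\<phi> ` J. ?E j \<omega>)"
      by (rule indep_vars_integrable) (use fin ind int in auto)
    then have 1: "integrable M (\<lambda>\<omega>. \<Prod>i\<in>J. ?D i \<omega>)" by (simp only: rw')
    have "expectation (\<lambda>\<omega>. \<Prod>j\<in>\<phi> ` J. ?E j \<omega>) = (\<Prod>j\<in>\<phi> ` J. expectation (?E j))"
      by (rule indep_vars_lebesgue_integral) (use fin ind int in auto)
    then have 2: "expectation (\<lambda>\<omega>. \<Prod>i\<in>J. ?D i \<omega>) = (\<Prod>i\<in>J. (u (Suc i) - u i) * expectation (Y 1))"
      using rw[of expectation] m by (simp add: rw' cong: prod.cong)
    have "indep_vars (\<lambda>_. borel) (\<lambda>j \<omega>. \<bar>?E j \<omega>\<bar>) (\<phi> ` J)"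
      using indep_vars_compose2[OF ind, of "\<lambda>_. abs" "\<lambda>_. borel"] by simp
    then have "expectation (\<lambda>\<omega>. \<Prod>j\<in>\<phi> ` J. \<bar>?E j \<omega>\<bar>) = (\<Prod>j\<in>\<phi> ` J. expectation (\<lambda>\<omega>. \<bar>?E j \<omega>\<bar>))"
      by (intro indep_vars_lebesgue_integral) (use fin int in auto)
    then have 3: "expectation (\<lambda>\<omega>. \<bar>\<Prod>i\<in>J. ?D i \<omega>\<bar>) = (\<Prod>i\<in>J. expectation (\<lambda>\<omega>. \<bar>Y (u (Suc i) - u i) \<omega>\<bar>))"
      using rw[of "\<lambda>f. expectation (\<lambda>\<omega>. \<bar>f \<omega>\<bar>)"] m by (simp add: rw' abs_prod cong: prod.cong)
    show ?thesis using 1 2 3 by simp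
  qed
  then show "integrable M (\<lambda>\<omega>. \<Prod>i\<in>J. ?D i \<omega>)"
    "expectation (\<lambda>\<omega>. \<Prod>i\<in>J. ?D i \<omega>) = (\<Prod>i\<in>J. (u (Suc i) - u i) * expectation (Y 1))"
    "expectation (\<lambda>\<omega>. \<bar>\<Prod>i\<in>J. ?D i \<omega>\<bar>) \<le> (\<Prod>i\<in>J. expectation (\<lambda>\<omega>. \<bar>Y (u (Suc i) - u i) \<omega>\<bar>))"
    by auto
qed

end

section \<open>Subordination by an independent process\<close>

text \<open>Evaluation of a path at a point is not jointly measurable on an uncountable product, so a
  right-continuous path is recovered from its values on countable grids.\<close>
definition right_eval :: "real \<Rightarrow> (real \<Rightarrow> real) \<Rightarrow> real" where
  "right_eval x y = lim (\<lambda>n. y (max 0 ((real_of_int \<lfloor>real (Suc n) * x\<rfloor> + 1) / real (Suc n))))"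

text \<open>The sampling points exceed \<open>x\<close> strictly and by at most
  \<open>1 / Suc n\<close>, so right-continuity at \<open>x\<close> suffices. For
  \<open>x \<ge> 0\<close> the \<open>max 0\<close> changes nothing; it keeps the sampled argument
  in the index set for every input.\<close>

lemma right_eval_eq:
  assumes x: "0 \<le> x" and y: "(y \<longlongrightarrow> y x) (at_right x)"
  shows "right_eval x y = y x"
proof -
  let ?r = "\<lambda>n. (real_of_int \<lfloor>real (Suc n) * x\<rfloor> + 1) / real (Suc n)"
  have gt: "x < ?r n" for n
  proof -
    have "real (Suc n) * x < real_of_int \<lfloor>real (Suc n) * x\<rfloor> + 1" by linarith
    then show ?thesis by (simp add: field_simps)
  qed
  have le: "?r n \<le> x + 1 / real (Suc n)" for n
  proof -
    have "real_of_int \<lfloor>real (Suc n) * x\<rfloor> + 1 \<le> real (Suc n) * x + 1" by linarith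
    then have "?r n \<le> (real (Suc n) * x + 1) / real (Suc n)" by (rule divide_right_mono) simp
    then show ?thesis by (simp add: add_divide_distrib)
  qed
  have "?r \<longlonglongrightarrow> x"
  proof (rule tendsto_sandwich)
    show "\<forall>\<^sub>F n in sequentially. x \<le> ?r n"
      by (intro always_eventually allI less_imp_le gt)
    show "\<forall>\<^sub>F n in sequentially. ?r n \<le> x + 1 / real (Suc n)"
      by (intro always_eventually allI le)
    have "(\<lambda>n. x + 1 / real (Suc n)) \<longlonglongrightarrow> x + 0"
      by (intro tendsto_intros LIMSEQ_Suc lim_1_over_n)
    then show "(\<lambda>n. x + 1 / real (Suc n)) \<longlonglongrightarrow> x" by (simp only: add_0_right)
  qed simp
  then have "filterlim ?r (at_right x) sequentially"
    unfolding filterlim_at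
    by (intro conjI always_eventually allI) (simp_all only: greaterThan_iff gt less_imp_neq[OF gt, symmetric] not_False_eq_True)
  then have "(\<lambda>n. y (?r n)) \<longlonglongrightarrow> y x"
    by (rule filterlim_compose[OF y])
  moreover have "max 0 (?r n) = ?r n" for n
    by (rule max_absorb2) (use x gt[of n] in linarith)
  ultimately show ?thesis unfolding right_eval_def by (simp only: limI)
qed

text \<open>For fixed \<open>n\<close> the sampled argument depends on the first path only through
  an integer, hence takes countably many values, and for each of them the map is a coordinate
  projection of the second factor. Measurability survives the countable gluing and the limit in
  \<open>n\<close>.\<close>

lemma measurable_right_eval:
  fixes t :: real
  assumes t: "t \<in> I"
  shows "(\<lambda>z. right_eval (fst z t) (snd z)) \<in>
    borel_measurable (PiM I (\<lambda>_. borel) \<Otimes>\<^sub>M PiM {0..} (\<lambda>_. borel))"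
proof -
  let ?N = "PiM I (\<lambda>_. borel) \<Otimes>\<^sub>M PiM {0..} (\<lambda>_. borel) :: ((real \<Rightarrow> real) \<times> (real \<Rightarrow> real)) measure"
  have [measurable]: "(\<lambda>z. fst z t) \<in> borel_measurable ?N"
    using t by measurable
  have *: "(\<lambda>z. snd z (max 0 ((real_of_int \<lfloor>real (Suc n) * fst z t\<rfloor> + 1) / real (Suc n))))
      \<in> borel_measurable ?N" for n
  proof (rule measurable_compose_countable[where
        f="\<lambda>(k::int) z. snd z (max 0 ((real_of_int k + 1) / real (Suc n)))"])
    fix k :: int
    have "max 0 ((real_of_int k + 1) / real (Suc n)) \<in> {0..}" by simp
    then show "(\<lambda>z. snd z (max 0 ((real_of_int k + 1) / real (Suc n)))) \<in> borel_measurable ?N"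
      by (intro measurable_compose[OF measurable_snd] measurable_component_singleton)
    show "(\<lambda>z. \<lfloor>real (Suc n) * fst z t\<rfloor>) \<in> ?N \<rightarrow>\<^sub>M count_space UNIV"
      by measurable
  qed
  show ?thesis unfolding right_eval_def by (rule borel_measurable_lim_metric[OF *])
qed

context integrable_levy
begin

text \<open>Conditioning on \<open>X\<close> is Fubini on the product of the two path laws, with
  deterministic times inside. The integrability hypothesis has factors 1 plus an increment because
  absolute means of \<open>Y\<close> are controlled by \<open>K * (1 + t)\<close>.\<close>

lemma expectation_subordinated_prod:
  fixes X :: "real \<Rightarrow> 'a \<Rightarrow> real" and p :: "nat \<Rightarrow> real"
  assumes ind: "indep_processes M I X {0..} Y"
    and Xnn: "\<And>t \<omega>. t \<in> I \<Longrightarrow> \<omega> \<in> space M \<Longrightarrow> 0 \<le> X t \<omega>"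
    and p: "\<And>i. i \<le> n \<Longrightarrow> p i \<in> I"
    and mono: "\<And>i. i < n \<Longrightarrow> AE \<omega> in M. X (p i) \<omega> \<le> X (p (Suc i)) \<omega>"
    and J: "J \<subseteq> {..<n}"
    and int: "integrable M (\<lambda>\<omega>. \<Prod>i\<in>J. 1 + (X (p (Suc i)) \<omega> - X (p i) \<omega>))"
  shows "integrable M (\<lambda>\<omega>. \<Prod>i\<in>J. Y (X (p (Suc i)) \<omega>) \<omega> - Y (X (p i) \<omega>) \<omega>)"
    and "expectation (\<lambda>\<omega>. \<Prod>i\<in>J. Y (X (p (Suc i)) \<omega>) \<omega> - Y (X (p i) \<omega>) \<omega>)
      = expectation (\<lambda>\<omega>. \<Prod>i\<in>J. X (p (Suc i)) \<omega> - X (p i) \<omega>) * expectation (Y 1) ^ card J"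
proof -
  let ?S = "PiM I (\<lambda>_. borel) :: (real \<Rightarrow> real) measure"
  let ?N = "PiM {0..} (\<lambda>_. borel) :: (real \<Rightarrow> real) measure"
  let ?A = "\<lambda>\<omega>. \<lambda>t\<in>I. X t \<omega>" and ?B = "\<lambda>\<omega>. \<lambda>t\<in>{0..}. Y t \<omega>"
  let ?W = "\<lambda>\<omega> \<omega>'. \<Prod>i\<in>J. Y (X (p (Suc i)) \<omega>) \<omega>' - Y (X (p i) \<omega>) \<omega>'"
  \<comment> \<open>\<open>H\<close> is measurable on pairs of paths and is known to agree with
    \<open>?W\<close> on paths coming from \<open>space M\<close>; integrals are moved between the
    two by congruence.\<close>
  define H where "H z = (\<Prod>i\<in>J. right_eval (fst z (p (Suc i))) (snd z) - right_eval (fst z (p i)) (snd z))" for z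
  have iv: "indep_var ?S ?A ?N ?B" using ind by (simp add: indep_processes_def)
  have pJ: "p i \<in> I" "p (Suc i) \<in> I" if "i \<in> J" for i using p[of i] p[of "Suc i"] J that by auto
  have H[measurable]: "H \<in> borel_measurable (?S \<Otimes>\<^sub>M ?N)"
    unfolding H_def by (intro borel_measurable_prod borel_measurable_diff measurable_right_eval pJ)
  \<comment> \<open>Restricting a path of \<open>Y\<close> to \<open>{0..}\<close> does not disturb
    its right limit at \<open>X t \<omega> \<ge> 0\<close>, as only larger arguments enter.\<close>
  have ev: "right_eval (X t \<omega>) (?B \<omega>') = Y (X t \<omega>) \<omega>'"
    if "t \<in> I" "\<omega> \<in> space M" "\<omega>' \<in> space M" for t \<omega> \<omega>'
  proof -
    have nn: "0 \<le> X t \<omega>" using Xnn that by simp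
    have "((\<lambda>s. Y s \<omega>') \<longlongrightarrow> Y (X t \<omega>) \<omega>') (at_right (X t \<omega>))"
      using cadlag_Y[OF that(3)] nn by (simp add: cadlag_def)
    moreover have "\<forall>\<^sub>F s in at_right (X t \<omega>). Y s \<omega>' = ?B \<omega>' s"
      by (rule eventually_mono[OF eventually_at_right_less]) (use nn in auto)
    ultimately have "(?B \<omega>' \<longlongrightarrow> Y (X t \<omega>) \<omega>') (at_right (X t \<omega>))"
      by (rule Lim_transform_eventually)
    moreover have B: "?B \<omega>' (X t \<omega>) = Y (X t \<omega>) \<omega>'" using nn by simp
    ultimately have "(?B \<omega>' \<longlongrightarrow> ?B \<omega>' (X t \<omega>)) (at_right (X t \<omega>))" by (simp only:)
    from right_eval_eq[OF nn this] B show ?thesis by (simp only:)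
  qed
  have HA: "H (?A \<omega>, ?B \<omega>') = ?W \<omega> \<omega>'" if "\<omega> \<in> space M" "\<omega>' \<in> space M" for \<omega> \<omega>'
    unfolding H_def by (intro prod.cong refl) (simp add: ev pJ that)
  have Xm: "X t \<in> borel_measurable M" if "t \<in> I" for t
  proof -
    have "?A \<in> M \<rightarrow>\<^sub>M ?S" using iv by (rule indep_var_rv1)
    from measurable_compose[OF this measurable_component_singleton[OF that]]
    show ?thesis using that by simp
  qed
  obtain K where K: "0 \<le> K" "\<And>t. 0 \<le> t \<Longrightarrow> expectation (\<lambda>\<omega>. \<bar>Y t \<omega>\<bar>) \<le> K * (1 + t)"
    using expectation_abs_Y_linear_bound by blast
  have mono_AE: "AE \<omega> in M. \<forall>i<n. X (p i) \<omega> \<le> X (p (Suc i)) \<omega>"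
    using mono by (simp add: AE_all_countable AE_impI)
  have W: "integrable M (?W \<omega>)"
    "expectation (?W \<omega>) = (\<Prod>i\<in>J. (X (p (Suc i)) \<omega> - X (p i) \<omega>)) * expectation (Y 1) ^ card J"
    "expectation (\<lambda>\<omega>'. \<bar>?W \<omega> \<omega>'\<bar>) \<le> K ^ card J * (\<Prod>i\<in>J. 1 + (X (p (Suc i)) \<omega> - X (p i) \<omega>))"
    if w: "\<omega> \<in> space M" and m: "\<forall>i<n. X (p i) \<omega> \<le> X (p (Suc i)) \<omega>" for \<omega>
  proof -
    note e = expectation_prod_incr[of "\<lambda>i. X (p i) \<omega>" n J, OF Xnn[OF p[OF le0] w] m[rule_format] J]
    show "integrable M (?W \<omega>)" using e(1) by simp
    show "expectation (?W \<omega>) = (\<Prod>i\<in>J. (X (p (Suc i)) \<omega> - X (p i) \<omega>)) * expectation (Y 1) ^ card J"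
      using e(2) by (simp add: prod.distrib)
    have "expectation (\<lambda>\<omega>'. \<bar>?W \<omega> \<omega>'\<bar>) \<le>
        (\<Prod>i\<in>J. expectation (\<lambda>\<omega>'. \<bar>Y (X (p (Suc i)) \<omega> - X (p i) \<omega>) \<omega>'\<bar>))" using e(3) by simp
    also have "\<dots> \<le> (\<Prod>i\<in>J. K * (1 + (X (p (Suc i)) \<omega> - X (p i) \<omega>)))"
      by (intro prod_mono) (use K m J in auto)
    finally show "expectation (\<lambda>\<omega>'. \<bar>?W \<omega> \<omega>'\<bar>) \<le> K ^ card J * (\<Prod>i\<in>J. 1 + (X (p (Suc i)) \<omega> - X (p i) \<omega>))"
      by (simp add: prod.distrib)
  qed
  have inner: "(\<integral>\<^sup>+\<omega>'. norm (H (?A \<omega>, ?B \<omega>')) \<partial>M) = ennreal (expectation (\<lambda>\<omega>'. \<bar>?W \<omega> \<omega>'\<bar>))"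
    if w: "\<omega> \<in> space M" and m: "\<forall>i<n. X (p i) \<omega> \<le> X (p (Suc i)) \<omega>" for \<omega>
  proof -
    have "(\<integral>\<^sup>+\<omega>'. norm (H (?A \<omega>, ?B \<omega>')) \<partial>M) = (\<integral>\<^sup>+\<omega>'. ennreal \<bar>?W \<omega> \<omega>'\<bar> \<partial>M)"
      by (intro nn_integral_cong) (simp only: HA[OF w] real_norm_def)
    also have "\<dots> = ennreal (expectation (\<lambda>\<omega>'. \<bar>?W \<omega> \<omega>'\<bar>))"
      using W(1)[OF that] by (intro nn_integral_eq_integral) auto
    finally show ?thesis .
  qed
  have bound: "AE \<omega> in M. (\<integral>\<^sup>+\<omega>'. norm (H (?A \<omega>, ?B \<omega>')) \<partial>M) \<le>
      ennreal (K ^ card J * (\<Prod>i\<in>J. 1 + (X (p (Suc i)) \<omega> - X (p i) \<omega>)))"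
    using mono_AE AE_space
  proof eventually_elim
    case (elim \<omega>)
    show ?case unfolding inner[OF elim(2,1)] by (rule ennreal_leI[OF W(3)[OF elim(2,1)]])
  qed
  \<comment> \<open>Tonelli for absolute values comes first: it yields the integrability that Fubini
    requires for the signed product.\<close>
  have "(\<integral>\<^sup>+\<omega>. norm (H (?A \<omega>, ?B \<omega>)) \<partial>M) = (\<integral>\<^sup>+\<omega>. (\<integral>\<^sup>+\<omega>'. norm (H (?A \<omega>, ?B \<omega>')) \<partial>M) \<partial>M)"
    by (rule indep_var_pair_integrals(1)[OF iv H])
  also have "\<dots> \<le> (\<integral>\<^sup>+\<omega>. ennreal (K ^ card J * (\<Prod>i\<in>J. 1 + (X (p (Suc i)) \<omega> - X (p i) \<omega>))) \<partial>M)"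
    by (rule nn_integral_mono_AE[OF bound])
  also have "\<dots> < \<infinity>"
  proof -
    have "integrable M (\<lambda>\<omega>. K ^ card J * (\<Prod>i\<in>J. 1 + (X (p (Suc i)) \<omega> - X (p i) \<omega>)))"
      using int by simp
    from integrableD(2)[OF this] show ?thesis unfolding less_top infinity_ennreal_def .
  qed
  finally have fin: "(\<integral>\<^sup>+\<omega>. norm (H (?A \<omega>, ?B \<omega>)) \<partial>M) < \<infinity>" .
  have AB: "(\<lambda>\<omega>. (?A \<omega>, ?B \<omega>)) \<in> M \<rightarrow>\<^sub>M ?S \<Otimes>\<^sub>M ?N"
    using indep_var_rv1[OF iv] indep_var_rv2[OF iv] by (rule measurable_Pair)
  have iH: "integrable M (\<lambda>\<omega>. H (?A \<omega>, ?B \<omega>))"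
    by (rule integrableI_bounded[OF measurable_compose[OF AB H] fin])
  have "integrable M (\<lambda>\<omega>. H (?A \<omega>, ?B \<omega>)) \<longleftrightarrow> integrable M (\<lambda>\<omega>. ?W \<omega> \<omega>)"
    by (intro Bochner_Integration.integrable_cong refl HA)
  with iH show "integrable M (\<lambda>\<omega>. ?W \<omega> \<omega>)" by blast
  have "expectation (\<lambda>\<omega>. ?W \<omega> \<omega>) = expectation (\<lambda>\<omega>. H (?A \<omega>, ?B \<omega>))"
    by (intro Bochner_Integration.integral_cong refl HA[symmetric])
  also have "\<dots> = (\<integral>\<omega>. (\<integral>\<omega>'. H (?A \<omega>, ?B \<omega>') \<partial>M) \<partial>M)"
    by (rule indep_var_pair_integrals(2)[OF iv H iH])
  also have "\<dots> = (\<integral>\<omega>. (\<integral>\<omega>'. ?W \<omega> \<omega>' \<partial>M) \<partial>M)"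
    by (intro Bochner_Integration.integral_cong refl HA)
  also have "\<dots> = (\<integral>\<omega>. (\<Prod>i\<in>J. (X (p (Suc i)) \<omega> - X (p i) \<omega>)) * expectation (Y 1) ^ card J \<partial>M)"
  proof (rule integral_cong_AE)
    \<comment> \<open>Measurability of the inner integral is inherited from the Fubini statement for
      \<open>H\<close>.\<close>
    have "integrable M (\<lambda>\<omega>. \<integral>\<omega>'. H (?A \<omega>, ?B \<omega>') \<partial>M)"
      by (rule indep_var_pair_integrals(3)[OF iv H iH])
    moreover have "integrable M (\<lambda>\<omega>. \<integral>\<omega>'. H (?A \<omega>, ?B \<omega>') \<partial>M) \<longleftrightarrow> integrable M (\<lambda>\<omega>. \<integral>\<omega>'. ?W \<omega> \<omega>' \<partial>M)"
      by (intro Bochner_Integration.integrable_cong Bochner_Integration.integral_cong refl HA)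
    ultimately show "(\<lambda>\<omega>. \<integral>\<omega>'. ?W \<omega> \<omega>' \<partial>M) \<in> borel_measurable M" by blast
    show "(\<lambda>\<omega>. (\<Prod>i\<in>J. (X (p (Suc i)) \<omega> - X (p i) \<omega>)) * expectation (Y 1) ^ card J) \<in> borel_measurable M"
      by (intro borel_measurable_times borel_measurable_prod borel_measurable_diff Xm pJ) auto
    show "AE \<omega> in M. (\<integral>\<omega>'. ?W \<omega> \<omega>' \<partial>M) = (\<Prod>i\<in>J. (X (p (Suc i)) \<omega> - X (p i) \<omega>)) * expectation (Y 1) ^ card J"
      using mono_AE AE_space by eventually_elim (rule W(2))
  qed
  finally show "expectation (\<lambda>\<omega>. ?W \<omega> \<omega>)
      = expectation (\<lambda>\<omega>. \<Prod>i\<in>J. X (p (Suc i)) \<omega> - X (p i) \<omega>) * expectation (Y 1) ^ card J"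
    by simp
qed

end

section \<open>The integrals A(C, k) for separated intervals\<close>

text \<open>For \<open>x \<ge> 2\<close> the recursion
  \<open>Gamma x = (x - 1) * Gamma (x - 1)\<close> gives a value no smaller than at
  \<open>x - 1\<close>, so the minimum over [1, 2] bounds all later values. This controls the
  factors 1 / Gamma uniformly over all families \<open>k\<close>.\<close>

lemma Gamma_bounded_below: "\<exists>g>0. \<forall>x\<ge>1. g \<le> Gamma (x :: real)"
proof -
  have "continuous_on {1..2} (Gamma :: real \<Rightarrow> real)"
    by (intro continuous_on_Gamma) (auto dest: nonpos_Ints_nonpos)
  then obtain x0 :: real where x0: "x0 \<in> {1..2}" "\<And>x. x \<in> {1..2} \<Longrightarrow> Gamma x0 \<le> Gamma x"
    using continuous_attains_inf[of "{1..2::real}" Gamma] by auto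
  have "Gamma x0 \<le> Gamma x" if "1 \<le> x" "x \<le> real n + 2" for n x
    using that
  proof (induction n arbitrary: x)
    case (Suc n)
    show ?case
    proof (cases "x \<le> 2")
      case False
      have "x - 1 \<notin> \<int>\<^sub>\<le>\<^sub>0" using False by (auto dest: nonpos_Ints_nonpos)
      from Gamma_plus1[OF this] have "Gamma x = (x - 1) * Gamma (x - 1)" by simp
      moreover have "Gamma (x - 1) \<le> (x - 1) * Gamma (x - 1)"
        using mult_right_mono[of 1 "x - 1" "Gamma (x - 1)"] False by (simp add: less_imp_le)
      moreover have "Gamma x0 \<le> Gamma (x - 1)"
        by (rule Suc.IH) (use Suc.prems False in auto)
      ultimately show ?thesis by linarith
    qed (use x0 Suc.prems in auto)
  qed (use x0 in auto)
  then have "Gamma x0 \<le> Gamma x" if "1 \<le> x" for x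
    using that real_arch_simple[of "x - 2"] by (meson diff_le_eq)
  then show ?thesis using x0(1) by (intro exI[of _ "Gamma x0"]) auto
qed

lemma mult_mono4:
  fixes u1 :: real
  assumes "0 \<le> u1" "u1 \<le> v1" "0 \<le> u2" "u2 \<le> v2" "0 \<le> u3" "u3 \<le> v3" "0 \<le> u4" "u4 \<le> v4"
  shows "u1 * u2 * u3 * u4 \<le> v1 * v2 * v3 * v4 \<and> 0 \<le> u1 * u2 * u3 * u4"
  using assms by (auto intro!: mult_mono mult_nonneg_nonneg)

text \<open>A function that is not integrable has Bochner integral 0, which satisfies the bound as
  well. Hence the integrand of \<open>eml_A\<close> can be handled through a measurable majorant
  alone.\<close>

lemma abs_integral_le_nn_integral:
  fixes f :: "'a \<Rightarrow> real"
  assumes "(\<integral>\<^sup>+x. ennreal \<bar>f x\<bar> \<partial>M) \<le> ennreal B" "0 \<le> B"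
  shows "\<bar>\<integral>x. f x \<partial>M\<bar> \<le> B"
proof (cases "integrable M f")
  case True
  then have "ennreal \<bar>\<integral>x. f x \<partial>M\<bar> \<le> (\<integral>\<^sup>+x. ennreal \<bar>f x\<bar> \<partial>M)"
    using integral_norm_bound_ennreal[of M f] by simp
  then show ?thesis using assms ennreal_le_iff order_trans by blast
qed (use assms in \<open>simp add: not_integrable_integral_eq\<close>)

text \<open>The fractional integral of order \<open>p\<close> of the constant 1 has the value
  \<open>y powr p / Gamma (p + 1)\<close>, and \<open>y < 1\<close>. The exponent
  \<open>p - 1\<close> may be negative, so the kernel may be unbounded near
  \<open>y' = y\<close>.\<close>

lemma nn_integral_powr_kernel_le:
  fixes p y :: real
  assumes p: "0 < p" and y: "0 < y" "y < 1"
  shows "(\<integral>\<^sup>+y'. ennreal (indicator {0<..<y} y' * ((y - y') powr (p - 1) / Gamma p)) \<partial>lborel)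
    \<le> ennreal (1 / Gamma (p + 1))"
proof -
  have Gp: "0 < Gamma p" using p by simp
  have hi: "((\<lambda>x. x powr (p - 1)) has_integral (y powr (p - 1 + 1) / (p - 1 + 1))) {0..y}"
    by (rule has_integral_powr_from_0) (use p y in auto)
  then have hi: "((\<lambda>x. x powr (p - 1) / Gamma p) has_integral (y powr p / p / Gamma p)) {0..y}"
    by (intro has_integral_divide) simp
  have "(\<integral>\<^sup>+y'. ennreal (indicator {0<..<y} y' * ((y - y') powr (p - 1) / Gamma p)) \<partial>lborel)
    = (\<integral>\<^sup>+u. ennreal (indicator {0<..<y} (y + (-1) * u) * ((y - (y + (-1) * u)) powr (p - 1) / Gamma p)) \<partial>lborel)"
    by (subst nn_integral_real_affine[where c="-1" and t=y]) auto
  also have "\<dots> \<le> (\<integral>\<^sup>+u. ennreal (u powr (p - 1) / Gamma p) * indicator {0..y} u \<partial>lborel)"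
    using Gp by (intro nn_integral_mono) (auto simp: indicator_def)
  also have "\<dots> = ennreal (y powr p / p / Gamma p)"
    using Gp by (intro nn_integral_has_integral_lebesgue' hi) auto
  also have "\<dots> \<le> ennreal (1 / Gamma (p + 1))"
  proof (rule ennreal_leI)
    have "y powr p \<le> 1" using p y by (simp add: powr_le1)
    moreover have "p \<notin> \<int>\<^sub>\<le>\<^sub>0" using p by (auto dest: nonpos_Ints_nonpos)
    ultimately show "y powr p / p / Gamma p \<le> 1 / Gamma (p + 1)"
      using p Gp Gamma_plus1[of p] by (simp add: divide_right_mono)
  qed
  finally show ?thesis .
qed

section \<open>Product Lebesgue measure and the interlaced time grid\<close>

interpretation lborel_product: product_sigma_finite "\<lambda>_::nat. lborel :: real measure" ..

text \<open>Position \<open>2 * i\<close> carries \<open>t i\<close> and position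
  \<open>2 * i - 1\<close> carries \<open>t i - d\<close>, so short intervals and the gaps between
  them alternate; position 0 is the starting point that the generating function requires.\<close>

definition gap_points :: "(nat \<Rightarrow> real) \<Rightarrow> real \<Rightarrow> nat \<Rightarrow> real" where
  "gap_points t d j = (if j = 0 then 0 else if even j then t (j div 2) else t (Suc j div 2) - d)"

lemma gap_points_simps [simp]:
  "gap_points t d 0 = 0" "1 \<le> i \<Longrightarrow> gap_points t d (2 * i) = t i"
  "1 \<le> i \<Longrightarrow> gap_points t d (2 * i - 1) = t i - d"
  "1 \<le> i \<Longrightarrow> gap_points t d (2 * i - Suc 0) = t i - d"
  by (auto simp: gap_points_def)

text \<open>These are the positions of the right endpoints. For this set the interval from position
  \<open>elt C i - 1\<close> to \<open>elt C i\<close> runs from \<open>t i - d\<close> to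
  \<open>t i\<close>, so up to the scaling by \<open>\<tau>\<close> each integration variable lives
  in a short interval.\<close>

definition evens :: "nat \<Rightarrow> nat set" where
  "evens m = (\<lambda>i. 2 * i) ` {1..m}"

lemma card_evens [simp]: "card (evens m) = m"
  unfolding evens_def by (subst card_image) (auto simp: inj_on_def)

lemma elt_evens [simp]:
  assumes "1 \<le> i" "i \<le> m"
  shows "elt (evens m) i = 2 * i"
proof -
  have "sorted_list_of_set (set (map (\<lambda>i. 2 * i) [1..<Suc m])) = map (\<lambda>i. 2 * i) [1..<Suc m]"
    by (intro sorted_list_of_set.idem_if_sorted_distinct)
      (auto simp: sorted_map distinct_map inj_on_def simp del: upt_Suc
        intro: sorted_wrt_mono_rel[OF _ sorted_upt])
  moreover have "set (map (\<lambda>i. 2 * i) [1..<Suc m]) = evens m"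
    unfolding evens_def by (auto simp: image_iff)
  ultimately show ?thesis using assms by (simp add: elt_def del: upt_Suc)
qed

locale gap_config =
  fixes \<alpha> l d :: real and m :: nat and t :: "nat \<Rightarrow> real"
  assumes \<alpha>: "0 < \<alpha>" "\<alpha> \<le> 1" and d: "0 < d" and m: "1 \<le> m"
    and t1: "d < t 1" and gap: "\<And>i. 2 \<le> i \<Longrightarrow> i \<le> m \<Longrightarrow> t (i - 1) < t i - d"
begin

abbreviation "\<tau> \<equiv> t m"

lemma t_mono: "1 \<le> i \<Longrightarrow> i \<le> j \<Longrightarrow> j \<le> m \<Longrightarrow> t i \<le> t j"
proof (induction j)
  case (Suc j)
  show ?case
  proof (cases "i = Suc j")
    case False
    then have "t i \<le> t j" using Suc by simp
    also have "t j \<le> t (Suc j)" using gap[of "Suc j"] Suc.prems False d by simp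
    finally show ?thesis .
  qed simp
qed simp

lemma t_gt_d: "1 \<le> i \<Longrightarrow> i \<le> m \<Longrightarrow> d < t i"
  using t_mono[of 1 i] t1 by simp

lemma \<tau>_pos: "0 < \<tau>" using t_gt_d[of m] m d by simp

lemma Q_iff:
  assumes "\<And>i. i \<in> {1..m} \<Longrightarrow> 1 \<le> k i"
  shows "(x, x') \<in> eml_Q (gap_points t d) (evens m) k \<longleftrightarrow>
    (\<forall>i\<in>{1..m}. (t i - d) / \<tau> < x i \<and> x i < t i / \<tau> \<and>
       (2 \<le> k i \<longrightarrow> (t i - d) / \<tau> < x' i \<and> x' i < x i))"
proof -
  have e: "gap_points t d (elt (evens m) m) = t m" using m by simp
  have "(x, x') \<in> eml_Q (gap_points t d) (evens m) k \<longleftrightarrow>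
    (\<forall>i\<in>{1..m}. (2 \<le> k i \<longrightarrow> (t i - d) / \<tau> < x' i \<and> x' i < x i \<and> x i < t i / \<tau>) \<and>
       (k i = 1 \<longrightarrow> (t i - d) / \<tau> < x i \<and> x i < t i / \<tau>))"
    unfolding eml_Q_def Let_def card_evens e mem_Collect_eq case_prod_conv ball_conj_distrib
    by (intro arg_cong2[of _ _ _ _ "(\<and>)"] ball_cong refl) (simp_all del: One_nat_def)
  also have "\<dots> \<longleftrightarrow> (\<forall>i\<in>{1..m}. (t i - d) / \<tau> < x i \<and> x i < t i / \<tau> \<and>
       (2 \<le> k i \<longrightarrow> (t i - d) / \<tau> < x' i \<and> x' i < x i))"
  proof (rule ball_cong[OF refl])
    fix i assume "i \<in> {1..m}"
    then have "1 \<le> k i" by (rule assms)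
    then consider "k i = 1" | "2 \<le> k i" by linarith
    then show "((2 \<le> k i \<longrightarrow> (t i - d) / \<tau> < x' i \<and> x' i < x i \<and> x i < t i / \<tau>) \<and>
       (k i = 1 \<longrightarrow> (t i - d) / \<tau> < x i \<and> x i < t i / \<tau>)) \<longleftrightarrow>
       ((t i - d) / \<tau> < x i \<and> x i < t i / \<tau> \<and>
       (2 \<le> k i \<longrightarrow> (t i - d) / \<tau> < x' i \<and> x' i < x i))"
    proof cases
      case 2
      then have "k i \<noteq> 1" by simp
      with 2 show ?thesis using less_trans by blast
    qed simp
  qed
  finally show ?thesis .
qed

lemma eml_A_eq:
  "eml_A \<alpha> l (gap_points t d) (evens m) k =
    (LINT z | (PiM {1..m} (\<lambda>_. lborel) \<Otimes>\<^sub>M PiM {i\<in>{1..m}. 2 \<le> k i} (\<lambda>_. lborel)).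
      indicator (eml_Q (gap_points t d) (evens m) k) z *
      ((if k 1 > 1
         then (fst z 1 - snd z 1) powr (\<alpha> * (real (k 1) - 1) - 1) / Gamma ((real (k 1) - 1) * \<alpha>)
                * exp (- l * \<tau> * (fst z 1 - snd z 1))
         else 1) *
        (\<Prod>i\<in>{i\<in>{1..m}. 2 \<le> k i \<and> 2 \<le> i}.
           eml_c \<alpha> * (snd z i - fst z (i - 1)) powr (\<alpha> - 1)
             * ((fst z i - snd z i) powr (\<alpha> * (real (k i) - 1) - 1) / Gamma ((real (k i) - 1) * \<alpha>))) *
        (\<Prod>j\<in>{j\<in>{1..m}. k j = 1 \<and> 2 \<le> j}. eml_c \<alpha> * (fst z j - fst z (j - 1)) powr (\<alpha> - 1)) *
        exp (- l * \<tau> * (fst z m - fst z 1))))"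
proof -
  have e: "gap_points t d (elt (evens m) m) = t m" using m by simp
  show ?thesis
    unfolding eml_A_def Let_def set_lebesgue_integral_def case_prod_beta card_evens e
    by (simp add: conj_assoc)
qed

text \<open>Consecutive blocks of integration variables are separated by the gaps between the
  intervals, so only the kernels in \<open>x\<^sub>i - x'\<^sub>i\<close> are singular.\<close>
lemma eml_A_bounded:
  "\<exists>K. \<forall>k. (\<forall>i\<in>{1..m}. 1 \<le> k i) \<longrightarrow> \<bar>eml_A \<alpha> l (gap_points t d) (evens m) k\<bar> \<le> K"
proof -
  obtain g :: real where g: "g > 0" "\<And>x. 1 \<le> x \<Longrightarrow> g \<le> Gamma x"
    using Gamma_bounded_below by blast
  \<comment> \<open>Both \<open>G\<close> and, below, \<open>D\<close> are made at least 1, so that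
    powers whose exponents depend on \<open>k\<close> can be raised to the exponent
    \<open>m\<close>.\<close>
  define G where "G = max 1 (1 / g)"
  obtain \<delta> where \<delta>: "0 < \<delta>" "\<And>i. 2 \<le> i \<Longrightarrow> i \<le> m \<Longrightarrow> \<delta> \<le> (t i - d) / \<tau> - t (i - 1) / \<tau>"
  proof
    let ?f = "\<lambda>i. (t i - d) / \<tau> - t (i - 1) / \<tau>"
    \<comment> \<open>Inserting 1 keeps the minimum meaningful for \<open>m = 1\<close>, where there
      are no gaps.\<close>
    show "0 < Min (insert 1 (?f ` {2..m}))"
      using gap \<tau>_pos by (auto simp: diff_divide_distrib[symmetric])
    show "Min (insert 1 (?f ` {2..m})) \<le> ?f i" if "2 \<le> i" "i \<le> m" for i
      using that by (intro Min_le) auto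
  qed
  have c: "0 < eml_c \<alpha>" using \<alpha> by (simp add: eml_c_def)
  define D where "D = max 1 (eml_c \<alpha> * \<delta> powr (\<alpha> - 1))"
  have D1: "1 \<le> D" and G1: "1 \<le> G" unfolding D_def G_def by auto
  define E where "E = exp (\<bar>l\<bar> * \<tau>)"
  have E1: "0 < E" unfolding E_def by simp
  have Eb: "exp (- l * \<tau> * y) \<le> E" if "\<bar>y\<bar> \<le> 1" for y
  proof -
    have "- l * \<tau> * y \<le> \<bar>l * \<tau> * y\<bar>" by simp
    also have "\<dots> = \<bar>l\<bar> * \<tau> * \<bar>y\<bar>" using \<tau>_pos by (simp add: abs_mult)
    also have "\<dots> \<le> \<bar>l\<bar> * \<tau> * 1" using that \<tau>_pos by (intro mult_left_mono) auto
    finally show ?thesis by (simp add: E_def)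
  qed
  have pw: "eml_c \<alpha> * y powr (\<alpha> - 1) \<le> D" if "\<delta> \<le> y" for y
  proof -
    have "y powr (\<alpha> - 1) \<le> \<delta> powr (\<alpha> - 1)" using that \<delta>(1) \<alpha> by (intro powr_mono2') auto
    then show ?thesis unfolding D_def using c by (simp add: le_max_iff_disj)
  qed
  \<comment> \<open>One factor for each part of the integrand: the exponential at index 1, the
    separated kernels with \<open>k i \<ge> 2\<close>, those with \<open>k i = 1\<close>, and the
    last exponential.\<close>
  define K0 where "K0 = E * D ^ m * D ^ m * E"
  have K0: "0 \<le> K0" using D1 E1 by (simp add: K0_def)
  have cm: "card {i\<in>{1..m}. P i} \<le> m" for P
  proof -
    have "card {i\<in>{1..m}. P i} \<le> card {1..m}" by (rule card_mono) auto
    then show ?thesis by simp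
  qed
  have main: "\<bar>eml_A \<alpha> l (gap_points t d) (evens m) k\<bar> \<le> K0 * G ^ m"
    if k: "\<forall>i\<in>{1..m}. 1 \<le> k i" for k
  proof -
    let ?Q = "eml_Q (gap_points t d) (evens m) k"
    let ?C2 = "{i\<in>{1..m}. 2 \<le> k i}"
    let ?N1 = "PiM {1..m} (\<lambda>_. lborel) :: (nat \<Rightarrow> real) measure"
    let ?N2 = "PiM ?C2 (\<lambda>_. lborel) :: (nat \<Rightarrow> real) measure"
    let ?p = "\<lambda>i. \<alpha> * (real (k i) - 1)"
    define h where "h i y y' = (y - y') powr (?p i - 1) / Gamma (?p i)" for i and y y' :: real
    let ?A1 = "\<lambda>z. if k 1 > 1 then h 1 (fst z 1) (snd z 1) * exp (- l * \<tau> * (fst z 1 - snd z 1)) else 1"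
    let ?A2 = "\<lambda>z. \<Prod>i\<in>{i\<in>{1..m}. 2 \<le> k i \<and> 2 \<le> i}.
        eml_c \<alpha> * (snd z i - fst z (i - 1)) powr (\<alpha> - 1) * h i (fst z i) (snd z i)"
    let ?A3 = "\<lambda>z. \<Prod>j\<in>{j\<in>{1..m}. k j = 1 \<and> 2 \<le> j}. eml_c \<alpha> * (fst z j - fst z (j - 1)) powr (\<alpha> - 1)"
    let ?A4 = "\<lambda>z. exp (- l * \<tau> * (fst z m - fst z 1))"
    let ?F = "\<lambda>z::(nat \<Rightarrow> real) \<times> (nat \<Rightarrow> real). ?A1 z * ?A2 z * ?A3 z * ?A4 z"
    \<comment> \<open>The majorant forgets all couplings between different indices:
      \<open>x i\<close> ranges over (0, 1) and \<open>x' i\<close> over the interval from 0 to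
      \<open>x i\<close>. Its integral factorises, and only the integrable singularities in
      \<open>x i - x' i\<close> remain.\<close>
    let ?\<Phi> = "\<lambda>z::(nat \<Rightarrow> real) \<times> (nat \<Rightarrow> real).
      (\<Prod>i\<in>{1..m}. ennreal (indicator {0<..<1} (fst z i))) *
      (\<Prod>i\<in>?C2. ennreal (indicator {0<..<fst z i} (snd z i) * h i (fst z i) (snd z i)))"
    have Gam: "0 < Gamma (?p i)" if "i \<in> ?C2" for i using that \<alpha> by simp
    have hnn: "0 \<le> h i y y'" if "i \<in> ?C2" for i y y' using Gam[OF that] by (simp add: h_def)
    have bound: "ennreal \<bar>indicator ?Q z * ?F z\<bar> \<le> ennreal K0 * ?\<Phi> z" for z
    proof (cases "z \<in> ?Q")
      case True
      obtain x x' where z: "z = (x, x')" by force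
      have q: "(t i - d) / \<tau> < x i" "x i < t i / \<tau>"
        "2 \<le> k i \<Longrightarrow> (t i - d) / \<tau> < x' i \<and> x' i < x i" if "i \<in> {1..m}" for i
        using True Q_iff[of k x x'] k that unfolding z by auto
      have x01: "0 < x i" "x i < 1" "2 \<le> k i \<Longrightarrow> 0 < x' i" if "i \<in> {1..m}" for i
      proof -
        have "0 \<le> (t i - d) / \<tau>" using t_gt_d[of i] that \<tau>_pos by simp
        moreover have "t i / \<tau> \<le> 1" using t_mono[of i m] that \<tau>_pos by simp
        ultimately show "0 < x i" "x i < 1" "2 \<le> k i \<Longrightarrow> 0 < x' i" using q[OF that] by auto
      qed
      have sep: "\<delta> \<le> x i - x (i - 1)" "2 \<le> k i \<Longrightarrow> \<delta> \<le> x' i - x (i - 1)"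
        if "i \<in> {1..m}" "2 \<le> i" for i
        using \<delta>(2)[of i] q[of i] q[of "i - 1"] that by force+
      \<comment> \<open>The product over \<open>{i\<in>?C2. i < 2}\<close> is the kernel with index
        1 or empty, which absorbs the case distinction on \<open>k 1\<close> and later merges with
        the indices \<open>i \<ge> 2\<close>.\<close>
      have a1: "0 \<le> ?A1 z" "?A1 z \<le> E * (\<Prod>i\<in>{i\<in>?C2. i < 2}. h i (x i) (x' i))"
      proof -
        show "0 \<le> ?A1 z" using hnn[of 1] m by simp
        have E': "1 \<le> E" unfolding E_def using \<tau>_pos by simp
        show "?A1 z \<le> E * (\<Prod>i\<in>{i\<in>?C2. i < 2}. h i (x i) (x' i))"
        proof (cases "1 < k 1")
          case True
          then have "{i\<in>?C2. i < 2} = {1}" using m by auto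
          then have "(\<Prod>i\<in>{i\<in>?C2. i < 2}. h i (x i) (x' i)) = h 1 (x 1) (x' 1)"
            by (simp only: prod.insert prod.empty finite.emptyI empty_iff not_False_eq_True mult_1_right)
          moreover have "exp (- l * \<tau> * (x 1 - x' 1)) \<le> E"
            using x01[of 1] q[of 1] True m by (intro Eb) auto
          moreover have "0 \<le> h 1 (x 1) (x' 1)" using hnn[of 1] True m by simp
          ultimately have "exp (- l * \<tau> * (x 1 - x' 1)) * h 1 (x 1) (x' 1)
              \<le> E * (\<Prod>i\<in>{i\<in>?C2. i < 2}. h i (x i) (x' i))"
            by (simp only: mult_right_mono)
          then show ?thesis using True z by (simp only: if_True fst_conv snd_conv mult.commute)
        next
          case False
          then have "{i\<in>?C2. i < 2} = {}" using m by (auto simp: less_2_cases_iff)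
          then show ?thesis using False E' by (simp only: if_False prod.empty mult_1_right)
        qed
      qed
      have a2: "0 \<le> ?A2 z" "?A2 z \<le> D ^ m * (\<Prod>i\<in>{i\<in>?C2. 2 \<le> i}. h i (x i) (x' i))"
      proof -
        show "0 \<le> ?A2 z" using c hnn by (intro prod_nonneg) auto
        have "?A2 z \<le> (\<Prod>i\<in>{i\<in>{1..m}. 2 \<le> k i \<and> 2 \<le> i}. D * h i (x i) (x' i))"
          unfolding z using c hnn sep by (intro prod_mono) (auto intro!: mult_right_mono pw)
        also have "\<dots> = D ^ card {i\<in>{1..m}. 2 \<le> k i \<and> 2 \<le> i} * (\<Prod>i\<in>{i\<in>?C2. 2 \<le> i}. h i (x i) (x' i))"
          by (simp add: prod.distrib conj_assoc)
        also have "\<dots> \<le> D ^ m * (\<Prod>i\<in>{i\<in>?C2. 2 \<le> i}. h i (x i) (x' i))"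
        proof (rule mult_right_mono)
          show "D ^ card {i\<in>{1..m}. 2 \<le> k i \<and> 2 \<le> i} \<le> D ^ m"
            by (rule power_increasing[OF cm D1])
        qed (use hnn in \<open>auto intro!: prod_nonneg\<close>)
        finally show "?A2 z \<le> D ^ m * (\<Prod>i\<in>{i\<in>?C2. 2 \<le> i}. h i (x i) (x' i))" .
      qed
      have a3: "0 \<le> ?A3 z" "?A3 z \<le> D ^ m"
      proof -
        show "0 \<le> ?A3 z" using c by (intro prod_nonneg) auto
        have "?A3 z \<le> (\<Prod>j\<in>{j\<in>{1..m}. k j = 1 \<and> 2 \<le> j}. D)"
          unfolding z using c sep by (intro prod_mono) (auto intro!: pw)
        also have "\<dots> = D ^ card {j\<in>{1..m}. k j = 1 \<and> 2 \<le> j}" by simp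
        also have "\<dots> \<le> D ^ m"
          by (rule power_increasing[OF cm D1])
        finally show "?A3 z \<le> D ^ m" .
      qed
      have a4: "0 \<le> ?A4 z" "?A4 z \<le> E"
        using x01[of m] x01[of 1] Eb[of "x m - x 1"] m unfolding z by auto
      have "?F z \<le> (E * (\<Prod>i\<in>{i\<in>?C2. i < 2}. h i (x i) (x' i))) *
          (D ^ m * (\<Prod>i\<in>{i\<in>?C2. 2 \<le> i}. h i (x i) (x' i))) * D ^ m * E"
        by (rule conjunct1[OF mult_mono4[OF a1 a2 a3 a4]])
      also have "\<dots> = K0 * ((\<Prod>i\<in>{i\<in>?C2. i < 2}. h i (x i) (x' i)) * (\<Prod>i\<in>{i\<in>?C2. 2 \<le> i}. h i (x i) (x' i)))"
        by (simp add: K0_def mult_ac)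
      also have "(\<Prod>i\<in>{i\<in>?C2. i < 2}. h i (x i) (x' i)) * (\<Prod>i\<in>{i\<in>?C2. 2 \<le> i}. h i (x i) (x' i))
          = (\<Prod>i\<in>?C2. h i (x i) (x' i))"
      proof -
        have "(\<Prod>i\<in>?C2. h i (x i) (x' i))
            = (\<Prod>i\<in>{i\<in>?C2. i < 2} \<union> {i\<in>?C2. 2 \<le> i}. h i (x i) (x' i))"
          by (intro prod.cong) auto
        also have "\<dots> = (\<Prod>i\<in>{i\<in>?C2. i < 2}. h i (x i) (x' i)) * (\<Prod>i\<in>{i\<in>?C2. 2 \<le> i}. h i (x i) (x' i))"
          by (rule prod.union_disjoint) auto
        finally show ?thesis by (rule sym)
      qed
      finally have F: "?F z \<le> K0 * (\<Prod>i\<in>?C2. h i (x i) (x' i))" .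
      have Fnn: "0 \<le> ?F z"
        by (rule conjunct2[OF mult_mono4[OF a1 a2 a3 a4]])
      have "?\<Phi> z = (\<Prod>i\<in>?C2. ennreal (h i (x i) (x' i)))"
      proof -
        have "(\<Prod>i\<in>{1..m}. ennreal (indicator {0<..<1} (fst z i))) = 1"
          unfolding z using x01 by (intro prod.neutral) auto
        moreover have "(\<Prod>i\<in>?C2. ennreal (indicator {0<..<fst z i} (snd z i) * h i (fst z i) (snd z i)))
            = (\<Prod>i\<in>?C2. ennreal (h i (x i) (x' i)))"
          unfolding z using x01 q by (intro prod.cong) auto
        ultimately show ?thesis by simp
      qed
      also have "\<dots> = ennreal (\<Prod>i\<in>?C2. h i (x i) (x' i))" using hnn by (intro prod_ennreal) auto
      finally have \<Phi>: "?\<Phi> z = ennreal (\<Prod>i\<in>?C2. h i (x i) (x' i))" .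
      have "\<bar>indicator ?Q z * ?F z\<bar> \<le> K0 * (\<Prod>i\<in>?C2. h i (x i) (x' i))"
        using F Fnn True by (simp only: indicator_simps mult_1_left abs_of_nonneg)
      then show ?thesis unfolding \<Phi> using K0 hnn
        by (subst ennreal_mult[symmetric]) (auto intro!: ennreal_leI prod_nonneg)
    qed simp
    interpret N2: sigma_finite_measure ?N2 by (rule lborel_product.sigma_finite) simp
    have [measurable]: "(\<lambda>z. fst z i) \<in> borel_measurable (?N1 \<Otimes>\<^sub>M ?N2)" if "i \<in> {1..m}" for i
      using that by measurable
    have [measurable]: "(\<lambda>z. snd z i) \<in> borel_measurable (?N1 \<Otimes>\<^sub>M ?N2)" if "i \<in> ?C2" for i
      using that by measurable
    have \<Phi>m: "?\<Phi> \<in> borel_measurable (?N1 \<Otimes>\<^sub>M ?N2)"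
    proof (intro borel_measurable_times_ennreal borel_measurable_prod_ennreal)
      fix i assume "i \<in> {1..m}"
      then show "(\<lambda>z. ennreal (indicator {0<..<1} (fst z i))) \<in> borel_measurable (?N1 \<Otimes>\<^sub>M ?N2)"
        by measurable
    next
      fix i assume i: "i \<in> ?C2"
      then have 1: "i \<in> {1..m}" by simp
      have "(\<lambda>z. ennreal (if 0 < snd z i \<and> snd z i < fst z i then h i (fst z i) (snd z i) else 0))
          \<in> borel_measurable (?N1 \<Otimes>\<^sub>M ?N2)"
        unfolding h_def using i 1 by measurable
      then show "(\<lambda>z. ennreal (indicator {0<..<fst z i} (snd z i) * h i (fst z i) (snd z i)))
          \<in> borel_measurable (?N1 \<Otimes>\<^sub>M ?N2)"
        by (rule measurable_cong[THEN iffD1, rotated]) (auto simp: indicator_def)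
    qed
    have inner: "(\<integral>\<^sup>+x'. ?\<Phi> (x, x') \<partial>?N2) \<le> ennreal (G ^ m) * (\<Prod>i\<in>{1..m}. ennreal (indicator {0<..<1} (x i)))" for x
    proof (cases "\<forall>i\<in>{1..m}. 0 < x i \<and> x i < 1")
      case True
      have "(\<integral>\<^sup>+x'. ?\<Phi> (x, x') \<partial>?N2) = (\<integral>\<^sup>+x'. (\<Prod>i\<in>?C2. ennreal (indicator {0<..<x i} (x' i) * h i (x i) (x' i))) \<partial>?N2)"
        using True by (intro nn_integral_cong) simp
      also have "\<dots> = (\<Prod>i\<in>?C2. \<integral>\<^sup>+y'. ennreal (indicator {0<..<x i} y' * h i (x i) y') \<partial>lborel)"
        by (intro lborel_product.product_nn_integral_prod) (auto simp: h_def)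
      also have "\<dots> \<le> (\<Prod>i\<in>?C2. ennreal G)"
      proof (rule prod_mono_ennreal)
        fix i assume i: "i \<in> ?C2"
        have "(\<integral>\<^sup>+y'. ennreal (indicator {0<..<x i} y' * h i (x i) y') \<partial>lborel) \<le> ennreal (1 / Gamma (?p i + 1))"
          unfolding h_def by (rule nn_integral_powr_kernel_le) (use i True \<alpha> in auto)
        also have "\<dots> \<le> ennreal G"
        proof (rule ennreal_leI)
          have "1 \<le> ?p i + 1" using i \<alpha> by simp
          then have "1 / Gamma (?p i + 1) \<le> 1 / g" using g by (intro divide_left_mono) auto
          then show "1 / Gamma (?p i + 1) \<le> G" unfolding G_def by simp
        qed
        finally show "(\<integral>\<^sup>+y'. ennreal (indicator {0<..<x i} y' * h i (x i) y') \<partial>lborel) \<le> ennreal G" .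
      qed
      also have "\<dots> = ennreal (G ^ card ?C2)" using G1 by (simp add: ennreal_power)
      also have "\<dots> \<le> ennreal (G ^ m)"
        by (intro ennreal_leI power_increasing cm G1)
      also have "\<dots> = ennreal (G ^ m) * (\<Prod>i\<in>{1..m}. ennreal (indicator {0<..<1} (x i)))"
        using True by simp
      finally show ?thesis .
    next
      case False
      then have "(\<Prod>i\<in>{1..m}. ennreal (indicator {0<..<1} (x i))) = 0"
        by (auto simp: prod_zero_iff indicator_def)
      then show ?thesis by (simp only: fst_conv mult_zero_left nn_integral_const) simp
    qed
    have "(\<integral>\<^sup>+z. ennreal \<bar>indicator ?Q z * ?F z\<bar> \<partial>(?N1 \<Otimes>\<^sub>M ?N2)) \<le> (\<integral>\<^sup>+z. ennreal K0 * ?\<Phi> z \<partial>(?N1 \<Otimes>\<^sub>M ?N2))"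
      by (intro nn_integral_mono bound)
    also have "\<dots> = ennreal K0 * (\<integral>\<^sup>+z. ?\<Phi> z \<partial>(?N1 \<Otimes>\<^sub>M ?N2))"
      by (rule nn_integral_cmult[OF \<Phi>m])
    also have "(\<integral>\<^sup>+z. ?\<Phi> z \<partial>(?N1 \<Otimes>\<^sub>M ?N2)) = (\<integral>\<^sup>+x. (\<integral>\<^sup>+x'. ?\<Phi> (x, x') \<partial>?N2) \<partial>?N1)"
      by (rule N2.nn_integral_fst[symmetric, OF \<Phi>m])
    also have "ennreal K0 * \<dots> \<le> ennreal K0 * (\<integral>\<^sup>+x. ennreal (G ^ m) * (\<Prod>i\<in>{1..m}. ennreal (indicator {0<..<1} (x i))) \<partial>?N1)"
      by (intro mult_left_mono nn_integral_mono inner) auto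
    also have "(\<integral>\<^sup>+x. ennreal (G ^ m) * (\<Prod>i\<in>{1..m}. ennreal (indicator {0<..<1} (x i))) \<partial>?N1)
        = ennreal (G ^ m) * (\<integral>\<^sup>+x. (\<Prod>i\<in>{1..m}. ennreal (indicator {0<..<1} (x i))) \<partial>?N1)"
      by (intro nn_integral_cmult borel_measurable_prod_ennreal) measurable
    also have "(\<integral>\<^sup>+x. (\<Prod>i\<in>{1..m}. ennreal (indicator {0<..<1} (x i))) \<partial>?N1)
        = (\<Prod>i\<in>{1..m}. \<integral>\<^sup>+y. ennreal (indicator {0<..<1::real} y) \<partial>lborel)"
      by (intro lborel_product.product_nn_integral_prod) auto
    also have "\<dots> = 1" by (intro prod.neutral ballI) (simp add: ennreal_indicator)
    finally have nn: "(\<integral>\<^sup>+z. ennreal \<bar>indicator ?Q z * ?F z\<bar> \<partial>(?N1 \<Otimes>\<^sub>M ?N2)) \<le> ennreal (K0 * G ^ m)"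
      using K0 G1 by (simp add: ennreal_mult)
    have "eml_A \<alpha> l (gap_points t d) (evens m) k = (\<integral>z. indicator ?Q z * ?F z \<partial>(?N1 \<Otimes>\<^sub>M ?N2))"
      unfolding eml_A_eq h_def mult.commute[of \<alpha>] ..
    also have "\<bar>\<dots>\<bar> \<le> K0 * G ^ m"
      by (rule abs_integral_le_nn_integral[OF nn]) (use K0 G1 in auto)
    finally show ?thesis .
  qed
  then show ?thesis by blast
qed

end

text \<open>In unscaled time, this is the integrand of the all-ones family at the right endpoints,
  with neighbouring distances shortened by \<open>\<epsilon>\<close> and the exponent shifted. Since
  \<alpha> \<le> 1, \<open>\<epsilon> = d\<close> bounds the integrand on the box from above and
  \<open>\<epsilon> = - d\<close> from below; \<open>\<epsilon> = 0\<close> gives the limit.\<close>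

definition kernel_bound :: "real \<Rightarrow> real \<Rightarrow> nat \<Rightarrow> (nat \<Rightarrow> real) \<Rightarrow> real \<Rightarrow> real" where
  "kernel_bound \<alpha> l m t \<epsilon> = (\<Prod>j\<in>{2..m}. eml_c \<alpha> * (t j - t (j - 1) - \<epsilon>) powr (\<alpha> - 1)) *
     exp (- l * (t m - t 1) + \<bar>l\<bar> * \<epsilon>)"

text \<open>The factor over the empty index set is a one-point space of mass 1: the family of ones
  has no variables x'.\<close>

lemma nn_integral_box:
  fixes a b :: "nat \<Rightarrow> real"
  assumes "\<And>i. i \<in> {1..m} \<Longrightarrow> a i \<le> b i"
  shows "(\<integral>\<^sup>+z. (\<Prod>i\<in>{1..m}. indicator {a i<..<b i} (fst z i))
      \<partial>(PiM {1..m} (\<lambda>_. lborel) \<Otimes>\<^sub>M (PiM {} (\<lambda>_. lborel) :: (nat \<Rightarrow> real) measure)))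
    = ennreal (\<Prod>i\<in>{1..m}. b i - a i)"
proof -
  let ?N1 = "PiM {1..m} (\<lambda>_. lborel) :: (nat \<Rightarrow> real) measure"
  let ?N2 = "PiM {} (\<lambda>_. lborel) :: (nat \<Rightarrow> real) measure"
  interpret N2: sigma_finite_measure ?N2 by (rule lborel_product.sigma_finite) simp
  have [measurable]: "(\<lambda>z. fst z i) \<in> borel_measurable (?N1 \<Otimes>\<^sub>M ?N2)" if "i \<in> {1..m}" for i
    using that by measurable
  let ?\<Phi> = "\<lambda>z :: (nat \<Rightarrow> real) \<times> (nat \<Rightarrow> real).
    (\<Prod>i\<in>{1..m}. indicator {a i<..<b i} (fst z i)) :: ennreal"
  have "?\<Phi> \<in> borel_measurable (?N1 \<Otimes>\<^sub>M ?N2)"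
    by (intro borel_measurable_prod_ennreal) measurable
  then have "(\<integral>\<^sup>+z. ?\<Phi> z \<partial>(?N1 \<Otimes>\<^sub>M ?N2)) = (\<integral>\<^sup>+x. (\<integral>\<^sup>+x'. ?\<Phi> (x, x') \<partial>?N2) \<partial>?N1)"
    by (rule N2.nn_integral_fst[symmetric])
  also have "\<dots> = (\<integral>\<^sup>+x. (\<Prod>i\<in>{1..m}. indicator {a i<..<b i} (x i)) \<partial>?N1)"
    by (simp add: PiM_empty)
  also have "\<dots> = (\<Prod>i\<in>{1..m}. \<integral>\<^sup>+y. indicator {a i<..<b i} y \<partial>lborel)"
    by (intro lborel_product.product_nn_integral_prod) auto
  also have "\<dots> = (\<Prod>i\<in>{1..m}. ennreal (b i - a i))"
    using assms by (intro prod.cong refl) simp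
  also have "\<dots> = ennreal (\<Prod>i\<in>{1..m}. b i - a i)"
    using assms by (intro prod_ennreal) auto
  finally show ?thesis .
qed

section \<open>The all-ones family: two-sided bounds for its integral\<close>

context gap_config
begin

text \<open>Returning from units of \<open>\<tau>\<close> to time, the kernels contribute the
  exponent \<open>- (\<alpha> - 1) * (m - 1)\<close> of \<open>\<tau>\<close> and the volume of the
  box contributes \<open>- m\<close>. The exponent \<open>\<alpha> * (m - 1) + 1\<close> of the
  series equals \<open>(\<alpha> - 1) * (m - 1) + m\<close>, so all powers of \<open>\<tau>\<close>
  cancel.\<close>

lemma prod_powr_scale:
  assumes "\<And>j. j \<in> {2..m} \<Longrightarrow> 0 < y j"
  shows "(\<Prod>j\<in>{2..m}. eml_c \<alpha> * (y j / \<tau>) powr (\<alpha> - 1)) * \<tau> powr (\<alpha> * (real m - 1) + 1) / \<tau> ^ m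
    = (\<Prod>j\<in>{2..m}. eml_c \<alpha> * y j powr (\<alpha> - 1))"
proof -
  have "(\<Prod>j\<in>{2..m}. eml_c \<alpha> * (y j / \<tau>) powr (\<alpha> - 1))
      = (\<Prod>j\<in>{2..m}. (eml_c \<alpha> * y j powr (\<alpha> - 1)) / \<tau> powr (\<alpha> - 1))"
    using assms \<tau>_pos by (intro prod.cong refl) (simp add: powr_divide less_imp_le)
  also have "\<dots> = (\<Prod>j\<in>{2..m}. eml_c \<alpha> * y j powr (\<alpha> - 1)) / (\<tau> powr (\<alpha> - 1)) ^ (m - 1)"
    by (simp add: prod_dividef)
  also have "(\<tau> powr (\<alpha> - 1)) ^ (m - 1) = \<tau> powr ((\<alpha> - 1) * (real m - 1))"
    using m \<tau>_pos by (simp add: powr_powr flip: powr_realpow)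
  finally have e: "(\<Prod>j\<in>{2..m}. eml_c \<alpha> * (y j / \<tau>) powr (\<alpha> - 1)) =
      (\<Prod>j\<in>{2..m}. eml_c \<alpha> * y j powr (\<alpha> - 1)) / \<tau> powr ((\<alpha> - 1) * (real m - 1))" .
  have "\<tau> powr (\<alpha> * (real m - 1) + 1) = \<tau> powr ((\<alpha> - 1) * (real m - 1)) * \<tau> powr real m"
    unfolding powr_add[symmetric] by (simp add: algebra_simps)
  also have "\<tau> powr real m = \<tau> ^ m" using \<tau>_pos by (simp add: powr_realpow)
  finally show ?thesis unfolding e using \<tau>_pos by simp
qed

text \<open>On the box each \<open>\<tau> * x i\<close> lies less than \<open>d\<close> below
  \<open>t i\<close>, so differences of two of them are within \<open>d\<close> of those of the
  \<open>t i\<close>. This squeezes the integrand between two constants, and the box has volume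
  \<open>(d / \<tau>) ^ m\<close>.\<close>

lemma eml_A_ones_bounds:
  defines "W \<equiv> \<tau> powr (\<alpha> * (real m - 1) + 1) *
    eml_A \<alpha> l (gap_points t d) (evens m) (restrict (\<lambda>_. 1) {1..m})"
  shows "d ^ m * kernel_bound \<alpha> l m t (- d) \<le> W" and "W \<le> d ^ m * kernel_bound \<alpha> l m t d"
proof -
  let ?k = "restrict (\<lambda>_. 1) {1..m} :: nat \<Rightarrow> nat"
  let ?Q = "eml_Q (gap_points t d) (evens m) ?k"
  let ?N = "PiM {1..m} (\<lambda>_. lborel) \<Otimes>\<^sub>M PiM {} (\<lambda>_. lborel) :: ((nat \<Rightarrow> real) \<times> (nat \<Rightarrow> real)) measure"
  let ?P = "\<lambda>z :: (nat \<Rightarrow> real) \<times> (nat \<Rightarrow> real). \<Prod>j\<in>{2..m}. eml_c \<alpha> * (fst z j - fst z (j - 1)) powr (\<alpha> - 1)"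
  let ?E = "\<lambda>z :: (nat \<Rightarrow> real) \<times> (nat \<Rightarrow> real). exp (- l * \<tau> * (fst z m - fst z 1))"
  define PB where "PB \<epsilon> = (\<Prod>j\<in>{2..m}. eml_c \<alpha> * ((t j - t (j - 1) - \<epsilon>) / \<tau>) powr (\<alpha> - 1))" for \<epsilon>
  define EB where "EB \<epsilon> = exp (- l * (t m - t 1) + \<bar>l\<bar> * \<epsilon>)" for \<epsilon>
  have k1: "?k 1 = 1" using m by simp
  have C2: "{i\<in>{1..m}. 2 \<le> ?k i} = {}" by auto
  have C2': "{i\<in>{1..m}. 2 \<le> ?k i \<and> 2 \<le> i} = {}" by auto
  have C1: "{j\<in>{1..m}. ?k j = 1 \<and> 2 \<le> j} = {2..m}" by auto
  have A: "eml_A \<alpha> l (gap_points t d) (evens m) ?k = (\<integral>z. indicator ?Q z * (?P z * ?E z) \<partial>?N)"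
    unfolding eml_A_eq C2 C2' C1 k1 by simp
  have Qi: "z \<in> ?Q \<longleftrightarrow> (\<forall>i\<in>{1..m}. (t i - d) / \<tau> < fst z i \<and> fst z i < t i / \<tau>)" for z
    using Q_iff[of ?k "fst z" "snd z"] by auto
  \<comment> \<open>Stated over an arbitrary semiring: the real version serves measurability, the
    \<open>ennreal\<close> version the volume.\<close>
  have Qp: "indicator ?Q z = (\<Prod>i\<in>{1..m}. indicator {(t i - d) / \<tau><..<t i / \<tau>} (fst z i) :: 'b::comm_semiring_1)" for z
  proof (cases "z \<in> ?Q")
    case True
    then show ?thesis using Qi by (simp add: prod.neutral)
  next
    case False
    then obtain i where "i \<in> {1..m}" "\<not> ((t i - d) / \<tau> < fst z i \<and> fst z i < t i / \<tau>)" using Qi by blast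
    then have "(\<Prod>i\<in>{1..m}. indicator {(t i - d) / \<tau><..<t i / \<tau>} (fst z i) :: 'b) = 0"
      by (intro prod_zero bexI[of _ i]) auto
    then show ?thesis using False by simp
  qed
  have c: "0 < eml_c \<alpha>" using \<alpha> by (simp add: eml_c_def)
  have bd: "PB (- d) * EB (- d) \<le> ?P z * ?E z \<and> ?P z * ?E z \<le> PB d * EB d" if "z \<in> ?Q" for z
  proof -
    have q: "t i - d < \<tau> * fst z i" "\<tau> * fst z i < t i" if "i \<in> {1..m}" for i
      using \<open>z \<in> ?Q\<close> Qi \<tau>_pos that by (auto simp: field_simps)
    have g: "(t j - t (j - 1) - d) / \<tau> < fst z j - fst z (j - 1)"
      "fst z j - fst z (j - 1) < (t j - t (j - 1) + d) / \<tau>"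
      "0 < (t j - t (j - 1) - d) / \<tau>" if "j \<in> {2..m}" for j
    proof -
      have j: "j \<in> {1..m}" "j - 1 \<in> {1..m}" using that by auto
      show "(t j - t (j - 1) - d) / \<tau> < fst z j - fst z (j - 1)"
        "fst z j - fst z (j - 1) < (t j - t (j - 1) + d) / \<tau>"
        using q[OF j(1)] q[OF j(2)] \<tau>_pos by (auto simp: field_simps)
      show "0 < (t j - t (j - 1) - d) / \<tau>" using gap[of j] that \<tau>_pos by simp
    qed
    have p1: "PB (- d) \<le> ?P z"
      unfolding PB_def
    proof (intro prod_mono conjI)
      fix j assume j: "j \<in> {2..m}"
      have "((t j - t (j - 1) - - d) / \<tau>) powr (\<alpha> - 1) \<le> (fst z j - fst z (j - 1)) powr (\<alpha> - 1)"
        using g[OF j] \<alpha> by (intro powr_mono2') auto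
      then show "eml_c \<alpha> * ((t j - t (j - 1) - - d) / \<tau>) powr (\<alpha> - 1)
          \<le> eml_c \<alpha> * (fst z j - fst z (j - 1)) powr (\<alpha> - 1)" using c by simp
    qed (use c in simp)
    have p2: "?P z \<le> PB d"
      unfolding PB_def
    proof (intro prod_mono conjI)
      fix j assume j: "j \<in> {2..m}"
      have "(fst z j - fst z (j - 1)) powr (\<alpha> - 1) \<le> ((t j - t (j - 1) - d) / \<tau>) powr (\<alpha> - 1)"
        using g[OF j] \<alpha> by (intro powr_mono2') auto
      then show "eml_c \<alpha> * (fst z j - fst z (j - 1)) powr (\<alpha> - 1)
          \<le> eml_c \<alpha> * ((t j - t (j - 1) - d) / \<tau>) powr (\<alpha> - 1)" using c by simp
    qed (use c in simp)
    have p0: "0 \<le> PB (- d)" "0 \<le> PB d" unfolding PB_def using c by (auto intro!: prod_nonneg)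
    \<comment> \<open>\<open>y\<close> is the error in the exponent when the scaled positions are
      replaced by \<open>t m\<close> and \<open>t 1\<close>.\<close>
    define y where "y = \<tau> * (fst z m - fst z 1) - (t m - t 1)"
    have "\<bar>y\<bar> \<le> d" using q[of m] q[of 1] m unfolding y_def by (auto simp: algebra_simps)
    then have "\<bar>l * y\<bar> \<le> \<bar>l\<bar> * d" by (simp add: abs_mult mult_left_mono)
    moreover have "- l * \<tau> * (fst z m - fst z 1) = - l * (t m - t 1) - l * y"
      unfolding y_def by (simp add: algebra_simps)
    ultimately have e: "EB (- d) \<le> ?E z" "?E z \<le> EB d" unfolding EB_def by auto
    have "0 \<le> EB (- d)" "0 \<le> ?P z" unfolding EB_def using c by (auto intro!: prod_nonneg)
    then show ?thesis using p1 p2 p0 e by (auto intro!: mult_mono)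
  qed
  have [measurable]: "(\<lambda>z. fst z i) \<in> borel_measurable ?N" if "i \<in> {1..m}" for i
    using that by measurable
  have Qm: "(\<lambda>z. indicator ?Q z :: real) \<in> borel_measurable ?N"
    unfolding Qp by (intro borel_measurable_prod) measurable
  have fm: "(\<lambda>z. fst z i) \<in> borel_measurable ?N" if "i \<in> {1..m}" for i
    using that by measurable
  have PEm: "(\<lambda>z. ?P z * ?E z) \<in> borel_measurable ?N"
    by (intro borel_measurable_times borel_measurable_prod borel_measurable_const borel_measurable_exp[THEN measurable_compose]
         powr_real_measurable borel_measurable_diff borel_measurable_exp measurable_compose[OF _ borel_measurable_exp] fm) (use m in auto)
  have nnQ: "(\<integral>\<^sup>+z. indicator ?Q z \<partial>?N) = ennreal ((d / \<tau>) ^ m)"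
    unfolding Qp using nn_integral_box[of m "\<lambda>i. (t i - d) / \<tau>" "\<lambda>i. t i / \<tau>"] d \<tau>_pos
    by (simp add: divide_right_mono diff_divide_distrib[symmetric])
  have nnQ': "(\<integral>\<^sup>+z. ennreal (indicator ?Q z) \<partial>?N) = ennreal ((d / \<tau>) ^ m)"
    using nnQ by (simp add: ennreal_indicator)
  have Qint: "integrable ?N (\<lambda>z. indicator ?Q z :: real)"
    by (rule integrableI_bounded) (use Qm nnQ' in auto)
  have Qval: "(\<integral>z. indicator ?Q z \<partial>?N) = (d / \<tau>) ^ m"
    by (subst integral_eq_nn_integral) (use Qm nnQ' d \<tau>_pos in auto)
  have Fint: "integrable ?N (\<lambda>z. indicator ?Q z * (?P z * ?E z))"
  proof (rule Bochner_Integration.integrable_bound)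
    show "integrable ?N (\<lambda>z. indicator ?Q z * (PB d * EB d))" using Qint by simp
    show "(\<lambda>z. indicator ?Q z * (?P z * ?E z)) \<in> borel_measurable ?N"
      by (rule borel_measurable_times[OF Qm PEm])
    have nn: "0 \<le> PB (- d) * EB (- d)" unfolding PB_def EB_def using c by (intro mult_nonneg_nonneg prod_nonneg) auto
    show "AE z in ?N. norm (indicator ?Q z * (?P z * ?E z)) \<le> norm (indicator ?Q z * (PB d * EB d))"
    proof (rule AE_I2)
      fix z
      show "norm (indicator ?Q z * (?P z * ?E z)) \<le> norm (indicator ?Q z * (PB d * EB d))"
      proof (cases "z \<in> ?Q")
        case True
        have "0 \<le> ?P z * ?E z" "?P z * ?E z \<le> PB d * EB d" "0 \<le> PB d * EB d"
          using bd[OF True] nn by linarith+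
        then show ?thesis using True by (simp only: indicator_simps mult_1_left real_norm_def abs_of_nonneg)
      qed simp
    qed
  qed
  have lo: "(d / \<tau>) ^ m * (PB (- d) * EB (- d)) \<le> eml_A \<alpha> l (gap_points t d) (evens m) ?k"
  proof -
    have "(\<integral>z. indicator ?Q z * (PB (- d) * EB (- d)) \<partial>?N) \<le> (\<integral>z. indicator ?Q z * (?P z * ?E z) \<partial>?N)"
      by (intro integral_mono Fint) (use Qint bd in \<open>auto simp: indicator_def\<close>)
    then show ?thesis unfolding A using Qval by simp
  qed
  have hi: "eml_A \<alpha> l (gap_points t d) (evens m) ?k \<le> (d / \<tau>) ^ m * (PB d * EB d)"
  proof -
    have "(\<integral>z. indicator ?Q z * (?P z * ?E z) \<partial>?N) \<le> (\<integral>z. indicator ?Q z * (PB d * EB d) \<partial>?N)"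
      by (intro integral_mono Fint) (use Qint bd in \<open>auto simp: indicator_def\<close>)
    then show ?thesis unfolding A using Qval by simp
  qed
  have conv: "\<tau> powr (\<alpha> * (real m - 1) + 1) * ((d / \<tau>) ^ m * (PB \<epsilon> * EB \<epsilon>)) = d ^ m * kernel_bound \<alpha> l m t \<epsilon>"
    if "\<epsilon> = d \<or> \<epsilon> = - d" for \<epsilon>
  proof -
    have "0 < t j - t (j - 1) - \<epsilon>" if "j \<in> {2..m}" for j
      using gap[of j] that \<open>\<epsilon> = d \<or> \<epsilon> = - d\<close> d by auto
    from prod_powr_scale[OF this]
    have "d ^ m * kernel_bound \<alpha> l m t \<epsilon> = d ^ m * (PB \<epsilon> * \<tau> powr (\<alpha> * (real m - 1) + 1) / \<tau> ^ m) * EB \<epsilon>"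
      by (simp add: kernel_bound_def PB_def EB_def)
    then show ?thesis by (simp add: power_divide)
  qed
  show "d ^ m * kernel_bound \<alpha> l m t (- d) \<le> W"
    using mult_left_mono[OF lo, of "\<tau> powr (\<alpha> * (real m - 1) + 1)"] conv[of "- d"] by (simp add: W_def)
  show "W \<le> d ^ m * kernel_bound \<alpha> l m t d"
    using mult_left_mono[OF hi, of "\<tau> powr (\<alpha> * (real m - 1) + 1)"] conv[of d] by (simp add: W_def)
qed

end

section \<open>Mixed moments of the increments of X\<close>

lemma sum_up_to_double:
  fixes f :: "nat \<Rightarrow> 'a::comm_monoid_add"
  shows "(\<Sum>j=1..2*n. f j) = (\<Sum>i=1..n. f (2 * i - 1) + f (2 * i))"
  by (induction n) (simp_all add: add.assoc)

lemma prod_exp_minus_one: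
  fixes x :: "'i \<Rightarrow> real"
  assumes "finite I"
  shows "(\<Prod>i\<in>I. exp (x i) - 1) = (\<Sum>T\<in>Pow I. (- 1) ^ (card I - card T) * exp (\<Sum>i\<in>T. x i))"
proof -
  have "(\<Prod>i\<in>I. exp (x i) + (- 1)) = (\<Sum>T\<in>Pow I. (\<Prod>i\<in>T. exp (x i)) * (\<Prod>i\<in>I-T. - 1))"
    by (rule prod_add[OF assms])
  also have "\<dots> = (\<Sum>T\<in>Pow I. (- 1) ^ (card I - card T) * exp (\<Sum>i\<in>T. x i))"
  proof (rule sum.cong[OF refl])
    fix T assume "T \<in> Pow I"
    then have "T \<subseteq> I" "finite T" using assms finite_subset by auto
    then show "(\<Prod>i\<in>T. exp (x i)) * (\<Prod>i\<in>I-T. - 1) = (- 1) ^ (card I - card T) * exp (\<Sum>i\<in>T. x i)"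
      by (simp add: exp_sum card_Diff_subset)
  qed
  finally show ?thesis by simp
qed

section \<open>Power series over families of positive integers\<close>

lemma has_sum_prod_geometric_PiE:
  fixes z :: real
  assumes "finite I" and z: "0 < z" "z < 1"
  shows "((\<lambda>k. \<Prod>i\<in>I. z ^ k i) has_sum (z / (1 - z)) ^ card I) (PiE I (\<lambda>_. {1..}))"
proof -
  have "(\<lambda>n. z ^ n) sums (1 / (1 - z))" using z by (intro geometric_sums) auto
  then have "((\<lambda>n. z ^ n) has_sum (1 / (1 - z))) UNIV"
    using z by (intro sums_nonneg_imp_has_sum) auto
  then have "((\<lambda>n. z ^ n) has_sum (1 / (1 - z) - z ^ 0)) (UNIV - {0})"
    by (intro has_sum_Diff) (auto intro: has_sum_finiteI)
  also have "1 / (1 - z) - z ^ 0 = z / (1 - z)" using z by (simp add: field_simps)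
  also have "UNIV - {0} = {1::nat..}" by auto
  finally have g: "((\<lambda>n. z ^ n) has_sum (z / (1 - z))) {1..}" .
  then have gi: "infsum (\<lambda>n. z ^ n) {1..} = z / (1 - z)" by (rule infsumI)
  have "(\<lambda>n. norm (z ^ n)) summable_on {1..}"
    using has_sum_imp_summable[OF g] z by simp
  then have eq: "infsum (\<lambda>k. \<Prod>i\<in>I. z ^ k i) (PiE I (\<lambda>_. {1..})) = (z / (1 - z)) ^ card I"
    using infsum_prod_PiE_abs[of I "\<lambda>_ n. z ^ n" "\<lambda>_. {1..}"] assms gi by simp
  \<comment> \<open>A sum that does not converge has \<open>infsum\<close> 0 by convention, so a
    nonzero value proves summability.\<close>
  moreover have "(z / (1 - z)) ^ card I \<noteq> 0" using z by simp
  ultimately have "(\<lambda>k. \<Prod>i\<in>I. z ^ k i) summable_on (PiE I (\<lambda>_. {1..}))"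
    using infsum_not_exists by fastforce
  then show ?thesis using eq summable_iff_has_sum_infsum by metis
qed

text \<open>A family of positive integers has total degree at least \<open>card I\<close>, with
  equality only for the family of ones. After division by \<open>r n ^ card I\<close> every other
  term keeps a positive power of \<open>r n\<close>, and the geometric majorant makes these terms
  vanish together.\<close>

lemma infsum_lowest_term_limit:
  fixes w :: "('i \<Rightarrow> nat) \<Rightarrow> real"
  assumes fin: "finite I" and B: "0 < B"
    and w: "\<And>k. k \<in> PiE I (\<lambda>_. {1..}) \<Longrightarrow> \<bar>w k\<bar> \<le> K * B ^ (\<Sum>i\<in>I. k i)"
    and r: "\<And>n. 0 < r n" "r \<longlonglongrightarrow> 0"
  shows "(\<lambda>n. (\<Sum>\<^sub>\<infinity>k\<in>PiE I (\<lambda>_. {1..}). w k * (\<Prod>i\<in>I. r n ^ k i)) / r n ^ card I)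
    \<longlonglongrightarrow> w (restrict (\<lambda>_. 1) I)"
proof -
  let ?P = "PiE I (\<lambda>_. {1::nat..})" and ?o = "restrict (\<lambda>_. 1) I :: 'i \<Rightarrow> nat"
  let ?s = "\<lambda>n. \<Sum>\<^sub>\<infinity>k\<in>?P. w k * (\<Prod>i\<in>I. r n ^ k i)"
  have o: "?o \<in> ?P" by auto
  have K: "0 \<le> K"
  proof -
    have "0 \<le> K * B ^ (\<Sum>i\<in>I. ?o i)" using w[OF o] abs_ge_zero order_trans by blast
    then show ?thesis using zero_less_power[OF B, of "\<Sum>i\<in>I. ?o i"] by (meson mult_neg_pos not_le)
  qed
  \<comment> \<open>The geometric majorant minus its leading term is \<open>z ^ card I\<close> times
    \<open>e z\<close>, up to the factor \<open>K\<close>, and \<open>e z\<close> tends to 0 with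
    \<open>z\<close>.\<close>
  define e where "e z = (1 / (1 - z)) ^ card I - 1" for z :: real
  have est: "\<bar>?s n / r n ^ card I - w ?o\<bar> \<le> K * B ^ card I * e (B * r n)" if n: "B * r n < 1" for n
  proof -
    let ?z = "B * r n"
    have z: "0 < ?z" "?z < 1" using B r n by auto
    let ?f = "\<lambda>k. w k * (\<Prod>i\<in>I. r n ^ k i)" and ?g = "\<lambda>k. K * (\<Prod>i\<in>I. ?z ^ k i)"
    have bd: "\<bar>?f k\<bar> \<le> ?g k" if "k \<in> ?P" for k
    proof -
      have "\<bar>?f k\<bar> = \<bar>w k\<bar> * (\<Prod>i\<in>I. r n ^ k i)"
        using r(1)[of n] by (simp add: abs_mult abs_prod)
      also have "\<dots> \<le> (K * B ^ (\<Sum>i\<in>I. k i)) * (\<Prod>i\<in>I. r n ^ k i)"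
        using w[OF that] r(1)[of n] by (intro mult_right_mono prod_nonneg) (auto intro: less_imp_le)
      also have "\<dots> = ?g k" by (simp add: power_sum power_mult_distrib prod.distrib)
      finally show ?thesis .
    qed
    have g: "(?g has_sum K * (?z / (1 - ?z)) ^ card I) ?P"
      by (intro has_sum_cmult_right has_sum_prod_geometric_PiE fin z)
    have gD: "(?g has_sum (K * (?z / (1 - ?z)) ^ card I - K * ?z ^ card I)) (?P - {?o})"
    proof (rule has_sum_Diff[OF g])
      have "?g ?o = K * ?z ^ card I" by simp
      then show "(?g has_sum K * ?z ^ card I) {?o}" by (intro has_sum_finiteI) auto
    qed (use o in auto)
    have fs: "?f summable_on ?P"
    proof (rule abs_summable_summable)
      show "(\<lambda>k. norm (?f k)) summable_on ?P"
        by (rule summable_on_comparison_test[OF has_sum_imp_summable[OF g]]) (use bd in auto)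
    qed
    have "?s n = infsum ?f (?P - {?o}) + ?f ?o"
      using infsum_Diff[OF fs, of "{?o}"] o by simp
    also have "?f ?o = w ?o * r n ^ card I" by simp
    finally have d: "?s n - w ?o * r n ^ card I = infsum ?f (?P - {?o})" by linarith
    have fD: "(\<lambda>k. norm (?f k)) summable_on (?P - {?o})"
      by (rule summable_on_comparison_test[OF has_sum_imp_summable[OF gD]]) (use bd in auto)
    have "\<bar>infsum ?f (?P - {?o})\<bar> \<le> infsum (\<lambda>k. \<bar>?f k\<bar>) (?P - {?o})"
      using norm_infsum_bound[OF fD] by simp
    also have "\<dots> \<le> infsum ?g (?P - {?o})"
      using fD has_sum_imp_summable[OF gD] bd by (intro infsum_mono) auto
    also have "\<dots> = K * (?z / (1 - ?z)) ^ card I - K * ?z ^ card I" by (rule infsumI[OF gD])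
    also have "\<dots> = r n ^ card I * (K * B ^ card I * e ?z)"
      by (simp add: e_def power_divide power_mult_distrib algebra_simps)
    finally have "\<bar>?s n - w ?o * r n ^ card I\<bar> \<le> r n ^ card I * (K * B ^ card I * e ?z)"
      using d by simp
    moreover have "?s n / r n ^ card I - w ?o = (?s n - w ?o * r n ^ card I) / r n ^ card I"
      using r(1)[of n] by (simp add: diff_divide_distrib)
    ultimately show ?thesis using r(1)[of n] by (simp add: abs_divide pos_divide_le_eq mult.commute)
  qed
  have z0: "(\<lambda>n. B * r n) \<longlonglongrightarrow> 0" using tendsto_mult_right_zero[OF r(2)] by simp
  have "(\<lambda>n. K * B ^ card I * e (B * r n)) \<longlonglongrightarrow> K * B ^ card I * ((1 / (1 - 0)) ^ card I - 1)"
    unfolding e_def by (intro tendsto_intros z0) auto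
  then have lim: "(\<lambda>n. K * B ^ card I * e (B * r n)) \<longlonglongrightarrow> 0" by simp
  have ev: "\<forall>\<^sub>F n in sequentially. B * r n < 1" using z0 by (rule order_tendstoD) simp
  have "(\<lambda>n. ?s n / r n ^ card I - w ?o) \<longlonglongrightarrow> 0"
  proof (rule Lim_null_comparison[OF _ lim])
    show "\<forall>\<^sub>F n in sequentially. norm (?s n / r n ^ card I - w ?o) \<le> K * B ^ card I * e (B * r n)"
      using ev by eventually_elim (use est in auto)
  qed
  then show ?thesis using LIM_zero_iff by blast
qed

lemma exp_diff_quotient_limit:
  fixes x :: real
  assumes "\<And>n. r n \<noteq> 0" "r \<longlonglongrightarrow> 0"
  shows "(\<lambda>n. (exp (r n * x) - 1) / r n) \<longlonglongrightarrow> x"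
proof -
  have "((\<lambda>h. exp (h * x)) has_real_derivative x) (at 0)"
    by (auto intro!: derivative_eq_intros)
  then have "((\<lambda>h. (exp (h * x) - 1) / h) \<longlongrightarrow> x) (at 0)"
    by (simp add: DERIV_def)
  moreover have "filterlim r (at 0) sequentially"
    using assms by (simp add: filterlim_at)
  ultimately show ?thesis by (rule filterlim_compose)
qed

text \<open>From \<open>1 - y \<le> exp (- y)\<close> the quotient is at most
  \<open>x * exp (r * x)\<close>, and \<open>x \<le> exp x\<close> turns this into a majorant free
  of \<open>r\<close>. Exponentials of the increments are integrable by the generating
  function.\<close>

lemma exp_diff_quotient_le:
  fixes x r :: real
  assumes "0 \<le> x" "0 < r" "r \<le> 1"
  shows "0 \<le> (exp (r * x) - 1) / r" "(exp (r * x) - 1) / r \<le> exp (2 * x)"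
proof -
  show "0 \<le> (exp (r * x) - 1) / r" using assms by simp
  have "1 - r * x \<le> exp (- (r * x))" using exp_ge_add_one_self[of "- (r * x)"] by simp
  then have "exp (r * x) * (1 - r * x) \<le> exp (r * x) * exp (- (r * x))" by (intro mult_left_mono) auto
  then have "exp (r * x) - 1 \<le> r * (x * exp (r * x))"
    by (simp add: algebra_simps flip: exp_add)
  then have "(exp (r * x) - 1) / r \<le> x * exp (r * x)"
    using assms by (simp add: pos_divide_le_eq mult.commute)
  also have "\<dots> \<le> exp x * exp x"
  proof (rule mult_mono)
    show "x \<le> exp x" using exp_ge_add_one_self[of x] by linarith
    show "exp (r * x) \<le> exp x" using assms by (simp add: mult_left_le_one_le)
  qed auto
  finally show "(exp (r * x) - 1) / r \<le> exp (2 * x)" by (simp flip: exp_add)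
qed

lemma elt_mem:
  assumes "finite C" "1 \<le> i" "i \<le> card C" shows "elt C i \<in> C"
proof -
  have "sorted_list_of_set C ! (i - 1) \<in> set (sorted_list_of_set C)"
    using assms by (intro nth_mem) auto
  then show ?thesis using assms by (simp add: elt_def)
qed

lemma mem_imp_elt:
  assumes "finite C" "e \<in> C" obtains i where "1 \<le> i" "i \<le> card C" "elt C i = e"
proof -
  have "e \<in> set (sorted_list_of_set C)" using assms by simp
  then obtain j where "j < length (sorted_list_of_set C)" "sorted_list_of_set C ! j = e"
    by (metis in_set_conv_nth)
  then show ?thesis using assms by (intro that[of "Suc j"]) (auto simp: elt_def)
qed

lemma abs_one_plus_le_exp:
  fixes x :: real
  assumes "0 \<le> x" shows "\<bar>1 + x\<bar> \<le> exp (2 * x)"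
  using exp_ge_add_one_self[of "2 * x"] assms by linarith

section \<open>The generating function on the interlaced grid\<close>

locale eml_gap_config = gap_config \<alpha> l d m t + prob_space M
  for \<alpha> l d :: real and m :: nat and t :: "nat \<Rightarrow> real" and M :: "'a measure" +
  fixes X :: "real \<Rightarrow> 'a \<Rightarrow> real" and b T :: real
  assumes eml: "eml_process M \<alpha> l b T X" and tT: "t m \<le> T"
begin

abbreviation D :: "nat \<Rightarrow> 'a \<Rightarrow> real" where "D i \<omega> \<equiv> X (t i) \<omega> - X (t i - d) \<omega>"
abbreviation a :: real where "a \<equiv> eml_a \<alpha> l b T"
abbreviation gp :: "nat \<Rightarrow> real" where "gp \<equiv> gap_points t d"

lemma gp_strict_mono: "i < j \<Longrightarrow> j \<le> 2 * m \<Longrightarrow> gp i < gp j"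
proof (induction j)
  case (Suc j)
  have step: "gp j < gp (Suc j)"
  proof (cases "even j")
    case True
    then obtain i where i: "j = 2 * i" by (rule evenE)
    have e: "gp (Suc j) = t (Suc i) - d" using gap_points_simps(3)[of "Suc i" t d] i by simp
    show ?thesis
    proof (cases "i = 0")
      case True
      then show ?thesis using e i t1 by simp
    next
      case False
      then show ?thesis using e i gap[of "Suc i"] Suc.prems by simp
    qed
  next
    case False
    then obtain i where "j = 2 * i + 1" by (rule oddE)
    then have "gp j = t (Suc i) - d" "gp (Suc j) = t (Suc i)"
      using gap_points_simps(2,3)[of "Suc i" t d] by simp_all
    then show ?thesis using d by simp
  qed
  show ?case
  proof (cases "i = j")
    case False
    then have "gp i < gp j" using Suc by simp
    then show ?thesis using step by simp
  qed (use step in simp)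
qed simp

lemma gp_range: "j \<le> 2 * m \<Longrightarrow> gp j \<in> {0..T}"
proof -
  assume j: "j \<le> 2 * m"
  have "gp (2 * m) = t m" using m by simp
  then have "gp j \<le> T" using gp_strict_mono[of j "2 * m"] j tT by (cases "j = 2 * m") auto
  moreover have "0 \<le> gp j" using gp_strict_mono[of 0 j] j by (cases "j = 0") auto
  ultimately show ?thesis by simp
qed

lemma t_range:
  assumes "i \<in> {1..m}" shows "t i \<in> {0..T}" "t i - d \<in> {0..T}"
  using t_gt_d[of i] t_mono[of i m] tT d assms by auto

lemma measurable_X: "s \<in> {0..T} \<Longrightarrow> X s \<in> borel_measurable M"
  using eml by (simp add: eml_process_def)

lemma measurable_D: "i \<in> {1..m} \<Longrightarrow> D i \<in> borel_measurable M"
  using measurable_X[of "t i"] measurable_X[of "t i - d"] t_range by auto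

lemma X_mono: "AE \<omega> in M. \<forall>s u. 0 \<le> s \<longrightarrow> s \<le> u \<longrightarrow> u \<le> T \<longrightarrow> X s \<omega> \<le> X u \<omega>"
proof -
  have "AE \<omega> in M. mono_on {0..T} (\<lambda>s. X s \<omega>)" using eml by (simp add: eml_process_def)
  then show ?thesis by eventually_elim (auto simp: mono_on_def)
qed

lemma D_nonneg: "AE \<omega> in M. \<forall>i\<in>{1..m}. 0 \<le> D i \<omega>"
  using X_mono
proof eventually_elim
  case (elim \<omega>)
  show ?case
  proof
    fix i assume "i \<in> {1..m}"
    then have "0 \<le> t i - d" "t i \<le> T" using t_range[of i] by auto
    then show "0 \<le> D i \<omega>" using elim[rule_format, of "t i - d" "t i"] d by simp
  qed
qed

text \<open>Opposite exponents at the two ends of each short interval turn a combination of values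
  of \<open>X\<close> into one of the increments \<open>D i\<close>. Each increment keeps its own
  coefficient, so that any subset of them can be switched off.\<close>

definition weights :: "(nat \<Rightarrow> real) \<Rightarrow> nat \<Rightarrow> real" where
  "weights r j = (if even j then r (j div 2) else - r (Suc j div 2))"

lemma weights_simps:
  "weights r (2 * i) = r i" "1 \<le> i \<Longrightarrow> weights r (2 * i - Suc 0) = - r i"
  by (auto simp: weights_def)

lemma sum_weights: "(\<Sum>j=1..2*m. weights r j * X (gp j) \<omega>) = (\<Sum>i=1..m. r i * D i \<omega>)"
  unfolding sum_up_to_double
  by (intro sum.cong refl) (simp add: weights_simps right_diff_distrib)

text \<open>A tail starting at an odd position consists of complete pairs of opposite weights.
  Writing the start as \<open>Suc (2 * i)\<close> makes the empty tail \<open>i = m\<close> the base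
  of the downward induction.\<close>

lemma sum_weights_from_odd: "i \<le> m \<Longrightarrow> (\<Sum>j=Suc (2 * i)..2*m. weights r j) = 0"
proof (induction i rule: inc_induct)
  case (step i)
  have "{Suc (2 * i)..2*m} = insert (2 * Suc i - 1) (insert (2 * Suc i) {Suc (2 * Suc i)..2*m})"
    using step by auto
  then have "(\<Sum>j=Suc (2 * i)..2*m. weights r j)
      = weights r (2 * Suc i - 1) + (weights r (2 * Suc i) + (\<Sum>j=Suc (2 * Suc i)..2*m. weights r j))"
    by simp
  then show ?case using step weights_simps(1)[of r "Suc i"] weights_simps(2)[of "Suc i" r] by simp
qed simp

lemma sum_weights_from_even:
  assumes "1 \<le> i" "i \<le> m" shows "(\<Sum>j=2 * i..2*m. weights r j) = r i"
proof -
  have "{2 * i..2*m} = insert (2 * i) {Suc (2 * i)..2*m}" using assms by auto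
  then show ?thesis using sum_weights_from_odd[OF assms(2), of r] weights_simps(1)[of r i] by simp
qed

lemma integrable_exp_D: "integrable M (\<lambda>\<omega>. exp (\<Sum>i=1..m. r i * D i \<omega>))"
  and expectation_exp_D: "expectation (\<lambda>\<omega>. exp (\<Sum>i=1..m. r i * D i \<omega>))
    = eml_mgf \<alpha> l b T (2 * m) gp (weights r)"
proof -
  have "strict_mono_on {0..2*m} gp" by (rule strict_mono_onI) (use gp_strict_mono in auto)
  then have "integrable M (\<lambda>\<omega>. exp (\<Sum>j=1..2*m. weights r j * X (gp j) \<omega>)) \<and>
    expectation (\<lambda>\<omega>. exp (\<Sum>j=1..2*m. weights r j * X (gp j) \<omega>)) = eml_mgf \<alpha> l b T (2 * m) gp (weights r)"
    using eml m gp_range[of "2 * m"] unfolding eml_process_def by auto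
  then show "integrable M (\<lambda>\<omega>. exp (\<Sum>i=1..m. r i * D i \<omega>))"
    "expectation (\<lambda>\<omega>. exp (\<Sum>i=1..m. r i * D i \<omega>)) = eml_mgf \<alpha> l b T (2 * m) gp (weights r)"
    unfolding sum_weights by auto
qed

text \<open>The partial sums of the exponents vanish at the odd points, so only subsets of the even
  points contribute to the series; inclusion-exclusion isolates the full set.\<close>
lemma expectation_prod_exp_minus_one:
  fixes \<rho> :: real
  shows "expectation (\<lambda>\<omega>. \<Prod>i=1..m. exp (\<rho> * D i \<omega>) - 1) = a *
    (\<Sum>\<^sub>\<infinity>k\<in>{1..m} \<rightarrow>\<^sub>E {1..}. \<tau> powr (\<alpha> * (real (\<Sum>i=1..m. k i) - 1) + 1) *
       eml_A \<alpha> l gp (evens m) k * (\<Prod>i=1..m. \<rho> ^ k i))"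
proof -
  define V where "V C S = (\<Sum>\<^sub>\<infinity>k\<in>{1..card C} \<rightarrow>\<^sub>E {1..}.
            gp (elt C (card C)) powr (\<alpha> * (real (\<Sum>i=1..card C. k i) - 1) + 1) *
            (\<Prod>i=1..card C. S (elt C i) ^ k i) * eml_A \<alpha> l gp C k)" for C and S :: "nat \<Rightarrow> real"
  define B where "B C = V C (\<lambda>_. \<rho>)" for C
  \<comment> \<open>\<open>f {} = 1\<close> absorbs the constant term of the generating function,
    which then is a sum of \<open>f\<close> over subsets, the form needed for Moebius
    inversion.\<close>
  define f where "f E = (if E = {} then 1 else a * B ((\<lambda>i. 2 * i) ` E))" for E
  have main: "expectation (\<lambda>\<omega>. exp (\<Sum>i\<in>E. \<rho> * D i \<omega>)) = sum f (Pow E)" if E: "E \<subseteq> {1..m}" for E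
  proof -
    let ?r = "\<lambda>i. if i \<in> E then \<rho> else 0"
    let ?S = "\<lambda>e. \<Sum>j=e..2*m. weights ?r j"
    let ?E2 = "(\<lambda>i. 2 * i) ` E"
    have finE: "finite E" using E finite_subset by blast
    have S1: "?S e = \<rho>" if "e \<in> ?E2" for e
      using that E sum_weights_from_even[of _ ?r] by auto
    have S0: "?S e = 0" if e: "e \<in> {1..2*m}" "e \<notin> ?E2" for e
    proof (cases "even e")
      case True
      then obtain i where i: "e = 2 * i" by (rule evenE)
      then have "i \<notin> E" using e by auto
      then show ?thesis using i e sum_weights_from_even[of i ?r] by auto
    next
      case False
      then obtain i where "e = 2 * i + 1" by (rule oddE)
      then show ?thesis using e sum_weights_from_odd[of i ?r] by auto
    qed
    have V1: "V C ?S = B C" if C: "C \<subseteq> ?E2" for C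
    proof -
      have "finite C" using C finE finite_subset by blast
      then have "?S (elt C i) = \<rho>" if "i \<in> {1..card C}" for i
        using elt_mem[of C i] that C by (intro S1) auto
      then show ?thesis unfolding B_def V_def
        by (intro infsum_cong arg_cong2[of _ _ _ _ "(*)"] prod.cong refl) simp
    qed
    have V0: "V C ?S = 0" if C: "C \<subseteq> {1..2*m}" "\<not> C \<subseteq> ?E2" for C
    proof -
      have finC: "finite C" using C finite_subset by blast
      obtain e where e: "e \<in> C" "e \<notin> ?E2" using C by blast
      obtain i where i: "1 \<le> i" "i \<le> card C" "elt C i = e" using mem_imp_elt[OF finC e(1)] .
      have z: "?S (elt C i) = 0" using S0[of e] e C i by auto
      show ?thesis unfolding V_def
      proof (rule infsum_0)
        fix k assume "k \<in> {1..card C} \<rightarrow>\<^sub>E {1::nat..}"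
        \<comment> \<open>Positivity of \<open>k i\<close> matters: a vanishing tail sum raised to
          the power 0 would be 1.\<close>
        then have "1 \<le> k i" using i by (auto simp: PiE_def Pi_def)
        then have "?S (elt C i) ^ k i = 0" using z by simp
        then have "(\<Prod>i=1..card C. ?S (elt C i) ^ k i) = 0"
          using i by (intro prod_zero bexI[of _ i]) auto
        then show "gp (elt C (card C)) powr (\<alpha> * (real (\<Sum>i=1..card C. k i) - 1) + 1) *
            (\<Prod>i=1..card C. ?S (elt C i) ^ k i) * eml_A \<alpha> l gp C k = 0" by simp
      qed
    qed
    have "expectation (\<lambda>\<omega>. exp (\<Sum>i\<in>E. \<rho> * D i \<omega>)) = expectation (\<lambda>\<omega>. exp (\<Sum>i=1..m. ?r i * D i \<omega>))"
    proof -
      have "(\<Sum>i\<in>E. \<rho> * D i \<omega>) = (\<Sum>i=1..m. ?r i * D i \<omega>)" for \<omega>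
        using E by (intro sum.mono_neutral_cong_left) auto
      then show ?thesis by simp
    qed
    also have "\<dots> = eml_mgf \<alpha> l b T (2 * m) gp (weights ?r)" by (rule expectation_exp_D)
    also have "\<dots> = 1 + a * (\<Sum>C\<in>Pow {1..2*m} - {{}}. V C ?S)"
      unfolding eml_mgf_def V_def ..
    also have "(\<Sum>C\<in>Pow {1..2*m} - {{}}. V C ?S) = (\<Sum>C\<in>Pow ?E2 - {{}}. B C)"
    proof (rule sum.mono_neutral_cong_right)
      show "Pow ?E2 - {{}} \<subseteq> Pow {1..2*m} - {{}}" using E by fastforce
    qed (use V0 V1 in auto)
    also have "\<dots> = (\<Sum>E'\<in>Pow E - {{}}. B ((\<lambda>i. 2 * i) ` E'))"
    proof -
      have inj: "inj ((*) (2::nat))" by (simp add: inj_def)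
      have "Pow ?E2 - {{}} = (\<lambda>E'. (\<lambda>i. 2 * i) ` E') ` (Pow E - {{}})"
        unfolding image_Pow_surj[OF refl, symmetric] by (auto simp: image_set_diff)
      then show ?thesis
        using inj_on_image_Pow[of "(*) 2" E] inj
        by (simp add: sum.reindex inj_on_def inj_image_eq_iff)
    qed
    also have "1 + a * \<dots> = sum f (Pow E)"
    proof -
      have "sum f (Pow E) = f {} + sum f (Pow E - {{}})"
        using finE by (intro sum.remove) auto
      also have "sum f (Pow E - {{}}) = (\<Sum>E'\<in>Pow E - {{}}. a * B ((\<lambda>i. 2 * i) ` E'))"
        by (intro sum.cong) (auto simp: f_def)
      finally show ?thesis by (simp add: f_def sum_distrib_left)
    qed
    finally show ?thesis .
  qed
  have intE: "integrable M (\<lambda>\<omega>. exp (\<Sum>i\<in>E. \<rho> * D i \<omega>))" if E: "E \<subseteq> {1..m}" for E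
  proof -
    have "(\<Sum>i\<in>E. \<rho> * D i \<omega>) = (\<Sum>i=1..m. (if i \<in> E then \<rho> else 0) * D i \<omega>)" for \<omega>
      using E by (intro sum.mono_neutral_cong_left) auto
    then show ?thesis using integrable_exp_D[of "\<lambda>i. if i \<in> E then \<rho> else 0"] by simp
  qed
  have "expectation (\<lambda>\<omega>. \<Prod>i=1..m. exp (\<rho> * D i \<omega>) - 1)
      = expectation (\<lambda>\<omega>. \<Sum>E\<in>Pow {1..m}. (- 1) ^ (card {1..m} - card E) * exp (\<Sum>i\<in>E. \<rho> * D i \<omega>))"
    by (subst prod_exp_minus_one) auto
  also have "\<dots> = (\<Sum>E\<in>Pow {1..m}. expectation (\<lambda>\<omega>. (- 1) ^ (card {1..m} - card E) * exp (\<Sum>i\<in>E. \<rho> * D i \<omega>)))"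
    using intE by (intro Bochner_Integration.integral_sum) auto
  also have "\<dots> = (\<Sum>E\<in>Pow {1..m}. (- 1) ^ (card {1..m} - card E) * sum f (Pow E))"
    using main by (intro sum.cong) auto
  also have "\<dots> = f {1..m}"
    by (rule inclusion_exclusion_mobius[symmetric]) auto
  also have "\<dots> = a * B (evens m)"
    using m by (auto simp: f_def evens_def)
  also have "B (evens m) = (\<Sum>\<^sub>\<infinity>k\<in>{1..m} \<rightarrow>\<^sub>E {1..}. \<tau> powr (\<alpha> * (real (\<Sum>i=1..m. k i) - 1) + 1) *
       eml_A \<alpha> l gp (evens m) k * (\<Prod>i=1..m. \<rho> ^ k i))"
    using m unfolding B_def V_def card_evens elt_evens[OF m order_refl] gap_points_simps(2)[OF m]
    by (simp add: mult_ac)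
  finally show ?thesis .
qed

lemma integrable_dominated_by_exp_D:
  assumes f: "f \<in> borel_measurable M"
    and bd: "\<And>\<omega>. (\<forall>i\<in>{1..m}. 0 \<le> D i \<omega>) \<Longrightarrow> \<bar>f \<omega>\<bar> \<le> (\<Prod>i=1..m. exp (2 * D i \<omega>))"
  shows "integrable M f"
proof (rule Bochner_Integration.integrable_bound[OF integrable_exp_D[of "\<lambda>_. 2"] f])
  show "AE \<omega> in M. norm (f \<omega>) \<le> norm (exp (\<Sum>i=1..m. 2 * D i \<omega>))"
    using D_nonneg
  proof eventually_elim
    case (elim \<omega>)
    have "\<bar>f \<omega>\<bar> \<le> (\<Prod>i=1..m. exp (2 * D i \<omega>))" using elim by (rule bd)
    also have "\<dots> = exp (\<Sum>i=1..m. 2 * D i \<omega>)" by (simp only: exp_sum finite_atLeastAtMost)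
    finally show ?case by (simp only: real_norm_def abs_exp_cancel)
  qed
qed

text \<open>This is the integrability that the subordination step asks for.\<close>

lemma integrable_prod_one_plus_D: "integrable M (\<lambda>\<omega>. \<Prod>i=1..m. 1 + D i \<omega>)"
proof (rule integrable_dominated_by_exp_D)
  show "(\<lambda>\<omega>. \<Prod>i=1..m. 1 + D i \<omega>) \<in> borel_measurable M"
    by (intro borel_measurable_prod borel_measurable_add borel_measurable_const measurable_D)
  fix \<omega> assume nn: "\<forall>i\<in>{1..m}. 0 \<le> D i \<omega>"
  have "(\<Prod>i=1..m. \<bar>1 + D i \<omega>\<bar>) \<le> (\<Prod>i=1..m. exp (2 * D i \<omega>))"
  proof (intro prod_mono conjI)
    fix i assume "i \<in> {1..m}"
    then have "0 \<le> D i \<omega>" using nn by blast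
    then show "\<bar>1 + D i \<omega>\<bar> \<le> exp (2 * D i \<omega>)" by (rule abs_one_plus_le_exp)
  qed simp
  then show "\<bar>\<Prod>i=1..m. 1 + D i \<omega>\<bar> \<le> (\<Prod>i=1..m. exp (2 * D i \<omega>))" by (simp only: abs_prod)
qed

text \<open>An identity for each admissible \<open>d\<close>, not an asymptotic statement. Both
  sides are limits of the same quantity: of expectations by dominated convergence, of series by
  their lowest term.\<close>

lemma expectation_prod_D:
  "expectation (\<lambda>\<omega>. \<Prod>i=1..m. D i \<omega>) = a * (\<tau> powr (\<alpha> * (real m - 1) + 1) *
     eml_A \<alpha> l gp (evens m) (restrict (\<lambda>_. 1) {1..m}))"
proof -
  define r where "r n = 1 / real (Suc n)" for n
  have r: "0 < r n" "r n \<le> 1" for n by (auto simp: r_def)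
  have r0: "r \<longlonglongrightarrow> 0" unfolding r_def by (intro LIMSEQ_Suc lim_1_over_n)
  define w where "w k = \<tau> powr (\<alpha> * (real (\<Sum>i=1..m. k i) - 1) + 1) * eml_A \<alpha> l gp (evens m) k" for k
  let ?q = "\<lambda>n \<omega>. \<Prod>i=1..m. (exp (r n * D i \<omega>) - 1) / r n"
  have "(\<lambda>n. expectation (?q n)) \<longlonglongrightarrow> expectation (\<lambda>\<omega>. \<Prod>i=1..m. D i \<omega>)"
  proof (rule integral_dominated_convergence)
    show "integrable M (\<lambda>\<omega>. exp (\<Sum>i=1..m. 2 * D i \<omega>))" by (rule integrable_exp_D)
    show "AE \<omega> in M. (\<lambda>n. ?q n \<omega>) \<longlonglongrightarrow> (\<Prod>i=1..m. D i \<omega>)"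
      by (intro AE_I2 tendsto_prod exp_diff_quotient_limit r0) (use r less_imp_neq in fastforce)
    show "AE \<omega> in M. norm (?q n \<omega>) \<le> exp (\<Sum>i=1..m. 2 * D i \<omega>)" for n
      using D_nonneg
    proof eventually_elim
      case (elim \<omega>)
      have "(\<Prod>i=1..m. \<bar>(exp (r n * D i \<omega>) - 1) / r n\<bar>) \<le> (\<Prod>i=1..m. exp (2 * D i \<omega>))"
      proof (intro prod_mono conjI)
        fix i assume "i \<in> {1..m}"
        then have "0 \<le> D i \<omega>" using elim by blast
        from exp_diff_quotient_le[OF this r(1) r(2), of n]
        show "\<bar>(exp (r n * D i \<omega>) - 1) / r n\<bar> \<le> exp (2 * D i \<omega>)" by (simp only: abs_of_nonneg)
      qed simp
      then show ?case by (simp only: real_norm_def abs_prod exp_sum finite_atLeastAtMost)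
    qed
    show "?q n \<in> borel_measurable M" for n
      by (intro borel_measurable_prod borel_measurable_divide borel_measurable_diff borel_measurable_const
          measurable_compose[OF _ borel_measurable_exp] borel_measurable_times measurable_D)
    show "(\<lambda>\<omega>. \<Prod>i=1..m. D i \<omega>) \<in> borel_measurable M"
      by (intro borel_measurable_prod measurable_D)
  qed
  moreover have "expectation (?q n) = a *
      ((\<Sum>\<^sub>\<infinity>k\<in>{1..m} \<rightarrow>\<^sub>E {1..}. w k * (\<Prod>i\<in>{1..m}. r n ^ k i)) / r n ^ card {1..m})" for n
    using expectation_prod_exp_minus_one[of "r n"]
    by (simp add: prod_dividef w_def)
  moreover have "(\<lambda>n. a * ((\<Sum>\<^sub>\<infinity>k\<in>{1..m} \<rightarrow>\<^sub>E {1..}. w k * (\<Prod>i\<in>{1..m}. r n ^ k i)) / r n ^ card {1..m}))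
      \<longlonglongrightarrow> a * w (restrict (\<lambda>_. 1) {1..m})"
  proof -
    obtain K where K: "\<And>k. \<forall>i\<in>{1..m}. 1 \<le> k i \<Longrightarrow> \<bar>eml_A \<alpha> l gp (evens m) k\<bar> \<le> K"
      using eml_A_bounded by blast
    \<comment> \<open>The exponent of \<open>\<tau>\<close> is affine in the total degree: the slope
      yields the base \<open>\<tau> powr \<alpha>\<close>, the intercept the factor
      \<open>\<tau> powr (1 - \<alpha>)\<close>.\<close>
    have wb: "\<bar>w k\<bar> \<le> (\<tau> powr (1 - \<alpha>) * K) * (\<tau> powr \<alpha>) ^ (\<Sum>i\<in>{1..m}. k i)"
      if k: "k \<in> {1..m} \<rightarrow>\<^sub>E {1..}" for k
    proof -
      let ?s = "\<Sum>i=1..m. k i"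
      have "\<tau> powr (\<alpha> * (real ?s - 1) + 1) = \<tau> powr (1 - \<alpha>) * \<tau> powr (\<alpha> * real ?s)"
        unfolding powr_add[symmetric] by (simp add: algebra_simps)
      also have "\<tau> powr (\<alpha> * real ?s) = (\<tau> powr \<alpha>) ^ ?s"
        using \<tau>_pos by (simp add: powr_powr flip: powr_realpow)
      finally have "\<bar>w k\<bar> = \<tau> powr (1 - \<alpha>) * (\<tau> powr \<alpha>) ^ ?s * \<bar>eml_A \<alpha> l gp (evens m) k\<bar>"
        by (simp add: w_def abs_mult)
      also have "\<dots> \<le> \<tau> powr (1 - \<alpha>) * (\<tau> powr \<alpha>) ^ ?s * K"
        using K[of k] k by (intro mult_left_mono) (auto simp: PiE_def Pi_def)
      finally show ?thesis by (simp add: mult_ac)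
    qed
    show ?thesis
      by (intro tendsto_mult_left infsum_lowest_term_limit[OF _ _ wb r(1) r0]) (use \<tau>_pos in auto)
  qed
  ultimately have "expectation (\<lambda>\<omega>. \<Prod>i=1..m. D i \<omega>) = a * w (restrict (\<lambda>_. 1) {1..m})"
    using LIMSEQ_unique by simp
  then show ?thesis by (simp add: w_def)
qed

end

section \<open>Short increments\<close>

lemma eventually_gap_config:
  assumes "0 < \<alpha>" "\<alpha> \<le> 1" "1 \<le> m" "0 < t 1" "strict_mono_on {1..m} t"
  shows "\<forall>\<^sub>F d in at_right 0. gap_config \<alpha> d m t"
proof -
  have 1: "\<forall>\<^sub>F d in at_right 0. 0 < d \<and> d < t 1"
    using assms(4) by (intro eventually_at_rightI[of 0 "t 1"]) auto
  have "\<forall>\<^sub>F d in at_right 0. \<forall>i\<in>{2..m}. t (i - 1) < t i - d"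
  proof (rule eventually_ball_finite)
    show "\<forall>i\<in>{2..m}. \<forall>\<^sub>F d in at_right 0. t (i - 1) < t i - d"
    proof
      fix i assume "i \<in> {2..m}"
      then have "t (i - 1) < t i" by (intro strict_mono_onD[OF assms(5)]) auto
      then show "\<forall>\<^sub>F d in at_right 0. t (i - 1) < t i - d"
        by (intro eventually_at_rightI[of 0 "t i - t (i - 1)"]) auto
    qed
  qed simp
  with 1 show ?thesis
    by eventually_elim (use assms in \<open>auto intro!: gap_config.intro\<close>)
qed

section \<open>Moments of the subordinated process\<close>

locale subordinated_eml = integrable_levy M Y for M :: "'a measure" and Y +
  fixes X Z :: "real \<Rightarrow> 'a \<Rightarrow> real" and \<alpha> l b T :: real
  assumes \<alpha>: "0 < \<alpha>" "\<alpha> \<le> 1"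
    and eml: "eml_process M \<alpha> l b T X"
    and indep: "indep_processes M {0..T} X {0..} Y"
    and Z: "\<And>t \<omega>. Z t \<omega> = Y (X t \<omega>) \<omega>"
begin

abbreviation \<mu> :: real where "\<mu> \<equiv> expectation (Y 1)"
abbreviation a :: real where "a \<equiv> eml_a \<alpha> l b T"

text \<open>Pulling out \<open>d ^ m\<close> and the constants leaves a factor \<open>w\<close>
  confined by \<open>kernel_bound\<close>, which is all that the limit needs to know about
  \<open>eml_A\<close>.\<close>

lemma moment_bounds:
  assumes gc: "gap_config \<alpha> d m t" and tT: "t m \<le> T"
  shows "integrable M (\<lambda>\<omega>. \<Prod>i=1..m. nabla d Z (t i) \<omega>)"
    and "\<exists>w. kernel_bound \<alpha> l m t (- d) \<le> w \<and> w \<le> kernel_bound \<alpha> l m t d \<and>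
      expectation (\<lambda>\<omega>. \<Prod>i=1..m. nabla d Z (t i) \<omega>) / d ^ m = \<mu> ^ m * a * w"
proof -
  interpret G: eml_gap_config \<alpha> l d m t M X b T
    by (intro eml_gap_config.intro eml_gap_config_axioms.intro gc eml tT prob_space_axioms)
  let ?gp = "gap_points t d"
  \<comment> \<open>The step from position \<open>2 * i - 1\<close> to \<open>2 * i\<close> is the
    short interval ending at \<open>t i\<close>. Steps from even positions are the gaps and stay
    outside the product.\<close>
  let ?J = "(\<lambda>i. 2 * i - 1) ` {1..m}"
  have inj: "inj_on (\<lambda>i. 2 * i - 1 :: nat) {1..m}" by (auto simp: inj_on_def)
  have J: "?J \<subseteq> {..<2 * m}" by auto
  have re: "(\<Prod>j\<in>?J. F (?gp (Suc j)) (?gp j)) = (\<Prod>i=1..m. F (t i) (t i - d))" for F :: "real \<Rightarrow> real \<Rightarrow> real"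
    by (subst prod.reindex[OF inj]) (auto intro!: prod.cong)
  have "integrable M (\<lambda>\<omega>. \<Prod>j\<in>?J. 1 + (X (?gp (Suc j)) \<omega> - X (?gp j) \<omega>))"
    using G.integrable_prod_one_plus_D re[of "\<lambda>u v. 1 + (X u _ - X v _)"] by simp
  moreover have "AE \<omega> in M. X (?gp i) \<omega> \<le> X (?gp (Suc i)) \<omega>" if "i < 2 * m" for i
    using G.X_mono
  proof eventually_elim
    case (elim \<omega>)
    then show ?case
      using G.gp_range[of i] G.gp_range[of "Suc i"] G.gp_strict_mono[of i "Suc i"] that by simp
  qed
  moreover have "0 \<le> X s \<omega>" if "s \<in> {0..T}" "\<omega> \<in> space M" for s \<omega>
    using eml that by (simp add: eml_process_def)
  ultimately have i: "integrable M (\<lambda>\<omega>. \<Prod>j\<in>?J. Y (X (?gp (Suc j)) \<omega>) \<omega> - Y (X (?gp j) \<omega>) \<omega>)"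
    and e: "expectation (\<lambda>\<omega>. \<Prod>j\<in>?J. Y (X (?gp (Suc j)) \<omega>) \<omega> - Y (X (?gp j) \<omega>) \<omega>)
      = expectation (\<lambda>\<omega>. \<Prod>j\<in>?J. X (?gp (Suc j)) \<omega> - X (?gp j) \<omega>) * \<mu> ^ card ?J"
    using expectation_subordinated_prod[where p="?gp", OF indep _ G.gp_range _ J] by auto
  show "integrable M (\<lambda>\<omega>. \<Prod>i=1..m. nabla d Z (t i) \<omega>)"
    using i re[of "\<lambda>u v. Y (X u _) _ - Y (X v _) _"] by (simp add: nabla_def Z)
  let ?W = "(t m) powr (\<alpha> * (real m - 1) + 1) *
    eml_A \<alpha> l ?gp (evens m) (restrict (\<lambda>_. 1) {1..m})"
  have "expectation (\<lambda>\<omega>. \<Prod>i=1..m. nabla d Z (t i) \<omega>) = a * ?W * \<mu> ^ m"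
    using e G.expectation_prod_D card_image[OF inj]
      re[of "\<lambda>u v. Y (X u _) _ - Y (X v _) _"] re[of "\<lambda>u v. X u _ - X v _"]
    by (simp add: nabla_def Z)
  then show "\<exists>w. kernel_bound \<alpha> l m t (- d) \<le> w \<and> w \<le> kernel_bound \<alpha> l m t d \<and>
      expectation (\<lambda>\<omega>. \<Prod>i=1..m. nabla d Z (t i) \<omega>) / d ^ m = \<mu> ^ m * a * w"
    using G.eml_A_ones_bounds G.d
    by (intro exI[of _ "?W / d ^ m"]) (simp add: pos_le_divide_eq pos_divide_le_eq mult_ac)
qed

lemma
  assumes m: "1 \<le> m" and t: "0 < t 1" "strict_mono_on {1..m} t" "t m \<le> T"
  shows eventually_integrable_moment:
      "\<forall>\<^sub>F d in at_right 0. integrable M (\<lambda>\<omega>. \<Prod>i=1..m. nabla d Z (t i) \<omega>)"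
    and moment_limit: "((\<lambda>d. expectation (\<lambda>\<omega>. \<Prod>i=1..m. nabla d Z (t i) \<omega>) / d ^ m) \<longlongrightarrow>
      \<mu> ^ m * a * ((\<Prod>j=2..m. eml_c \<alpha> * (t j - t (j - 1)) powr (\<alpha> - 1)) * exp (- l * (t m - t 1))))
      (at_right 0)"
proof -
  have ev: "\<forall>\<^sub>F d in at_right 0. gap_config \<alpha> d m t"
    using eventually_gap_config \<alpha> m t by blast
  then show "\<forall>\<^sub>F d in at_right 0. integrable M (\<lambda>\<omega>. \<Prod>i=1..m. nabla d Z (t i) \<omega>)"
    by eventually_elim (rule moment_bounds(1)[of _ m t, OF _ t(3)])
  \<comment> \<open>Choosing the factor for each \<open>d\<close> makes it a function of
    \<open>d\<close>, to which the squeeze applies.\<close>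
  define w where "w d = (SOME w. kernel_bound \<alpha> l m t (- d) \<le> w \<and> w \<le> kernel_bound \<alpha> l m t d \<and>
      expectation (\<lambda>\<omega>. \<Prod>i=1..m. nabla d Z (t i) \<omega>) / d ^ m = \<mu> ^ m * a * w)" for d
  have w: "kernel_bound \<alpha> l m t (- d) \<le> w d \<and> w d \<le> kernel_bound \<alpha> l m t d \<and>
      expectation (\<lambda>\<omega>. \<Prod>i=1..m. nabla d Z (t i) \<omega>) / d ^ m = \<mu> ^ m * a * w d"
    if "gap_config \<alpha> d m t" for d
    unfolding w_def by (rule someI_ex[OF moment_bounds(2)[of _ m t, OF that t(3)]])
  let ?L = "(\<Prod>j=2..m. eml_c \<alpha> * (t j - t (j - 1)) powr (\<alpha> - 1)) * exp (- l * (t m - t 1))"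
  have kb: "((\<lambda>d. kernel_bound \<alpha> l m t (\<sigma> * d)) \<longlongrightarrow> ?L) (at_right 0)" for \<sigma>
  proof -
    \<comment> \<open>Continuity of \<open>powr\<close> requires a base with nonzero limit, here the
      distance between neighbouring times.\<close>
    have pos: "t j - t (j - 1) - \<sigma> * 0 \<noteq> 0" if "j \<in> {2..m}" for j
    proof -
      have "t (j - 1) < t j" using that by (intro strict_mono_onD[OF t(2)]) auto
      then show ?thesis by simp
    qed
    have "((\<lambda>d. kernel_bound \<alpha> l m t (\<sigma> * d)) \<longlongrightarrow>
      (\<Prod>j=2..m. eml_c \<alpha> * (t j - t (j - 1) - \<sigma> * 0) powr (\<alpha> - 1)) *
        exp (- l * (t m - t 1) + \<bar>l\<bar> * (\<sigma> * 0))) (at_right 0)"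
      unfolding kernel_bound_def
      by (intro tendsto_mult tendsto_prod tendsto_powr tendsto_diff tendsto_exp tendsto_add
          tendsto_const tendsto_ident_at pos)
    then show ?thesis by simp
  qed
  have "(w \<longlongrightarrow> ?L) (at_right 0)"
  proof (rule tendsto_sandwich)
    show "\<forall>\<^sub>F d in at_right 0. kernel_bound \<alpha> l m t (- 1 * d) \<le> w d"
      using ev by eventually_elim (use w in simp)
    show "\<forall>\<^sub>F d in at_right 0. w d \<le> kernel_bound \<alpha> l m t (1 * d)"
      using ev by eventually_elim (use w in simp)
  qed (rule kb)+
  then have "((\<lambda>d. \<mu> ^ m * a * w d) \<longlongrightarrow> \<mu> ^ m * a * ?L) (at_right 0)"
    by (rule tendsto_mult_left)
  moreover have "\<forall>\<^sub>F d in at_right 0. \<mu> ^ m * a * w d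
      = expectation (\<lambda>\<omega>. \<Prod>i=1..m. nabla d Z (t i) \<omega>) / d ^ m"
    using ev by eventually_elim (use w in simp)
  ultimately show "((\<lambda>d. expectation (\<lambda>\<omega>. \<Prod>i=1..m. nabla d Z (t i) \<omega>) / d ^ m) \<longlongrightarrow>
      \<mu> ^ m * a * ?L) (at_right 0)"
    by (rule Lim_transform_eventually)
qed

lemma
  assumes s: "0 < s" "s \<le> T"
  shows eventually_integrable_nabla: "\<forall>\<^sub>F d in at_right 0. integrable M (nabla d Z s)"
    and mean_limit: "((\<lambda>d. expectation (nabla d Z s) / d) \<longlongrightarrow> \<mu> * a) (at_right 0)"
  using eventually_integrable_moment[of 1 "\<lambda>_. s"] moment_limit[of 1 "\<lambda>_. s"] s
  by (simp_all add: strict_mono_on_def)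

lemma
  assumes st: "0 < s" "0 < t" "s + t \<le> T"
  shows eventually_integrable_nabla_mult:
      "\<forall>\<^sub>F d in at_right 0. integrable M (\<lambda>\<omega>. nabla d Z s \<omega> * nabla d Z (s + t) \<omega>)"
    and product_limit: "((\<lambda>d. expectation (\<lambda>\<omega>. nabla d Z s \<omega> * nabla d Z (s + t) \<omega>) / d\<^sup>2) \<longlongrightarrow>
      \<mu>\<^sup>2 * a * eml_c \<alpha> * (exp (- l * t) * t powr (\<alpha> - 1))) (at_right 0)"
proof -
  let ?t = "\<lambda>i::nat. if i = 1 then s else s + t"
  have 12: "{1..2} = {1, 2::nat}" by auto
  have "0 < ?t 1" "strict_mono_on {1..2} ?t" "?t 2 \<le> T" using st by (auto simp: strict_mono_on_def)
  note lims = eventually_integrable_moment[OF _ this] moment_limit[OF _ this]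
  show "\<forall>\<^sub>F d in at_right 0. integrable M (\<lambda>\<omega>. nabla d Z s \<omega> * nabla d Z (s + t) \<omega>)"
    "((\<lambda>d. expectation (\<lambda>\<omega>. nabla d Z s \<omega> * nabla d Z (s + t) \<omega>) / d\<^sup>2) \<longlongrightarrow>
      \<mu>\<^sup>2 * a * eml_c \<alpha> * (exp (- l * t) * t powr (\<alpha> - 1))) (at_right 0)"
    using lims unfolding 12 by (simp_all add: mult_ac)
qed

end

section \<open>Covariance and the final asymptotics\<close>

lemma (in prob_space) covariance_eq:
  fixes U V :: "'a \<Rightarrow> real"
  assumes "integrable M U" "integrable M V" "integrable M (\<lambda>\<omega>. U \<omega> * V \<omega>)"
  shows "covariance M U V = expectation (\<lambda>\<omega>. U \<omega> * V \<omega>) - expectation U * expectation V"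
proof -
  have "(U \<omega> - expectation U) * (V \<omega> - expectation V) =
      U \<omega> * V \<omega> - expectation V * U \<omega> - expectation U * V \<omega> + expectation U * expectation V" for \<omega>
    by (simp add: algebra_simps)
  then show ?thesis unfolding covariance_def using assms by (simp add: prob_space)
qed

text \<open>The logarithmic derivative of \<open>exp (- l * t) * t powr (\<alpha> - 1)\<close> is
  \<open>(\<alpha> - 1) / t - l\<close>, negative up to \<open>T\<close> by the assumption on
  \<open>l\<close>. The proof replaces calculus by \<open>ln (t / T) \<le> t / T - 1\<close>,
  multiplied by the nonpositive factor \<open>\<alpha> - 1\<close>.\<close>

lemma exp_powr_strict_antimono:
  fixes \<alpha> l t T :: real
  assumes "\<alpha> \<le> 1" "0 < t" "t < T" "(\<alpha> - 1) / T < l"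
  shows "exp (- l * T) * T powr (\<alpha> - 1) < exp (- l * t) * t powr (\<alpha> - 1)"
proof -
  have T: "0 < T" using assms by simp
  have "ln t - ln T \<le> t / T - 1"
    using ln_le_minus_one[of "t / T"] assms T by (simp add: ln_div)
  then have "(T - t) / T \<le> ln T - ln t" using T by (simp add: diff_divide_distrib)
  then have "(\<alpha> - 1) * (ln T - ln t) \<le> (\<alpha> - 1) * ((T - t) / T)"
    using assms(1) by (intro mult_left_mono_neg) auto
  also have "\<dots> = (\<alpha> - 1) / T * (T - t)" by simp
  also have "\<dots> < l * (T - t)" using assms by (intro mult_strict_right_mono) auto
  finally have "- l * T + (\<alpha> - 1) * ln T < - l * t + (\<alpha> - 1) * ln t"
    by (simp add: algebra_simps)
  then have "exp (- l * T + (\<alpha> - 1) * ln T) < exp (- l * t + (\<alpha> - 1) * ln t)" by simp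
  moreover have "T powr (\<alpha> - 1) = exp ((\<alpha> - 1) * ln T)" "t powr (\<alpha> - 1) = exp ((\<alpha> - 1) * ln t)"
    using T assms by (simp_all add: powr_def)
  ultimately show ?thesis by (simp only: exp_add)
qed

theorem corollary4p2:
  fixes M :: "'a measure" and X Y Z :: "real \<Rightarrow> 'a \<Rightarrow> real" and \<alpha> l b T :: real
  assumes "prob_space M"
    and "0 < \<alpha>" "\<alpha> \<le> 1" "0 < T" "0 < b" "b \<le> 1" "l > (\<alpha> - 1) / T"
    and "eml_process M \<alpha> l b T X"
    and "levy_process M Y"
    and "indep_processes M {0..T} X {0..} Y"
    and "integrable M (Y 1)" "(\<integral>\<omega>. Y 1 \<omega> \<partial>M) \<noteq> 0"
    and "\<And>t \<omega>. Z t \<omega> = Y (X t \<omega>) \<omega>"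
  shows "(\<exists>c'>0. \<forall>s>0. \<forall>t>0. s + t \<le> T \<longrightarrow>
            ((\<lambda>d. (\<integral>\<omega>. nabla d Z s \<omega> * nabla d Z (s + t) \<omega> \<partial>M) /
                   (c' * d\<^sup>2 * exp (- l * t) * t powr (\<alpha> - 1))) \<longlongrightarrow> 1) (at_right 0) \<and>
            ((\<lambda>d. covariance M (nabla d Z s) (nabla d Z (s + t)) /
                   (c' * d\<^sup>2 * (exp (- l * t) * t powr (\<alpha> - 1)
                                  - b * exp (- l * T) * T powr (\<alpha> - 1)))) \<longlongrightarrow> 1) (at_right 0)) \<and>
         (\<forall>m\<ge>1. \<forall>t :: nat \<Rightarrow> real. 0 < t 1 \<and> strict_mono_on {1..m} t \<and> t m \<le> T \<longrightarrow>
            ((\<lambda>d. (\<integral>\<omega>. (\<Prod>i=1..m. nabla d Z (t i) \<omega>) \<partial>M) /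
                   (\<Prod>i=1..m. \<integral>\<omega>. nabla d Z (t i) \<omega> \<partial>M))
              \<longlongrightarrow> exp (- l * (t m - t 1)) * (eml_c \<alpha> / eml_a \<alpha> l b T) ^ (m - 1) *
                  (\<Prod>i=2..m. (t i - t (i - 1)) powr (\<alpha> - 1))) (at_right 0))"
proof -
  interpret subordinated_eml M Y X Z \<alpha> l b T
    using assms by (simp add: subordinated_eml_def integrable_levy_def integrable_levy_axioms_def
        subordinated_eml_axioms_def)
  have c: "0 < eml_c \<alpha>" using \<alpha> by (simp add: eml_c_def)
  have a: "0 < a" using \<alpha> \<open>0 < T\<close> \<open>0 < b\<close> by (simp add: eml_a_def)
  \<comment> \<open>In the squared mean limit, one of the two factors \<open>a\<close> is split into
    \<open>eml_c \<alpha>\<close>, which completes \<open>c'\<close>, and the term subtracted in the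
    covariance.\<close>
  have ac: "a = eml_c \<alpha> * (b * exp (- l * T) * T powr (\<alpha> - 1))" by (simp add: eml_a_def eml_c_def)
  have \<mu>: "\<mu> \<noteq> 0" by fact
  define c' where "c' = \<mu>\<^sup>2 * a * eml_c \<alpha>"
  have c': "0 < c'" using \<mu> a c by (simp add: c'_def)
  have part1: "((\<lambda>d. expectation (\<lambda>\<omega>. nabla d Z s \<omega> * nabla d Z (s + t) \<omega>) /
          (c' * d\<^sup>2 * exp (- l * t) * t powr (\<alpha> - 1))) \<longlongrightarrow> 1) (at_right 0) \<and>
      ((\<lambda>d. covariance M (nabla d Z s) (nabla d Z (s + t)) /
          (c' * d\<^sup>2 * (exp (- l * t) * t powr (\<alpha> - 1) - b * exp (- l * T) * T powr (\<alpha> - 1))))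
        \<longlongrightarrow> 1) (at_right 0)" if st: "0 < s" "0 < t" "s + t \<le> T" for s t
  proof
    let ?e = "exp (- l * t) * t powr (\<alpha> - 1)" and ?E = "exp (- l * T) * T powr (\<alpha> - 1)"
    have lim: "((\<lambda>d. expectation (\<lambda>\<omega>. nabla d Z s \<omega> * nabla d Z (s + t) \<omega>) / d\<^sup>2) \<longlongrightarrow> c' * ?e) (at_right 0)"
      using product_limit[OF st] by (simp only: c'_def)
    have "((\<lambda>d. expectation (\<lambda>\<omega>. nabla d Z s \<omega> * nabla d Z (s + t) \<omega>) / d\<^sup>2 / (c' * ?e))
        \<longlongrightarrow> c' * ?e / (c' * ?e)) (at_right 0)"
      using c' st by (intro tendsto_divide lim tendsto_const) simp
    then show "((\<lambda>d. expectation (\<lambda>\<omega>. nabla d Z s \<omega> * nabla d Z (s + t) \<omega>) /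
          (c' * d\<^sup>2 * exp (- l * t) * t powr (\<alpha> - 1))) \<longlongrightarrow> 1) (at_right 0)"
      using c' st by (simp add: mult_ac)
    \<comment> \<open>\<open>t < T\<close> holds strictly because \<open>s > 0\<close> and
      \<open>s + t \<le> T\<close>. Together with \<open>b \<le> 1\<close> this makes the bracket
      positive, so that one may divide by it.\<close>
    have "?E < ?e" by (rule exp_powr_strict_antimono) (use st assms in auto)
    moreover have "b * ?E \<le> 1 * ?E" using \<open>b \<le> 1\<close> by (intro mult_right_mono) auto
    ultimately have pos: "0 < ?e - b * ?E" by linarith
    have m1: "((\<lambda>d. expectation (nabla d Z s) / d) \<longlongrightarrow> \<mu> * a) (at_right 0)"
      "((\<lambda>d. expectation (nabla d Z (s + t)) / d) \<longlongrightarrow> \<mu> * a) (at_right 0)"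
      using mean_limit[of s] mean_limit[of "s + t"] st by auto
    \<comment> \<open>Expanding the covariance uses integrability of both increments and of their
      product, available for all sufficiently small \<open>d\<close>.\<close>
    have ev: "\<forall>\<^sub>F d in at_right 0. expectation (\<lambda>\<omega>. nabla d Z s \<omega> * nabla d Z (s + t) \<omega>) / d\<^sup>2
        - (expectation (nabla d Z s) / d) * (expectation (nabla d Z (s + t)) / d)
        = covariance M (nabla d Z s) (nabla d Z (s + t)) / d\<^sup>2"
    proof -
      have "\<forall>\<^sub>F d in at_right 0. integrable M (nabla d Z s)"
        "\<forall>\<^sub>F d in at_right 0. integrable M (nabla d Z (s + t))"
        using eventually_integrable_nabla[of s] eventually_integrable_nabla[of "s + t"] st by auto
      then show ?thesis using eventually_integrable_nabla_mult[OF st]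
        by eventually_elim (simp add: covariance_eq diff_divide_distrib power2_eq_square)
    qed
    have "((\<lambda>d. covariance M (nabla d Z s) (nabla d Z (s + t)) / d\<^sup>2) \<longlongrightarrow>
        c' * ?e - (\<mu> * a) * (\<mu> * a)) (at_right 0)"
      by (rule Lim_transform_eventually[OF _ ev]) (intro tendsto_diff tendsto_mult lim m1)
    also have "c' * ?e - (\<mu> * a) * (\<mu> * a) = c' * (?e - b * ?E)"
    proof -
      have "(\<mu> * a) * (\<mu> * a) = \<mu>\<^sup>2 * a * a" by (simp add: power2_eq_square mult_ac)
      also have "\<dots> = \<mu>\<^sup>2 * a * (eml_c \<alpha> * (b * exp (- l * T) * T powr (\<alpha> - 1)))"
        by (simp only: ac[symmetric])
      finally have sq: "(\<mu> * a) * (\<mu> * a) = \<mu>\<^sup>2 * a * (eml_c \<alpha> * (b * exp (- l * T) * T powr (\<alpha> - 1)))" .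
      show ?thesis unfolding sq by (simp only: c'_def right_diff_distrib mult.assoc)
    qed
    finally have "((\<lambda>d. covariance M (nabla d Z s) (nabla d Z (s + t)) / d\<^sup>2 / (c' * (?e - b * ?E)))
        \<longlongrightarrow> c' * (?e - b * ?E) / (c' * (?e - b * ?E))) (at_right 0)"
      using c' pos by (intro tendsto_divide tendsto_const) auto
    moreover have "c' * (?e - b * ?E) / (c' * (?e - b * ?E)) = 1"
      by (rule divide_self) (use c' pos in simp)
    ultimately have lim': "((\<lambda>d. covariance M (nabla d Z s) (nabla d Z (s + t)) / d\<^sup>2 / (c' * (?e - b * ?E)))
        \<longlongrightarrow> 1) (at_right 0)"
      by (simp only:)
    have "x / d\<^sup>2 / (c' * (?e - b * ?E)) =
        x / (c' * d\<^sup>2 * (exp (- l * t) * t powr (\<alpha> - 1) - b * exp (- l * T) * T powr (\<alpha> - 1)))" for x d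
      by (simp add: mult_ac)
    with lim' show "((\<lambda>d. covariance M (nabla d Z s) (nabla d Z (s + t)) /
          (c' * d\<^sup>2 * (exp (- l * t) * t powr (\<alpha> - 1) - b * exp (- l * T) * T powr (\<alpha> - 1))))
        \<longlongrightarrow> 1) (at_right 0)"
      by (simp only:)
  qed
  have part2: "((\<lambda>d. expectation (\<lambda>\<omega>. \<Prod>i=1..m. nabla d Z (t i) \<omega>) /
        (\<Prod>i=1..m. expectation (nabla d Z (t i))))
      \<longlongrightarrow> exp (- l * (t m - t 1)) * (eml_c \<alpha> / a) ^ (m - 1) *
          (\<Prod>i=2..m. (t i - t (i - 1)) powr (\<alpha> - 1))) (at_right 0)"
    if m: "1 \<le> m" and t: "0 < t 1" "strict_mono_on {1..m} t" "t m \<le> T" for m and t :: "nat \<Rightarrow> real"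
  proof -
    let ?L = "(\<Prod>j=2..m. eml_c \<alpha> * (t j - t (j - 1)) powr (\<alpha> - 1)) * exp (- l * (t m - t 1))"
    have ti: "0 < t i" "t i \<le> T" if "i \<in> {1..m}" for i
    proof -
      have mono: "t j \<le> t k" if "j \<in> {1..m}" "k \<in> {1..m}" "j \<le> k" for j k
        using t(2) that by (cases "j = k") (auto simp: strict_mono_on_def less_imp_le)
      show "0 < t i" "t i \<le> T" using mono[of 1 i] mono[of i m] that m t by auto
    qed
    have "((\<lambda>d. \<Prod>i=1..m. expectation (nabla d Z (t i)) / d) \<longlongrightarrow> (\<Prod>i=1..m. \<mu> * a)) (at_right 0)"
      by (intro tendsto_prod mean_limit ti)
    then have "((\<lambda>d. (\<Prod>i=1..m. expectation (nabla d Z (t i))) / d ^ m) \<longlongrightarrow> (\<mu> * a) ^ m) (at_right 0)"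
      by (simp add: prod_dividef)
    then have "((\<lambda>d. (expectation (\<lambda>\<omega>. \<Prod>i=1..m. nabla d Z (t i) \<omega>) / d ^ m) /
        ((\<Prod>i=1..m. expectation (nabla d Z (t i))) / d ^ m)) \<longlongrightarrow> \<mu> ^ m * a * ?L / (\<mu> * a) ^ m) (at_right 0)"
      by (intro tendsto_divide moment_limit m t) (use \<mu> a in auto)
    moreover have "\<forall>\<^sub>F d in at_right (0::real). (expectation (\<lambda>\<omega>. \<Prod>i=1..m. nabla d Z (t i) \<omega>) / d ^ m) /
        ((\<Prod>i=1..m. expectation (nabla d Z (t i))) / d ^ m) =
        expectation (\<lambda>\<omega>. \<Prod>i=1..m. nabla d Z (t i) \<omega>) / (\<Prod>i=1..m. expectation (nabla d Z (t i)))"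
      by (intro eventually_at_rightI[of 0 1]) auto
    ultimately have "((\<lambda>d. expectation (\<lambda>\<omega>. \<Prod>i=1..m. nabla d Z (t i) \<omega>) /
        (\<Prod>i=1..m. expectation (nabla d Z (t i)))) \<longlongrightarrow> \<mu> ^ m * a * ?L / (\<mu> * a) ^ m) (at_right 0)"
      by (rule Lim_transform_eventually)
    also have "\<mu> ^ m * a * ?L / (\<mu> * a) ^ m = exp (- l * (t m - t 1)) * (eml_c \<alpha> / a) ^ (m - 1) *
          (\<Prod>i=2..m. (t i - t (i - 1)) powr (\<alpha> - 1))"
    proof -
      obtain n where n: "m = Suc n" using m by (cases m) auto
      \<comment> \<open>One of the \<open>m\<close> factors \<open>a\<close> in the denominator
        cancels, which leaves the exponent \<open>m - 1\<close>.\<close>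
      have "a / a ^ m = 1 / a ^ (m - 1)" using a n by simp
      moreover have "\<mu> ^ m * a * ?L / (\<mu> * a) ^ m = a / a ^ m * ?L"
        using \<mu> by (simp add: power_mult_distrib)
      moreover have "?L = exp (- l * (t m - t 1)) * eml_c \<alpha> ^ (m - 1) *
          (\<Prod>i=2..m. (t i - t (i - 1)) powr (\<alpha> - 1))"
        by (simp add: prod.distrib mult_ac)
      ultimately show ?thesis by (simp add: power_divide)
    qed
    finally show ?thesis .
  qed
  show ?thesis
    using c' part1 part2 by (intro conjI exI[of _ c']) auto
qed

end
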